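(* There are convex domains $\Omega$ in the hyperbolic plane $\mathbb{H}^2$ such that $$\lambda_2-\lambda_1<\frac{3\pi^2}{D^2},$$ where $D$ is the diameter of $\Omega$ and $\lambda_1,\lambda_2$ are the first and second Dirichlet eigenvalues of $-\Delta$ on $\Omega$.
   Context: $\mathbb{H}^2$ is the hyperbolic plane of constant curvature $-1$, e.g. the upper half-plane $\{(x,y):y>0\}$ with metric $(dx^2+dy^2)/y^2$. $\Delta$ is its Laplace--Beltrami operator. Domains are bounded (have compact closure), and convex means geodesically convex. The Dirichlet eigenvalues of $-\Delta$ on $\Omega$ (i.e. $\Delta u=-\lambda u$ in $\Omega$, $u=0$ on $\partial\Omega$) are listed in increasing order with multiplicity, $\lambda_1<\lambda_2\le\lambda_3\le\cdots$. The diameter is $D=\sup_{p,q\in\Omega}\mathrm{dist}(p,q)$, with $\mathrm{dist}$ the hyperbolic distance. *)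

theory Defs
  imports "HOL-Analysis.Analysis"
begin

section \<open>Riemannian metrics in one global chart\<close>

text \<open>
  The manifold is an open subset \<open>M\<close> of \<open>real ^ 'n\<close>, and a Riemannian metric is given by its
  coefficient matrix \<open>g p\<close> at each point \<open>p\<close>.
\<close>

definition speed :: "(real ^ 'n \<Rightarrow> real ^ 'n ^ 'n) \<Rightarrow> (real \<Rightarrow> real ^ 'n) \<Rightarrow> real \<Rightarrow> real" where
  "speed g \<gamma> t =
     sqrt (vector_derivative \<gamma> (at t) \<bullet> (g (\<gamma> t) *v vector_derivative \<gamma> (at t)))"

definition curve_length :: "(real ^ 'n \<Rightarrow> real ^ 'n ^ 'n) \<Rightarrow> (real \<Rightarrow> real ^ 'n) \<Rightarrow> real" where
  "curve_length g \<gamma> = integral {0..1} (speed g \<gamma>)"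

text \<open>
  The derivative of a valid path may be unbounded near the finitely many exceptional parameters,
  so that its length may be infinite. Such curves have to be excluded, since \<open>integral\<close> returns 0
  on non-integrable functions.
\<close>

definition curves_between ::
  "(real ^ 'n) set \<Rightarrow> (real ^ 'n \<Rightarrow> real ^ 'n ^ 'n) \<Rightarrow> real ^ 'n \<Rightarrow> real ^ 'n \<Rightarrow> (real \<Rightarrow> real ^ 'n) set"
  where
  "curves_between M g p q =
     {\<gamma>. valid_path \<gamma> \<and> path_image \<gamma> \<subseteq> M \<and> pathstart \<gamma> = p \<and> pathfinish \<gamma> = q \<and>
         speed g \<gamma> integrable_on {0..1}}"

definition riemannian_dist ::
  "(real ^ 'n) set \<Rightarrow> (real ^ 'n \<Rightarrow> real ^ 'n ^ 'n) \<Rightarrow> real ^ 'n \<Rightarrow> real ^ 'n \<Rightarrow> real" where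
  "riemannian_dist M g p q = (INF \<gamma>\<in>curves_between M g p q. curve_length g \<gamma>)"

definition minimizing_geodesic ::
  "(real ^ 'n) set \<Rightarrow> (real ^ 'n \<Rightarrow> real ^ 'n ^ 'n) \<Rightarrow> real ^ 'n \<Rightarrow> real ^ 'n \<Rightarrow> (real \<Rightarrow> real ^ 'n) \<Rightarrow> bool"
  where
  "minimizing_geodesic M g p q \<gamma> \<longleftrightarrow>
     \<gamma> \<in> curves_between M g p q \<and> curve_length g \<gamma> = riemannian_dist M g p q"

definition partial_deriv :: "'n \<Rightarrow> (real ^ 'n \<Rightarrow> real) \<Rightarrow> real ^ 'n \<Rightarrow> real" where
  "partial_deriv i u p = deriv (\<lambda>t. u (p + t *\<^sub>R axis i 1)) 0"

definition C1_on :: "(real ^ 'n) set \<Rightarrow> (real ^ 'n \<Rightarrow> real) \<Rightarrow> bool" where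
  "C1_on S u \<longleftrightarrow>
     (\<forall>p\<in>S. u differentiable (at p)) \<and> (\<forall>i. continuous_on S (partial_deriv i u))"

definition C2_on :: "(real ^ 'n) set \<Rightarrow> (real ^ 'n \<Rightarrow> real) \<Rightarrow> bool" where
  "C2_on S u \<longleftrightarrow> C1_on S u \<and> (\<forall>i. C1_on S (partial_deriv i u))"

definition laplace_beltrami ::
  "(real ^ 'n \<Rightarrow> real ^ 'n ^ 'n) \<Rightarrow> (real ^ 'n \<Rightarrow> real) \<Rightarrow> real ^ 'n \<Rightarrow> real" where
  "laplace_beltrami g u p =
     (\<Sum>i\<in>UNIV. partial_deriv i
        (\<lambda>q. sqrt (det (g q)) * (\<Sum>j\<in>UNIV. matrix_inv (g q) $ i $ j * partial_deriv j u q)) p)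
     / sqrt (det (g p))"


section \<open>Dirichlet eigenvalues\<close>

text \<open>
  A solution of the Dirichlet problem on a bounded \<open>\<Omega>\<close> is a function that is continuous on
  \<open>closure \<Omega>\<close>, zero on \<open>frontier \<Omega>\<close>, and twice continuously differentiable in \<open>\<Omega>\<close>. Extending by
  zero identifies these with the bounded continuous functions on the whole space that vanish off
  \<open>\<Omega>\<close> and are \<open>C\<^sup>2\<close> in \<open>\<Omega>\<close>; this makes the eigenspaces subspaces of a real vector space.
\<close>

definition dirichlet_eigenspace ::
  "(real ^ 'n \<Rightarrow> real ^ 'n ^ 'n) \<Rightarrow> (real ^ 'n) set \<Rightarrow> real \<Rightarrow> ((real ^ 'n) \<Rightarrow>\<^sub>C real) set" where
  "dirichlet_eigenspace g \<Omega> \<mu> =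
     {u. (\<forall>p. p \<notin> \<Omega> \<longrightarrow> apply_bcontfun u p = 0) \<and> C2_on \<Omega> (apply_bcontfun u) \<and>
         (\<forall>p\<in>\<Omega>. laplace_beltrami g (apply_bcontfun u) p = - \<mu> * apply_bcontfun u p)}"

definition dirichlet_spectrum ::
  "(real ^ 'n \<Rightarrow> real ^ 'n ^ 'n) \<Rightarrow> (real ^ 'n) set \<Rightarrow> real set" where
  "dirichlet_spectrum g \<Omega> = {\<mu>. \<exists>u\<in>dirichlet_eigenspace g \<Omega> \<mu>. u \<noteq> 0}"

definition multiplicity_sum ::
  "(real ^ 'n \<Rightarrow> real ^ 'n ^ 'n) \<Rightarrow> (real ^ 'n) set \<Rightarrow> real set \<Rightarrow> nat" where
  "multiplicity_sum g \<Omega> A = (\<Sum>\<mu>\<in>dirichlet_spectrum g \<Omega> \<inter> A. dim (dirichlet_eigenspace g \<Omega> \<mu>))"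

text \<open>
  \<open>\<mu>\<close> is the \<open>k\<close>-th entry, counting from \<open>k = 1\<close>, of the list of eigenvalues in increasing order
  with multiplicity: it is an eigenvalue, fewer than \<open>k\<close> entries are smaller than \<open>\<mu>\<close>, and at
  least \<open>k\<close> entries are at most \<open>\<mu>\<close>. The two finiteness conditions say that the list is well
  defined up to \<open>\<mu>\<close>; they are needed because \<open>sum\<close> and \<open>dim\<close> return 0 in the infinite case.
\<close>

definition is_dirichlet_eigenvalue ::
  "(real ^ 'n \<Rightarrow> real ^ 'n ^ 'n) \<Rightarrow> (real ^ 'n) set \<Rightarrow> nat \<Rightarrow> real \<Rightarrow> bool" where
  "is_dirichlet_eigenvalue g \<Omega> k \<mu> \<longleftrightarrow>
     \<mu> \<in> dirichlet_spectrum g \<Omega> \<and>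
     finite (dirichlet_spectrum g \<Omega> \<inter> {..\<mu>}) \<and>
     (\<forall>\<nu>\<le>\<mu>. \<exists>B. finite B \<and> dirichlet_eigenspace g \<Omega> \<nu> \<subseteq> span B) \<and>
     multiplicity_sum g \<Omega> {..<\<mu>} < k \<and> k \<le> multiplicity_sum g \<Omega> {..\<mu>}"


section \<open>The hyperbolic plane\<close>

definition hyperbolic_plane :: "(real ^ 2) set" where
  "hyperbolic_plane = {p. p $ 2 > 0}"

text \<open>The metric \<open>(dx\<^sup>2 + dy\<^sup>2) / y\<^sup>2\<close>; \<open>mat c\<close> is \<open>c\<close> times the identity matrix.\<close>

definition hyperbolic_metric :: "real ^ 2 \<Rightarrow> real ^ 2 ^ 2" where
  "hyperbolic_metric p = mat (1 / (p $ 2)\<^sup>2)"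

abbreviation hyperbolic_dist :: "real ^ 2 \<Rightarrow> real ^ 2 \<Rightarrow> real" where
  "hyperbolic_dist \<equiv> riemannian_dist hyperbolic_plane hyperbolic_metric"

text \<open>
  Boundedness means compact closure in the hyperbolic plane, not merely in \<open>real ^ 2\<close>.
\<close>

definition hyperbolic_domain :: "(real ^ 2) set \<Rightarrow> bool" where
  "hyperbolic_domain \<Omega> \<longleftrightarrow>
     open \<Omega> \<and> connected \<Omega> \<and> \<Omega> \<noteq> {} \<and> compact (closure \<Omega>) \<and> closure \<Omega> \<subseteq> hyperbolic_plane"

text \<open>
  Any two points of the hyperbolic plane are joined by exactly one geodesic, up to
  reparametrization, and it is minimizing.
\<close>

definition hyperbolic_convex :: "(real ^ 2) set \<Rightarrow> bool" where
  "hyperbolic_convex \<Omega> \<longleftrightarrow>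
     (\<forall>p\<in>\<Omega>. \<forall>q\<in>\<Omega>. \<exists>\<gamma>. minimizing_geodesic hyperbolic_plane hyperbolic_metric p q \<gamma> \<and>
        path_image \<gamma> \<subseteq> \<Omega>)"

definition hyperbolic_diameter :: "(real ^ 2) set \<Rightarrow> real" where
  "hyperbolic_diameter \<Omega> = (SUP (p, q)\<in>\<Omega> \<times> \<Omega>. hyperbolic_dist p q)"

end

theory Submission
  imports Defs
begin

text \<open>
  In the coordinates \<open>x = exp t * sin \<phi>\<close>, \<open>y = exp t * cos \<phi>\<close> the hyperbolic metric is
  \<open>(dt\<^sup>2 + d\<phi>\<^sup>2) / (cos \<phi>)\<^sup>2\<close>. The rectangle \<open>0 < t < L\<close>, \<open>\<bar>\<phi>\<bar> < pi / 4\<close> is convex: it is bounded by two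
  geodesics and by two equidistant curves of the geodesic \<open>\<phi> = 0\<close>. Its diameter is at most
  \<open>L + 3\<close>. The Dirichlet problem separates into \<open>sin (k * pi * t / L) * h \<phi>\<close> with
  \<open>h'' + (\<mu> / (cos \<phi>)\<^sup>2 - \<nu>\<^sub>k) * h = 0\<close> and \<open>\<nu>\<^sub>k = (k * pi / L)\<^sup>2\<close>, and the first two eigenvalues are the
  principal eigenvalues \<open>\<mu>\<^sub>1\<close>, \<open>\<mu>\<^sub>2\<close> of this equation for \<open>k = 1, 2\<close>. Integrating the derivative of the
  Wronskian of \<open>h\<^sub>1\<close> and \<open>h\<^sub>2\<close> gives \<open>(\<mu>\<^sub>2 - \<mu>\<^sub>1) * \<integral> h\<^sub>1 h\<^sub>2 / (cos \<phi>)\<^sup>2 = (\<nu>\<^sub>2 - \<nu>\<^sub>1) * \<integral> h\<^sub>1 h\<^sub>2\<close>, so the gap is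
  smaller than \<open>\<nu>\<^sub>2 - \<nu>\<^sub>1 = 3 * pi\<^sup>2 / L\<^sup>2\<close> by a factor that stays away from 1 as \<open>L\<close> grows, because the
  concave functions \<open>h\<^sub>1\<close>, \<open>h\<^sub>2\<close> cannot concentrate at \<open>\<phi> = 0\<close>. For large \<open>L\<close> this beats \<open>((L + 3) / L)\<^sup>2\<close>.
\<close>

section \<open>Second-order linear equations\<close>

text \<open>Exhibiting two eigenfunctions is the easier half. The \<open>k\<close>-th eigenvalue is
  defined through all classical eigenfunctions, so every other one with eigenvalue at most
  \<open>\<mu>2\<close> has to be excluded as well, although its derivatives are uncontrolled at the
  boundary. Such a function is projected to the sine modes in \<open>t\<close>: each coefficient
  satisfies the transversal equation with zero ends, and completeness of the sines recovers the
  function. For the wrong mode or parameter, the Wronskian with \<open>h\<^sub>1\<close> or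
  \<open>h\<^sub>2\<close> produces an interior zero of the coefficient, hence three zeros in all.
  Three are too many: the principal eigenvalues are at most 5, so the potential is at most 10 on a
  strip of width \<open>pi / 2\<close>. The gain is explicit as well: the factor is
  \<open>1 + 1 / 200\<close> for every \<open>L > 8\<close>, while the diameter exceeds
  \<open>L\<close> by at most the constant 3, so that \<open>L = 2000\<close> is large
  enough.\<close>

definition solves :: "(real \<Rightarrow> real) \<Rightarrow> (real \<Rightarrow> real) \<Rightarrow> (real \<Rightarrow> real) \<Rightarrow> real set \<Rightarrow> bool" where
  "solves q f f' S \<longleftrightarrow>
     (\<forall>x\<in>S. (f has_real_derivative f' x) (at x) \<and> (f' has_real_derivative - (q x * f x)) (at x))"

lemma solvesD:
  assumes "solves q f f' S" "x \<in> S"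
  shows "(f has_real_derivative f' x) (at x)" "(f' has_real_derivative - (q x * f x)) (at x)"
  using assms by (auto simp: solves_def)

lemma solves_continuous_on:
  assumes "solves q f f' S"
  shows "continuous_on S f" "continuous_on S f'"
  using solvesD[OF assms] by (meson DERIV_isCont continuous_at_imp_continuous_on)+

lemma solves_subset: "solves q f f' S \<Longrightarrow> T \<subseteq> S \<Longrightarrow> solves q f f' T"
  by (auto simp: solves_def)

lemma solves_cong:
  assumes "solves q f f' S" "\<And>x. x \<in> S \<Longrightarrow> q x = r x"
  shows "solves r f f' S"
  using assms by (auto simp: solves_def)

lemma solves_diff_scaled:
  assumes "solves q f f' S" "solves q g g' S"
  shows "solves q (\<lambda>x. f x - c * g x) (\<lambda>x. f' x - c * g' x) S"
  unfolding solves_def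
proof (intro ballI conjI)
  fix x assume x: "x \<in> S"
  note d = solvesD[OF assms(1) x] solvesD[OF assms(2) x]
  show "((\<lambda>x. f x - c * g x) has_real_derivative f' x - c * g' x) (at x)"
    by (rule derivative_eq_intros d refl | simp)+
  show "((\<lambda>x. f' x - c * g' x) has_real_derivative - (q x * (f x - c * g x))) (at x)"
    by (rule derivative_eq_intros d refl | simp add: algebra_simps)+
qed

lemma solves_reflect:
  assumes "solves q f f' {-b..b}" "\<And>x. q (- x) = q x"
  shows "solves q (\<lambda>x. f (- x)) (\<lambda>x. - f' (- x)) {-b..b}"
  unfolding solves_def
proof (intro ballI conjI)
  fix x assume "x \<in> {-b..b}"
  then have x: "-x \<in> {-b..b}" by auto
  note d = solvesD[OF assms(1) x]
  show "((\<lambda>x. f (- x)) has_real_derivative - f' (- x)) (at x)"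
    using DERIV_chain2[of f "f' (- x)" uminus x "-1" UNIV] d(1) DERIV_minus[OF DERIV_ident] by auto
  have "((\<lambda>x. f' (- x)) has_real_derivative q x * f (- x)) (at x)"
    using DERIV_chain2[of f' "- (q (- x) * f (- x))" uminus x "-1" UNIV] d(2) assms(2)
      DERIV_minus[OF DERIV_ident] by auto
  then show "((\<lambda>x. - f' (- x)) has_real_derivative - (q x * f (- x))) (at x)"
    by (rule DERIV_minus)
qed

text \<open>The energy \<open>(f x)\<^sup>2 + (f' x)\<^sup>2\<close> changes at most at the relative
  rate \<open>1 + K\<close>, so it vanishes everywhere once it vanishes at \<open>x0\<close>. The
  two directions from \<open>x0\<close> use opposite signs in the exponential weight.\<close>

lemma solves_unique:
  assumes s: "solves q f f' {a..b}" and K: "\<And>x. x \<in> {a..b} \<Longrightarrow> \<bar>q x\<bar> \<le> K"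
    and x0: "x0 \<in> {a..b}" "f x0 = 0" "f' x0 = 0" and x: "x \<in> {a..b}"
  shows "f x = 0"
proof -
  define E where "E = (\<lambda>x. (f x)\<^sup>2 + (f' x)\<^sup>2)"
  define E' where "E' = (\<lambda>x. 2 * f x * f' x * (1 - q x))"
  have dE: "(E has_real_derivative E' y) (at y)" if "y \<in> {a..b}" for y
    unfolding E_def E'_def
    by (rule derivative_eq_intros solvesD[OF s that] refl | simp add: algebra_simps)+
  have bE: "\<bar>E' y\<bar> \<le> (1 + K) * E y" if "y \<in> {a..b}" for y
  proof -
    have "\<bar>2 * f y * f' y\<bar> \<le> E y"
      using sum_squares_bound[of "f y" "f' y"] sum_squares_bound[of "f y" "- f' y"]
      by (auto simp: E_def abs_if)
    moreover have "\<bar>1 - q y\<bar> \<le> 1 + K" using K[OF that] by auto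
    ultimately show ?thesis unfolding E'_def abs_mult[of _ "1 - q y"]
      by (subst mult.commute) (intro mult_mono, auto)
  qed
  have "E x \<le> 0"
  proof (cases "x0 \<le> x")
    case True
    have "E x * exp (- (1 + K) * x) \<le> E x0 * exp (- (1 + K) * x0)"
    proof (rule DERIV_nonpos_imp_nonincreasing[OF True])
      fix y assume "x0 \<le> y" "y \<le> x"
      then have y: "y \<in> {a..b}" using x0 x by auto
      have "((\<lambda>x. E x * exp (- (1 + K) * x)) has_real_derivative
          (E' y - (1 + K) * E y) * exp (- (1 + K) * y)) (at y)"
        by (rule derivative_eq_intros dE[OF y] refl | simp add: algebra_simps)+
      moreover have "(E' y - (1 + K) * E y) * exp (- (1 + K) * y) \<le> 0"
        using bE[OF y] by (simp add: mult_nonpos_nonneg)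
      ultimately show "\<exists>z. ((\<lambda>x. E x * exp (- (1 + K) * x)) has_real_derivative z) (at y) \<and> z \<le> 0"
        by blast
    qed
    then show ?thesis using x0 by (simp add: E_def mult_le_0_iff)
  next
    case False
    then have le: "x \<le> x0" by simp
    have "E x * exp ((1 + K) * x) \<le> E x0 * exp ((1 + K) * x0)"
    proof (rule DERIV_nonneg_imp_nondecreasing[OF le])
      fix y assume "x \<le> y" "y \<le> x0"
      then have y: "y \<in> {a..b}" using x0 x by auto
      have "((\<lambda>x. E x * exp ((1 + K) * x)) has_real_derivative
          (E' y + (1 + K) * E y) * exp ((1 + K) * y)) (at y)"
        by (rule derivative_eq_intros dE[OF y] refl | simp add: algebra_simps)+
      moreover have "(E' y + (1 + K) * E y) * exp ((1 + K) * y) \<ge> 0"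
        using bE[OF y] by simp
      ultimately show "\<exists>z. ((\<lambda>x. E x * exp ((1 + K) * x)) has_real_derivative z) (at y) \<and> 0 \<le> z"
        by blast
    qed
    then show ?thesis using x0 by (simp add: E_def mult_le_0_iff)
  qed
  then show ?thesis by (simp add: E_def sum_power2_le_zero_iff)
qed

text \<open>At a positive interior maximum of \<open>f / w\<close> the Wronskian vanishes and has positive
  derivative, so that \<open>f / w\<close> still increases to the right of it.\<close>

lemma sturm_comparison_le:
  assumes f: "solves q f f' {a..b}" and w: "solves r w w' {a..b}"
    and wpos: "\<And>x. x \<in> {a..b} \<Longrightarrow> w x > 0"
    and qr: "\<And>x. x \<in> {a<..<b} \<Longrightarrow> q x < r x"
    and ends: "f a = 0" "f b = 0" and x: "x \<in> {a..b}"
  shows "f x \<le> 0"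
proof (rule ccontr)
  assume "\<not> f x \<le> 0"
  then have fx: "f x > 0" by simp
  have "continuous_on {a..b} (\<lambda>x. f x / w x)"
    using wpos by (intro continuous_on_divide solves_continuous_on[OF f] solves_continuous_on[OF w]) force
  then obtain m where m: "m \<in> {a..b}" "\<And>y. y \<in> {a..b} \<Longrightarrow> f y / w y \<le> f m / w m"
    using continuous_attains_sup[of "{a..b}" "\<lambda>x. f x / w x"] x by force
  have "f m / w m > 0" using m(2)[OF x] fx wpos[OF x] by (smt (verit) divide_pos_pos)
  then have fm: "f m > 0" using wpos[OF m(1)] by (simp add: zero_less_divide_iff)
  then have mi: "m \<in> {a<..<b}" using ends m(1) by (smt (verit) atLeastAtMost_iff greaterThanLessThan_iff)
  define N where "N = (\<lambda>x. f' x * w x - f x * w' x)"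
  have dv: "((\<lambda>x. f x / w x) has_real_derivative N y / (w y)\<^sup>2) (at y)" if "y \<in> {a..b}" for y
    unfolding N_def using wpos[OF that]
    by (auto intro!: derivative_eq_intros solvesD[OF f that] solvesD[OF w that] simp: power2_eq_square)
  have dN: "(N has_real_derivative (r y - q y) * (f y * w y)) (at y)" if "y \<in> {a..b}" for y
    unfolding N_def
    by (rule derivative_eq_intros solvesD[OF f that] solvesD[OF w that] refl | simp add: algebra_simps)+
  obtain d0 where d0: "d0 > 0" "\<And>y. \<bar>m - y\<bar> < d0 \<Longrightarrow> y \<in> {a..b}"
  proof
    show "min (m - a) (b - m) > 0" using mi by auto
    show "\<And>y. \<bar>m - y\<bar> < min (m - a) (b - m) \<Longrightarrow> y \<in> {a..b}" by (auto simp: abs_if split: if_splits)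
  qed
  have "N m / (w m)\<^sup>2 = 0"
    by (rule DERIV_local_max[OF dv[OF m(1)] d0(1)]) (use m(2) d0(2) in auto)
  then have Nm: "N m = 0" using wpos[OF m(1)] by auto
  have "(r m - q m) * (f m * w m) > 0" using qr[OF mi] fm wpos[OF m(1)] by simp
  then obtain d1 where d1: "d1 > 0" "\<And>h. 0 < h \<Longrightarrow> h < d1 \<Longrightarrow> N m < N (m + h)"
    using DERIV_pos_inc_right[OF dN[OF m(1)]] by blast
  define c where "c = m + min d0 d1 / 2"
  have c: "m < c" "c < m + d0" "c < m + d1" using d0 d1 by (auto simp: c_def)
  have "f m / w m < f c / w c"
  proof (rule DERIV_pos_imp_increasing_open[OF c(1)])
    fix y assume y: "m < y" "y < c"
    then have yi: "y \<in> {a..b}" using d0(2)[of y] c by auto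
    have "N (m + (y - m)) > N m" by (rule d1(2)) (use y c in auto)
    then have "N y / (w y)\<^sup>2 > 0" using Nm wpos[OF yi] by simp
    then show "\<exists>z. ((\<lambda>x. f x / w x) has_real_derivative z) (at y) \<and> 0 < z" using dv[OF yi] by blast
  next
    show "continuous_on {m..c} (\<lambda>x. f x / w x)"
    proof (rule continuous_on_subset[OF \<open>continuous_on {a..b} (\<lambda>x. f x / w x)\<close>], rule subsetI)
      fix y assume "y \<in> {m..c}"
      then have "\<bar>m - y\<bar> < d0" using c by auto
      then show "y \<in> {a..b}" by (rule d0(2))
    qed
  qed
  moreover have "c \<in> {a..b}" by (rule d0(2)) (use c in auto)
  ultimately show False using m(2) by force
qed

lemma sturm_comparison:
  assumes f: "solves q f f' {a..b}" and w: "solves r w w' {a..b}"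
    and "\<And>x. x \<in> {a..b} \<Longrightarrow> w x > 0" "\<And>x. x \<in> {a<..<b} \<Longrightarrow> q x < r x"
    and "f a = 0" "f b = 0" "x \<in> {a..b}"
  shows "f x = 0"
proof -
  have "solves q (\<lambda>x. - f x) (\<lambda>x. - f' x) {a..b}"
    using f unfolding solves_def by (auto intro!: derivative_eq_intros)
  from sturm_comparison_le[OF this w, of x] sturm_comparison_le[OF f w, of x] assms show ?thesis
    by auto
qed

lemma solves_cos: "solves (\<lambda>_. k\<^sup>2) (\<lambda>x. cos (k * (x - c))) (\<lambda>x. - k * sin (k * (x - c))) S"
  unfolding solves_def
  by (auto intro!: derivative_eq_intros simp: power2_eq_square)

text \<open>The comparison function is a cosine of frequency \<open>k\<close> centred at the
  midpoint; on an interval shorter than its half period it stays positive up to both ends.\<close>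

lemma two_zeros_imp_zero:
  assumes f: "solves q f f' {a..b}" and q: "\<And>x. x \<in> {a<..<b} \<Longrightarrow> q x < k\<^sup>2"
    and k: "0 < k" "k * (b - a) < pi"
    and ends: "f a = 0" "f b = 0" "x \<in> {a..b}"
  shows "f x = 0"
proof (rule sturm_comparison[OF f solves_cos[of k "(a + b) / 2"]])
  fix y assume y: "y \<in> {a..b}"
  have "\<bar>y - (a + b) / 2\<bar> \<le> (b - a) / 2" using y by (auto simp: abs_if field_simps)
  then have "\<bar>k * (y - (a + b) / 2)\<bar> \<le> k * ((b - a) / 2)"
    using k by (simp add: abs_mult)
  also have "\<dots> < pi / 2" using k by simp
  finally show "0 < cos (k * (y - (a + b) / 2))"
    by (intro cos_gt_zero_pi) (auto simp: abs_less_iff)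
qed (use assms in auto)

text \<open>The shorter of the two gaps next to \<open>z\<close> has length below
  \<open>pi / k\<close>, so its two end zeros already annihilate \<open>f\<close> there. Its
  midpoint then has zero value and zero slope, and uniqueness spreads this to all of
  \<open>{a..b}\<close>.\<close>

lemma three_zeros_imp_zero:
  assumes f: "solves q f f' {a..b}" and q: "\<And>x. x \<in> {a..b} \<Longrightarrow> q x < k\<^sup>2" "\<And>x. x \<in> {a..b} \<Longrightarrow> \<bar>q x\<bar> \<le> K"
    and k: "0 < k" "k * (b - a) < 2 * pi"
    and zeros: "f a = 0" "f z = 0" "f b = 0" "z \<in> {a<..<b}" and x: "x \<in> {a..b}"
  shows "f x = 0"
proof -
  obtain c d where cd: "a \<le> c" "c < d" "d \<le> b" "f c = 0" "f d = 0" "k * (d - c) < pi"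
  proof (cases "z - a \<le> b - z")
    case True
    have "k * (2 * (z - a)) \<le> k * (b - a)" using True k by (intro mult_left_mono) auto
    then have "k * (z - a) < pi" using k by linarith
    then show ?thesis using that[of a z] zeros by auto
  next
    case False
    have "k * (2 * (b - z)) \<le> k * (b - a)" using False k by (intro mult_left_mono) auto
    then have "k * (b - z) < pi" using k by linarith
    then show ?thesis using that[of z b] zeros by auto
  qed
  have z: "f y = 0" if "y \<in> {c..d}" for y
    by (rule two_zeros_imp_zero[OF solves_subset[OF f] _ k(1) cd(6) cd(4,5) that]) (use cd q in auto)
  define m where "m = (c + d) / 2"
  have m: "c < m" "m < d" using cd by (auto simp: m_def)
  have mab: "m \<in> {a..b}" using m cd by auto
  have "f' m = 0"
  proof (rule DERIV_local_const[OF solvesD(1)[OF f mab]])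
    show "0 < min (m - c) (d - m)" using m by auto
    show "\<forall>y. \<bar>m - y\<bar> < min (m - c) (d - m) \<longrightarrow> f m = f y"
      using z m by (auto simp: abs_if split: if_splits)
  qed
  moreover have "f m = 0" using z m by auto
  ultimately show ?thesis using solves_unique[OF f q(2) mab _ _ x] by blast
qed

section \<open>Integrated Wronskian identities\<close>

lemma has_integral_real_derivative:
  fixes F :: "real \<Rightarrow> real"
  assumes "a \<le> b" "\<And>x. x \<in> {a..b} \<Longrightarrow> (F has_real_derivative f x) (at x)"
  shows "(f has_integral F b - F a) {a..b}"
  using assms(1)
proof (rule fundamental_theorem_of_calculus)
  show "(F has_vector_derivative f x) (at x within {a..b})" if "x \<in> {a..b}" for x
    using assms(2)[OF that]
    by (simp add: has_field_derivative_at_within has_real_derivative_iff_has_vector_derivative[symmetric])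
qed

text \<open>The boundary condition only equates the Wronskians at the two ends. This covers zero
  ends on the whole strip and, for even solutions on half of it, zero slopes at the centre combined
  with a zero outer end.\<close>

lemma wronskian_has_integral:
  assumes f: "solves q f f' {a..b}" and g: "solves r g g' {a..b}" and "a \<le> b"
    and "f b * g' b - f' b * g b = f a * g' a - f' a * g a"
  shows "((\<lambda>x. (q x - r x) * (f x * g x)) has_integral 0) {a..b}"
proof -
  have "((\<lambda>x. (q x - r x) * (f x * g x)) has_integral
      (f b * g' b - f' b * g b) - (f a * g' a - f' a * g a)) {a..b}"
  proof (rule has_integral_real_derivative[OF \<open>a \<le> b\<close>])
    fix x assume x: "x \<in> {a..b}"
    show "((\<lambda>x. f x * g' x - f' x * g x) has_real_derivative (q x - r x) * (f x * g x)) (at x)"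
      by (rule derivative_eq_intros solvesD[OF f x] solvesD[OF g x] refl | simp add: algebra_simps)+
  qed
  then show ?thesis using assms(4) by simp
qed

lemma integral_pos_if_pos_inside:
  fixes F :: "real \<Rightarrow> real"
  assumes "continuous_on {a..b} F" "\<And>x. x \<in> {a<..<b} \<Longrightarrow> F x > 0" "a < b"
  shows "integral {a..b} F > 0"
proof -
  have cl: "F x \<ge> 0" if "x \<in> {a..b}" for x
  proof -
    have "x \<in> closure {a<..<b}" using assms(3) that by simp
    moreover have "continuous_on (closure {a<..<b}) F" using assms by simp
    ultimately show ?thesis
      using continuous_ge_on_closure[of "{a<..<b}" F x 0] assms(2) by force
  qed
  have "integral {a..b} F \<noteq> 0"
  proof
    assume "integral {a..b} F = 0"
    then have "F ((a + b) / 2) = 0"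
      using integral_eq_0_iff[OF assms(1,3)] cl assms(3) by (auto simp: )
    then show False using assms(2)[of "(a + b) / 2"] assms(3) by auto
  qed
  moreover have "integral {a..b} F \<ge> 0"
    by (rule integral_nonneg) (use assms cl in \<open>auto intro: integrable_continuous_interval\<close>)
  ultimately show ?thesis by simp
qed

text \<open>Without an interior zero \<open>f\<close> keeps one sign, and so does
  \<open>(q x - r x) * (f x * g x)\<close>, whose integral is zero by the Wronskian identity. The
  factor \<open>s\<close> treats \<open>q < r\<close> and \<open>q > r\<close> together.\<close>

lemma wronskian_interior_zero:
  assumes f: "solves q f f' {a..b}" and g: "solves r g g' {a..b}" and ab: "a < b"
    and ends: "f a = 0" "f b = 0" "g a = 0" "g b = 0"
    and gpos: "\<And>x. x \<in> {a<..<b} \<Longrightarrow> g x > 0"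
    and qr: "\<And>x. x \<in> {a<..<b} \<Longrightarrow> s * (r x - q x) > 0"
    and c: "continuous_on {a..b} q" "continuous_on {a..b} r"
  shows "\<exists>z\<in>{a<..<b}. f z = 0"
proof (rule ccontr)
  assume "\<not> ?thesis"
  then have nz: "f z \<noteq> 0" if "z \<in> {a<..<b}" for z using that by blast
  \<comment> \<open>\<open>t\<close> normalizes the sign of \<open>f\<close> by its value at the
    midpoint; a change of sign would produce a zero by connectedness.\<close>
  define t where "t = sgn (f ((a + b) / 2))"
  have mid: "(a + b) / 2 \<in> {a<..<b}" using ab by auto
  have tf: "t * f z > 0" if z: "z \<in> {a<..<b}" for z
  proof (rule ccontr)
    assume "\<not> t * f z > 0"
    moreover have "t * f z \<noteq> 0" using nz[OF z] nz[OF mid] by (auto simp: t_def sgn_0_0)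
    ultimately have neg: "t * f z < 0" by linarith
    have pos: "t * f ((a + b) / 2) > 0" using nz[OF mid] by (auto simp: t_def sgn_if)
    have "connected ((\<lambda>x. t * f x) ` {a<..<b})"
      by (intro connected_continuous_image continuous_intros
          continuous_on_subset[OF solves_continuous_on(1)[OF f]]) auto
    then have "0 \<in> (\<lambda>x. t * f x) ` {a<..<b}"
      using neg pos z mid unfolding connected_iff_interval by (meson imageI less_imp_le)
    then obtain y where "y \<in> {a<..<b}" "t * f y = 0" by force
    then show False using nz nz[OF mid] by (auto simp: t_def sgn_0_0)
  qed
  have "((\<lambda>x. (- s * t) * ((q x - r x) * (f x * g x))) has_integral (- s * t) * 0) {a..b}"
    by (rule has_integral_mult_right, rule wronskian_has_integral[OF f g]) (use ab ends in auto)
  then have "integral {a..b} (\<lambda>x. (- s * t) * ((q x - r x) * (f x * g x))) = 0"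
    by (metis integral_unique mult_zero_right)
  moreover have "integral {a..b} (\<lambda>x. (- s * t) * ((q x - r x) * (f x * g x))) > 0"
  proof (rule integral_pos_if_pos_inside[OF _ _ ab])
    show "continuous_on {a..b} (\<lambda>x. (- s * t) * ((q x - r x) * (f x * g x)))"
      by (intro continuous_intros c solves_continuous_on(1)[OF f] solves_continuous_on(1)[OF g])
    fix x assume x: "x \<in> {a<..<b}"
    have "(s * (r x - q x)) * (t * f x) * g x > 0" using tf[OF x] gpos[OF x] qr[OF x] by simp
    then show "0 < (- s * t) * ((q x - r x) * (f x * g x))" by (simp add: algebra_simps)
  qed
  ultimately show False by auto
qed

section \<open>Existence and parameter dependence for linear initial value problems\<close>

lemma global_antiderivative:
  fixes f :: "real \<Rightarrow> real"
  assumes "continuous_on UNIV f"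
  obtains F where "\<And>x. (F has_real_derivative f x) (at x)" "F 0 = 0"
proof -
  have "\<exists>F. \<forall>x::real. -\<infinity> < ereal x \<longrightarrow> ereal x < \<infinity> \<longrightarrow> (F has_vector_derivative f x) (at x)"
    by (rule einterval_antiderivative) (use assms in \<open>auto simp: continuous_on_eq_continuous_at\<close>)
  then obtain F where F: "\<And>x. (F has_real_derivative f x) (at x)"
    by (auto simp: has_real_derivative_iff_has_vector_derivative)
  show ?thesis
  proof
    show "((\<lambda>x. F x - F 0) has_real_derivative f x) (at x)" for x
      using F[of x] by (auto intro!: derivative_eq_intros)
  qed simp
qed

text \<open>The kernel of twofold integration from 0 to \<open>x\<close>, transported to \<open>{0..1}\<close> and damped by the
  weight \<open>exp (- k * \<bar>x\<bar>)\<close>.\<close>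

definition picard_kernel :: "real \<Rightarrow> real \<Rightarrow> real \<Rightarrow> real" where
  "picard_kernel k x r = x\<^sup>2 * (1 - r) * exp (- k * \<bar>x\<bar> * (1 - r))"

lemma picard_kernel_nonneg: "r \<le> 1 \<Longrightarrow> picard_kernel k x r \<ge> 0"
  by (simp add: picard_kernel_def)

text \<open>What matters is that the bound does not depend on \<open>x\<close>: the damped integral
  operator becomes a contraction on the whole line at once, not just on short intervals.\<close>

lemma picard_kernel_integral:
  assumes "k > 0"
  shows "picard_kernel k x integrable_on {0..1}" "integral {0..1} (picard_kernel k x) \<le> 1 / k\<^sup>2"
proof -
  define a where "a = \<bar>x\<bar>"
  \<comment> \<open>An antiderivative of the kernel in \<open>r\<close>, from one integration by
    parts; \<open>G 1\<close> is the claimed bound and \<open>G 0\<close> is nonnegative.\<close>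
  define G where "G = (\<lambda>r. exp (- k * a * (1 - r)) * (1 + k * a * (1 - r)) / k\<^sup>2)"
  have kernel: "picard_kernel k x r = a\<^sup>2 * (1 - r) * exp (- k * a * (1 - r))" for r
    by (simp add: picard_kernel_def a_def)
  have "(picard_kernel k x has_integral G 1 - G 0) {0..1}"
  proof (rule has_integral_real_derivative)
    fix r :: real
    define e where "e = exp (- k * a * (1 - r))"
    have "((\<lambda>r. exp (- k * a * (1 - r))) has_real_derivative e * (k * a)) (at r)"
      by (auto intro!: derivative_eq_intros simp: e_def)
    moreover have "((\<lambda>r. 1 + k * a * (1 - r)) has_real_derivative - (k * a)) (at r)"
      by (auto intro!: derivative_eq_intros)
    ultimately have "((\<lambda>r. exp (- k * a * (1 - r)) * (1 + k * a * (1 - r))) has_real_derivative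
        e * (k * a) * (1 + k * a * (1 - r)) + - (k * a) * e) (at r)"
      unfolding e_def by (rule DERIV_mult)
    also have "e * (k * a) * (1 + k * a * (1 - r)) + - (k * a) * e = k\<^sup>2 * picard_kernel k x r"
      unfolding kernel e_def[symmetric] by (simp add: algebra_simps power2_eq_square)
    finally have "((\<lambda>r. exp (- k * a * (1 - r)) * (1 + k * a * (1 - r))) has_real_derivative
        k\<^sup>2 * picard_kernel k x r) (at r)" .
    from DERIV_cdivide[OF this, of "k\<^sup>2"]
    show "(G has_real_derivative picard_kernel k x r) (at r)"
      using assms by (simp add: G_def)
  qed simp
  moreover have "G 1 = 1 / k\<^sup>2" "G 0 \<ge> 0" using assms by (auto simp: G_def a_def)
  ultimately show "picard_kernel k x integrable_on {0..1}" "integral {0..1} (picard_kernel k x) \<le> 1 / k\<^sup>2"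
    by (auto simp: has_integral_iff)
qed

lemma picard_integral_bound:
  assumes k: "k > 0" and f: "continuous_on {0..1} f" and C: "\<And>r. r \<in> {0..1} \<Longrightarrow> \<bar>f r\<bar> \<le> C"
  shows "\<bar>integral {0..1} (\<lambda>r. picard_kernel k x r * f r)\<bar> \<le> C / k\<^sup>2"
proof -
  have C0: "C \<ge> 0" using C[of 0] by auto
  have "norm (integral {0..1} (\<lambda>r. picard_kernel k x r * f r))
      \<le> integral {0..1} (\<lambda>r. picard_kernel k x r * C)"
  proof (rule integral_norm_bound_integral)
    show "(\<lambda>r. picard_kernel k x r * f r) integrable_on {0..1}"
      unfolding picard_kernel_def by (intro integrable_continuous_interval continuous_intros f)
    show "(\<lambda>r. picard_kernel k x r * C) integrable_on {0..1}"
      using picard_kernel_integral(1)[OF k] by (rule integrable_on_mult_left)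
    show "norm (picard_kernel k x r * f r) \<le> picard_kernel k x r * C" if "r \<in> {0..1}" for r
      using C[OF that] picard_kernel_nonneg[of r k x] that by (simp add: abs_mult mult_left_mono)
  qed
  also have "\<dots> = integral {0..1} (picard_kernel k x) * C" by simp
  also have "\<dots> \<le> 1 / k\<^sup>2 * C" using picard_kernel_integral(2)[OF k] C0 by (rule mult_right_mono)
  finally show ?thesis by simp
qed

text \<open>Banach's fixed point theorem is applied to bounded continuous functions of the pair
  \<open>(x, m)\<close>, with \<open>m\<close> merely carried along. Joint continuity in
  \<open>x\<close> and the parameter, needed for the compactness argument that finds the principal
  eigenvalue, is thus built in.\<close>

lemma linear_ivp_exists:
  fixes q :: "real \<times> real \<Rightarrow> real"
  assumes q: "continuous_on UNIV q" and K: "\<And>z. \<bar>q z\<bar> \<le> K"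
  obtains H H' where "continuous_on UNIV (\<lambda>(x, m). H x m)" "\<And>m. H 0 m = 1" "\<And>m. H' 0 m = 0"
    "\<And>m. solves (\<lambda>x. q (x, m)) (\<lambda>x. H x m) (\<lambda>x. H' x m) UNIV"
proof -
  \<comment> \<open>Ensures \<open>K < k\<^sup>2\<close>, so that the contraction constant
    \<open>K / k\<^sup>2\<close> is below 1.\<close>
  define k where "k = K + 1"
  have K0: "K \<ge> 0" using K[of 0] by auto
  then have k: "k > 0" by (simp add: k_def)
  \<comment> \<open>The twice integrated equation, written for the damped unknown
    \<open>exp (- k * \<bar>x\<bar>) * H x m\<close>, which stays bounded even if \<open>H\<close>
    grows exponentially.\<close>
  define T0 where "T0 = (\<lambda>(g :: real \<times> real \<Rightarrow> real) z. exp (- k * \<bar>fst z\<bar>) -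
     integral {0..1} (\<lambda>r. picard_kernel k (fst z) r * (q (fst z * r, snd z) * g (fst z * r, snd z))))"
  have qc: "continuous_on S (\<lambda>x. q (f x))" if "continuous_on S f" for f and S :: "'z::topological_space set"
    using continuous_on_compose2[OF q that] by auto
  have gc: "continuous_on S (\<lambda>x. apply_bcontfun g (f x))" if "continuous_on S f"
    for f and S :: "'z::topological_space set" and g :: "(real \<times> real) \<Rightarrow>\<^sub>C real"
    using continuous_on_compose2[OF continuous_on_apply_bcontfun that] by auto
  have T0b: "T0 (apply_bcontfun g) \<in> bcontfun" for g
  proof (rule bcontfun_normI)
    have "continuous_on UNIV (\<lambda>z. integral (cbox 0 1) (\<lambda>r. picard_kernel k (fst z) r *
        (q (fst z * r, snd z) * apply_bcontfun g (fst z * r, snd z))))"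
      by (rule integral_continuous_on_param)
        (auto simp: case_prod_beta picard_kernel_def intro!: continuous_intros qc gc)
    then show "continuous_on UNIV (T0 (apply_bcontfun g))"
      unfolding T0_def by (intro continuous_intros) simp
    fix z
    have "\<bar>integral {0..1} (\<lambda>r. picard_kernel k (fst z) r *
        (q (fst z * r, snd z) * apply_bcontfun g (fst z * r, snd z)))\<bar> \<le> K * norm g / k\<^sup>2"
    proof (rule picard_integral_bound[OF k])
      show "\<bar>q (fst z * r, snd z) * apply_bcontfun g (fst z * r, snd z)\<bar> \<le> K * norm g" for r
        using mult_mono[OF K norm_bounded[of g]] K0 by (simp add: abs_mult)
    qed (intro continuous_intros qc gc)
    moreover have "exp (- k * \<bar>fst z\<bar>) \<le> 1" using k by simp
    ultimately show "norm (T0 (apply_bcontfun g) z) \<le> 1 + K * norm g / k\<^sup>2"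
      unfolding T0_def by (smt (verit) exp_gt_zero real_norm_def)
  qed
  define T where "T = (\<lambda>g. Bcontfun (T0 (apply_bcontfun g)))"
  have T: "apply_bcontfun (T g) = T0 (apply_bcontfun g)" for g
    unfolding T_def by (rule Bcontfun_inverse[OF T0b])
  have "\<exists>!g. T g = g"
  proof (rule banach_fix_type[of "K / k\<^sup>2"], goal_cases)
    case 1 then show ?case using K0 by simp
  next
    case 2
    have "K < k\<^sup>2" using K0 by (simp add: k_def power2_eq_square algebra_simps add_pos_nonneg)
    then show ?case using k by simp
  next
    case 3
    show ?case
    proof (intro allI dist_bound)
      fix g1 g2 z
      let ?I = "\<lambda>g r. picard_kernel k (fst z) r * (q (fst z * r, snd z) * apply_bcontfun g (fst z * r, snd z))"
      have int: "?I g integrable_on {0..1}" for g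
        unfolding picard_kernel_def by (intro integrable_continuous_interval continuous_intros qc gc)
      have "dist (T g1 z) (T g2 z) = \<bar>integral {0..1} (?I g1) - integral {0..1} (?I g2)\<bar>"
        by (simp add: T T0_def dist_real_def abs_minus_commute)
      also have "integral {0..1} (?I g1) - integral {0..1} (?I g2)
          = integral {0..1} (\<lambda>r. picard_kernel k (fst z) r * (q (fst z * r, snd z) *
            (apply_bcontfun g1 (fst z * r, snd z) - apply_bcontfun g2 (fst z * r, snd z))))"
        by (subst Henstock_Kurzweil_Integration.integral_diff[symmetric, OF int int]) (simp add: algebra_simps)
      also have "\<bar>\<dots>\<bar> \<le> K * dist g1 g2 / k\<^sup>2"
      proof (rule picard_integral_bound[OF k])
        show "\<bar>q (fst z * r, snd z) * (apply_bcontfun g1 (fst z * r, snd z) -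
            apply_bcontfun g2 (fst z * r, snd z))\<bar> \<le> K * dist g1 g2" for r
          unfolding abs_mult
          by (rule mult_mono[OF K]) (use dist_bounded[of g1 "(fst z * r, snd z)" g2] K0 in \<open>auto simp: dist_real_def\<close>)
      qed (intro continuous_intros qc gc)
      finally show "dist (T g1 z) (T g2 z) \<le> K / k\<^sup>2 * dist g1 g2" by simp
    qed
  qed
  then obtain g where "T g = g" by blast
  then have g: "apply_bcontfun g z = T0 (apply_bcontfun g) z" for z by (metis T)
  define H where "H = (\<lambda>x m. exp (k * \<bar>x\<bar>) * apply_bcontfun g (x, m))"
  have Heq: "H x m = 1 - integral {0..1} (\<lambda>r. x\<^sup>2 * (1 - r) * (q (x * r, m) * H (x * r) m))" for x m
  proof -
    have "H x m = exp (k * \<bar>x\<bar>) * exp (- k * \<bar>x\<bar>) - exp (k * \<bar>x\<bar>) * integral {0..1}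
        (\<lambda>r. picard_kernel k x r * (q (x * r, m) * apply_bcontfun g (x * r, m)))"
      unfolding H_def by (subst g) (simp add: T0_def right_diff_distrib)
    also have "exp (k * \<bar>x\<bar>) * exp (- k * \<bar>x\<bar>) = 1" by (simp add: exp_minus)
    also have "exp (k * \<bar>x\<bar>) * integral {0..1}
        (\<lambda>r. picard_kernel k x r * (q (x * r, m) * apply_bcontfun g (x * r, m)))
      = integral {0..1} (\<lambda>r. exp (k * \<bar>x\<bar>) * (picard_kernel k x r * (q (x * r, m) * apply_bcontfun g (x * r, m))))"
      by simp
    also have "\<dots> = integral {0..1} (\<lambda>r. x\<^sup>2 * (1 - r) * (q (x * r, m) * H (x * r) m))"
    proof (rule integral_cong)
      fix r :: real assume r: "r \<in> {0..1}"
      have "exp (k * \<bar>x\<bar>) * exp (- k * \<bar>x\<bar> * (1 - r)) = exp (k * \<bar>x * r\<bar>)"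
        unfolding exp_add[symmetric] using r by (simp add: abs_mult algebra_simps)
      moreover have "exp (k * \<bar>x\<bar>) * (picard_kernel k x r * (q (x * r, m) * apply_bcontfun g (x * r, m)))
        = x\<^sup>2 * (1 - r) * (q (x * r, m) *
          ((exp (k * \<bar>x\<bar>) * exp (- k * \<bar>x\<bar> * (1 - r))) * apply_bcontfun g (x * r, m)))"
        unfolding picard_kernel_def by (simp only: ac_simps)
      ultimately show "exp (k * \<bar>x\<bar>) * (picard_kernel k x r * (q (x * r, m) * apply_bcontfun g (x * r, m)))
        = x\<^sup>2 * (1 - r) * (q (x * r, m) * H (x * r) m)"
        unfolding H_def by simp
    qed
    finally show ?thesis .
  qed
  have Hc: "continuous_on UNIV (\<lambda>z. H (fst z) (snd z))"
    unfolding H_def by (intro continuous_intros gc)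
  have "\<exists>F. F 0 = 0 \<and> solves (\<lambda>x. q (x, m)) (\<lambda>x. H x m) F UNIV" for m
  proof -
    define f where "f = (\<lambda>x. q (x, m) * H x m)"
    have "continuous_on UNIV f"
      unfolding f_def by (intro continuous_intros qc continuous_on_compose2[OF Hc, of _ "\<lambda>x. (x, m)", simplified])
    then obtain F1 where F1: "\<And>x. (F1 has_real_derivative f x) (at x)" "F1 0 = 0"
      by (rule global_antiderivative) auto
    then have "continuous_on UNIV F1" by (meson DERIV_isCont continuous_at_imp_continuous_on)
    then obtain F2 where F2: "\<And>x. (F2 has_real_derivative F1 x) (at x)" "F2 0 = 0"
      by (rule global_antiderivative) auto
    have Hm: "H x m = 1 - F2 x" for x
    proof -
      \<comment> \<open>Integration by parts in \<open>r\<close>: \<open>G 1 - G 0\<close> is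
        \<open>F2 x\<close>, which identifies the integral in \<open>Heq\<close> with the twofold
        antiderivative and so makes \<open>H\<close> twice differentiable.\<close>
      define G where "G = (\<lambda>r. x * (1 - r) * F1 (x * r) + F2 (x * r))"
      have "((\<lambda>r. x\<^sup>2 * (1 - r) * f (x * r)) has_integral G 1 - G 0) {0..1}"
      proof (rule has_integral_real_derivative)
        fix r :: real
        have m: "((\<lambda>r. x * r) has_real_derivative x) (at r)" by (auto intro!: derivative_eq_intros)
        have l: "((\<lambda>r. x * (1 - r)) has_real_derivative - x) (at r)" by (auto intro!: derivative_eq_intros)
        show "(G has_real_derivative x\<^sup>2 * (1 - r) * f (x * r)) (at r)"
          unfolding G_def
          by (rule DERIV_cong[OF DERIV_add[OF DERIV_mult[OF l DERIV_chain2[OF F1(1) m]] DERIV_chain2[OF F2(1) m]]])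
            (simp add: power2_eq_square)
      qed simp
      then show ?thesis using F1(2) F2(2) by (subst Heq) (simp add: f_def G_def integral_unique)
    qed
    have "solves (\<lambda>x. q (x, m)) (\<lambda>x. H x m) (\<lambda>x. - F1 x) UNIV"
      unfolding solves_def Hm
      using F1(1) F2(1) by (auto intro!: derivative_eq_intros simp: f_def Hm)
    then show ?thesis using F1(2) by (intro exI[of _ "\<lambda>x. - F1 x"]) simp
  qed
  then obtain H' where "\<And>m. H' m 0 = 0" "\<And>m. solves (\<lambda>x. q (x, m)) (\<lambda>x. H x m) (H' m) UNIV"
    by metis
  moreover have "H 0 m = 1" for m by (subst Heq) simp
  ultimately show ?thesis using that[of H "\<lambda>x m. H' m x"] Hc by (simp add: case_prod_beta)
qed

section \<open>The transversal eigenvalue problem\<close>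

text \<open>With this width the weight \<open>1 / (cos x)\<^sup>2\<close> lies between 1 and 2 on
  the closed strip, and its edges are the rays where
  \<open>\<bar>p $ 1\<bar> = p $ 2\<close>.\<close>

definition half_width :: real where "half_width = pi / 4"

abbreviation strip :: "real set" where "strip \<equiv> {- half_width..half_width}"

abbreviation inner_strip :: "real set" where "inner_strip \<equiv> {- half_width<..<half_width}"

definition potential :: "real \<Rightarrow> real \<Rightarrow> real \<Rightarrow> real" where
  "potential \<mu> \<nu> x = \<mu> / (cos x)\<^sup>2 - \<nu>"

lemma half_width_pos: "half_width > 0"
  by (simp add: half_width_def)

lemma cos_strip:
  assumes "x \<in> strip"
  shows "cos x > 0" "(cos x)\<^sup>2 \<ge> 1 / 2" "1 \<le> 1 / (cos x)\<^sup>2" "1 / (cos x)\<^sup>2 \<le> 2"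
proof -
  have "cos (2 * x) \<ge> 0" by (rule cos_ge_zero) (use assms in \<open>auto simp: half_width_def\<close>)
  then show c: "(cos x)\<^sup>2 \<ge> 1 / 2" by (simp add: cos_double_cos)
  have "- (pi / 2) < x" "x < pi / 2"
    using assms pi_gt_zero unfolding half_width_def atLeastAtMost_iff by linarith+
  then show "cos x > 0" by (rule cos_gt_zero_pi)
  have "(cos x)\<^sup>2 \<le> 1" by (simp add: abs_square_le_1)
  then show "1 \<le> 1 / (cos x)\<^sup>2" "1 / (cos x)\<^sup>2 \<le> 2" using c \<open>cos x > 0\<close>
    by (simp_all add: divide_le_eq le_divide_eq)
qed

lemma potential_even: "potential \<mu> \<nu> (- x) = potential \<mu> \<nu> x"
  by (simp add: potential_def)

lemma continuous_on_potential: "continuous_on strip (potential \<mu> \<nu>)"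
  unfolding potential_def using cos_strip(1) by (intro continuous_intros) force

lemma potential_le:
  assumes "x \<in> strip" "\<mu> \<le> M" "0 \<le> M" "0 \<le> \<nu>"
  shows "potential \<mu> \<nu> x \<le> 2 * M"
proof -
  have "\<mu> * (1 / (cos x)\<^sup>2) \<le> M * (1 / (cos x)\<^sup>2)" using assms cos_strip(3)[of x] by (intro mult_right_mono) auto
  also have "\<dots> \<le> M * 2" using assms cos_strip(4)[of x] by (intro mult_left_mono) auto
  finally show ?thesis using assms by (simp add: potential_def)
qed

lemma potential_abs_le:
  assumes "x \<in> strip"
  shows "\<bar>potential \<mu> \<nu> x\<bar> \<le> 2 * \<bar>\<mu>\<bar> + \<bar>\<nu>\<bar>"
proof -
  have "\<bar>\<mu> * (1 / (cos x)\<^sup>2)\<bar> \<le> \<bar>\<mu>\<bar> * 2"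
    unfolding abs_mult using cos_strip[OF assms] by (intro mult_left_mono) auto
  then have "\<bar>\<mu> / (cos x)\<^sup>2\<bar> \<le> \<bar>\<mu>\<bar> * 2" by (metis mult.right_neutral times_divide_eq_right)
  then show ?thesis unfolding potential_def by linarith
qed

lemma even_solution:
  assumes h: "solves (potential \<mu> \<nu>) h h' strip" "h' 0 = 0" and x: "x \<in> strip"
  shows "h (- x) = h x"
proof -
  have "solves (potential \<mu> \<nu>) (\<lambda>x. h x - 1 * h (- x)) (\<lambda>x. h' x - 1 * - h' (- x)) strip"
    by (rule solves_diff_scaled[OF h(1) solves_reflect[OF h(1) potential_even]])
  from solves_unique[OF this potential_abs_le, of 0 x] show ?thesis
    using h(2) x half_width_pos by auto
qed

text \<open>By evenness a zero at \<open>x\<close> comes with one at \<open>- x\<close>, at distance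
  at most \<open>pi / 2\<close>. The potential is at most 2, below \<open>(3 / 2)\<^sup>2\<close>,
  and \<open>3 / 2 * (pi / 2) < pi\<close>, so these two zeros would force
  \<open>h 0 = 0\<close>.\<close>

lemma solution_nonzero_if_small:
  assumes h: "solves (potential \<mu> \<nu>) h h' strip" "h 0 = 1" "h' 0 = 0"
    and "\<mu> \<le> 1" "0 \<le> \<nu>" and x: "x \<in> strip"
  shows "h x \<noteq> 0"
proof
  assume "h x = 0"
  then have z: "h (- \<bar>x\<bar>) = 0" "h \<bar>x\<bar> = 0" using even_solution[OF h(1,3) x] by (auto simp: abs_if)
  have sub: "{- \<bar>x\<bar>..\<bar>x\<bar>} \<subseteq> strip" using x by auto
  have "h 0 = 0"
  proof (rule two_zeros_imp_zero[OF solves_subset[OF h(1) sub], of "3 / 2"])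
    fix y assume "y \<in> {- \<bar>x\<bar><..<\<bar>x\<bar>}"
    then have "potential \<mu> \<nu> y \<le> 2 * 1" using x assms by (intro potential_le) auto
    then show "potential \<mu> \<nu> y < (3 / 2)\<^sup>2" by (simp add: power2_eq_square)
  next
    have "\<bar>x\<bar> \<le> pi / 4" using x by (auto simp: half_width_def)
    then have "3 / 2 * (\<bar>x\<bar> - - \<bar>x\<bar>) \<le> 3 * (pi / 4)" by simp
    also have "\<dots> < pi" by simp
    finally show "3 / 2 * (\<bar>x\<bar> - - \<bar>x\<bar>) < pi" .
  qed (use z in auto)
  then show False using h(2) by simp
qed

text \<open>The eigenvalue is the smallest parameter whose even solution fails to be positive on
  the closed strip; touching zero inside the strip is excluded by uniqueness.\<close>

lemma principal_eigenpair_exists: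
  assumes nu: "0 \<le> \<nu>" "\<nu> < 1"
  obtains \<mu> h h' where "1 < \<mu>" "\<mu> \<le> 5" "solves (potential \<mu> \<nu>) h h' strip" "h 0 = 1" "h' 0 = 0"
    "h (- half_width) = 0" "h half_width = 0" "\<And>x. x \<in> inner_strip \<Longrightarrow> h x > 0"
proof -
  \<comment> \<open>Freezing \<open>x\<close> to the strip and \<open>m\<close> to
    \<open>{0..5}\<close> gives the globally bounded continuous coefficient required for existence,
    without altering the equation where it is used.\<close>
  define clamp where "clamp = (\<lambda>x. max (- half_width) (min half_width x))"
  define q where "q = (\<lambda>(x, m). potential (max 0 (min 5 m)) \<nu> (clamp x))"
  have clamp: "clamp x \<in> strip" for x using half_width_pos by (auto simp: clamp_def)
  have clampc: "cos (clamp x) \<noteq> 0" for x using cos_strip(1)[OF clamp[of x]] by simp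
  have "continuous_on UNIV q"
    unfolding q_def potential_def case_prod_beta
    by (intro continuous_intros) (use clampc in \<open>auto simp: clamp_def intro!: continuous_intros\<close>)
  moreover have "\<bar>q z\<bar> \<le> 11" for z
  proof -
    have "\<bar>q z\<bar> \<le> 2 * \<bar>max 0 (min 5 (snd z))\<bar> + \<bar>\<nu>\<bar>"
      unfolding q_def case_prod_beta by (rule potential_abs_le[OF clamp])
    also have "\<dots> \<le> 11" using nu by (simp add: abs_if max_def min_def)
    finally show ?thesis .
  qed
  ultimately obtain H H' where H: "continuous_on UNIV (\<lambda>(x, m). H x m)" "\<And>m. H 0 m = (1::real)"
    "\<And>m. H' 0 m = 0" "\<And>m. solves (\<lambda>x. q (x, m)) (\<lambda>x. H x m) (\<lambda>x. H' x m) UNIV"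
    by (rule linear_ivp_exists) blast
  have s: "solves (potential m \<nu>) (\<lambda>x. H x m) (\<lambda>x. H' x m) strip" if "m \<in> {0..5}" for m
    by (rule solves_cong[OF solves_subset[OF H(4)[of m]]]) (use that in \<open>auto simp: q_def clamp_def\<close>)
  have Hc: "continuous_on S (\<lambda>z. H (f z) (g z))" if "continuous_on S f" "continuous_on S g"
    for S :: "'z::topological_space set" and f g
    using continuous_on_compose2[OF H(1) continuous_on_Pair[OF that]] by auto
  \<comment> \<open>The parameters at which positivity fails, as the projection of a compact set, so
    that a least one exists once \<open>B\<close> is nonempty.\<close>
  define B where "B = snd ` ((strip \<times> {0..5}) \<inter> {z. H (fst z) (snd z) \<le> 0})"
  have Biff: "m \<in> B \<longleftrightarrow> m \<in> {0..5} \<and> (\<exists>x\<in>strip. H x m \<le> 0)" for m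
    by (force simp: B_def)
  have "closed {z. H (fst z) (snd z) \<le> 0}"
    by (intro closed_Collect_le Hc continuous_intros)
  then have "compact B"
    unfolding B_def
    by (intro compact_continuous_image continuous_intros compact_Int_closed compact_Times compact_Icc)
  \<comment> \<open>\<open>cos (2 * x)\<close> vanishes at both ends of the strip and solves the
    equation with coefficient 4, which is below \<open>5 - \<nu>\<close>. Comparison with a solution
    positive on the whole strip would force this cosine to vanish at the centre too.\<close>
  moreover have "5 \<in> B"
  proof (rule ccontr)
    assume "5 \<notin> B"
    then have pos: "H x 5 > 0" if "x \<in> strip" for x using that by (force simp: Biff)
    have "cos (2 * (0 - 0)) = (0::real)"
    proof (rule sturm_comparison[OF solves_cos[of 2 0] s[of 5] pos])
      fix x assume "x \<in> inner_strip"
      then have "1 \<le> 1 / (cos x)\<^sup>2" by (intro cos_strip) auto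
      then show "2\<^sup>2 < potential 5 \<nu> x" using nu by (simp add: potential_def)
    qed (use half_width_pos in \<open>auto simp: half_width_def\<close>)
    then show False by simp
  qed
  ultimately obtain \<mu> where mu: "\<mu> \<in> B" "\<And>m. m \<in> B \<Longrightarrow> \<mu> \<le> m"
    using compact_attains_inf[of B] by blast
  then have mu05: "\<mu> \<in> {0..5}" by (auto simp: Biff)
  note s\<mu> = s[OF mu05]
  obtain x0 where x0: "x0 \<in> strip" "H x0 \<mu> \<le> 0" using mu(1) by (auto simp: Biff)
  \<comment> \<open>Besides being part of the conclusion, this leaves room to the left of
    \<open>\<mu>\<close> inside \<open>{0..5}\<close>, where the following limit is taken.\<close>
  have "\<mu> > 1"
  proof (rule ccontr)
    assume "\<not> \<mu> > 1"
    then have nz: "H x \<mu> \<noteq> 0" if "x \<in> strip" for x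
      using solution_nonzero_if_small[OF s\<mu> H(2,3) _ nu(1) that] by simp
    have "connected ((\<lambda>x. H x \<mu>) ` strip)"
      by (intro connected_continuous_image Hc continuous_intros connected_Icc)
    moreover have "H 0 \<mu> \<in> (\<lambda>x. H x \<mu>) ` strip" using half_width_pos by (intro imageI) auto
    ultimately have "0 \<in> (\<lambda>x. H x \<mu>) ` strip"
      using x0 H(2)[of \<mu>] unfolding connected_iff_interval by (metis imageI zero_le_one)
    then show False using nz by force
  qed
  have nonneg: "H x \<mu> \<ge> 0" if x: "x \<in> strip" for x
  proof (rule tendsto_lowerbound)
    have "continuous_on UNIV (\<lambda>m. H x m)" by (intro Hc continuous_intros)
    then have "isCont (\<lambda>m. H x m) \<mu>" by (simp add: continuous_on_eq_continuous_at)
    then show "((\<lambda>m. H x m) \<longlongrightarrow> H x \<mu>) (at_left \<mu>)"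
      by (metis continuous_at_imp_continuous_at_within continuous_within)
    show "\<forall>\<^sub>F m in at_left \<mu>. 0 \<le> H x m"
      using eventually_at_left_real[OF \<open>\<mu> > 1\<close>]
    proof eventually_elim
      fix m assume m: "m \<in> {1<..<\<mu>}"
      then have "m \<notin> B" using mu(2) by force
      moreover have "m \<in> {0..5}" using m mu05 by auto
      ultimately show "0 \<le> H x m" using x unfolding Biff by (meson linear)
    qed
  qed simp
  have inner: "H x \<mu> > 0" if x: "x \<in> inner_strip" for x
  proof (rule ccontr)
    have xs: "x \<in> strip" using x by auto
    assume "\<not> H x \<mu> > 0"
    then have Hx: "H x \<mu> = 0" using nonneg[OF xs] by simp
    have "H' x \<mu> = 0"
    proof (rule DERIV_local_min[OF solvesD(1)[OF s\<mu> xs]])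
      show "0 < min (x + half_width) (half_width - x)" using x by auto
      show "\<forall>y. \<bar>x - y\<bar> < min (x + half_width) (half_width - x) \<longrightarrow> H x \<mu> \<le> H y \<mu>"
        using nonneg by (auto simp: Hx abs_if split: if_splits)
    qed
    then have "H 0 \<mu> = 0"
      using solves_unique[OF s\<mu> potential_abs_le xs Hx, of 0] half_width_pos by auto
    then show False using H(2) by simp
  qed
  \<comment> \<open>The point where positivity fails can only be an end, and evenness copies the
    zero to the other end.\<close>
  have "x0 = half_width \<or> x0 = - half_width" using inner[of x0] x0 by force
  moreover have "H x0 \<mu> = 0" using x0 nonneg[of x0] by simp
  moreover have "H (- half_width) \<mu> = H half_width \<mu>"
    using even_solution[OF s\<mu> H(3), of half_width] half_width_pos by auto
  ultimately have "H (- half_width) \<mu> = 0" "H half_width \<mu> = 0" by auto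
  then show ?thesis using that[OF \<open>\<mu> > 1\<close> _ s\<mu> H(2,3)] mu05 inner by auto
qed

text \<open>Excludes all but the principal solutions in the range \<open>\<mu> \<le> 5\<close>:
  there the potential is at most 10, below \<open>(7 / 2)\<^sup>2\<close>, and \<open>7 / 2\<close>
  times the strip width \<open>pi / 2\<close> is below \<open>2 * pi\<close>.\<close>

lemma strip_three_zeros:
  assumes f: "solves (potential \<mu> \<nu>) f f' strip" and mu: "\<mu> \<le> 5" "0 \<le> \<nu>"
    and z: "f (- half_width) = 0" "f half_width = 0" "f z = 0" "z \<in> inner_strip"
    and x: "x \<in> strip"
  shows "f x = 0"
proof (rule three_zeros_imp_zero[OF f _ potential_abs_le _ _ z(1,3,2,4) x, of "7 / 2"])
  fix y assume "y \<in> strip"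
  then have "potential \<mu> \<nu> y \<le> 2 * 5" using mu by (intro potential_le) auto
  then show "potential \<mu> \<nu> y < (7 / 2)\<^sup>2" by (simp add: power2_eq_square)
next
  show "7 / 2 * (half_width - - half_width) < 2 * pi" using pi_gt_zero by (simp add: half_width_def)
qed auto

text \<open>The alternatives in \<open>ord\<close> are a higher mode at a parameter not above the
  reference one, and the same mode at a different parameter. In each the difference of the
  potentials keeps one sign, so the Wronskian identity puts a zero of \<open>f\<close> between its
  zero ends, which is one zero too many.\<close>

lemma solution_zero_if_potential_ordered:
  assumes f: "solves (potential \<mu> \<nu>) f f' strip" and mu: "\<mu> \<le> 5" "0 \<le> \<nu>"
    and fz: "f (- half_width) = 0" "f half_width = 0"
    and g: "solves (potential \<mu>' \<nu>') g g' strip" and gz: "g (- half_width) = 0" "g half_width = 0"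
    and gpos: "\<And>x. x \<in> inner_strip \<Longrightarrow> g x > 0"
    and ord: "\<mu> \<le> \<mu>' \<and> \<nu>' < \<nu> \<or> \<nu> = \<nu>' \<and> \<mu> \<noteq> \<mu>'"
    and x: "x \<in> strip"
  shows "f x = 0"
proof -
  have "\<exists>z\<in>inner_strip. f z = 0"
  proof (rule wronskian_interior_zero[OF f g _ fz gz gpos _ continuous_on_potential continuous_on_potential])
    fix x assume "x \<in> inner_strip"
    then have c: "1 \<le> 1 / (cos x)\<^sup>2" by (intro cos_strip) auto
    have eq: "potential \<mu>' \<nu>' x - potential \<mu> \<nu> x = (\<mu>' - \<mu>) * (1 / (cos x)\<^sup>2) - (\<nu>' - \<nu>)"
      by (simp add: potential_def algebra_simps diff_divide_distrib)
    show "(if \<mu>' < \<mu> then - 1 else 1) * (potential \<mu>' \<nu>' x - potential \<mu> \<nu> x) > 0"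
    proof (cases "\<mu>' < \<mu>")
      case True
      then have "(\<mu> - \<mu>') * (1 / (cos x)\<^sup>2) > 0" using c by (intro mult_pos_pos) auto
      then show ?thesis unfolding eq using True ord by (auto simp: algebra_simps)
    next
      case False
      then have "(\<mu>' - \<mu>) * (1 / (cos x)\<^sup>2) \<ge> \<mu>' - \<mu>"
        using c mult_left_mono[of 1 "1 / (cos x)\<^sup>2" "\<mu>' - \<mu>"] by auto
      then show ?thesis unfolding eq using False ord by auto
    qed
  qed (use half_width_pos in auto)
  then obtain z where "z \<in> inner_strip" "f z = 0" by blast
  from strip_three_zeros[OF f mu fz this(2,1) x] show ?thesis .
qed

text \<open>Subtracting \<open>f 0 * g\<close> creates a third zero at the centre. This is what
  makes the eigenvalues simple within one mode.\<close>

lemma solution_proportional: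
  assumes f: "solves (potential \<mu> \<nu>) f f' strip" and mu: "\<mu> \<le> 5" "0 \<le> \<nu>"
    and fz: "f (- half_width) = 0" "f half_width = 0"
    and g: "solves (potential \<mu> \<nu>) g g' strip" and gz: "g (- half_width) = 0" "g half_width = 0" "g 0 = 1"
    and x: "x \<in> strip"
  shows "f x = f 0 * g x"
proof -
  have "f x - f 0 * g x = 0"
    by (rule strip_three_zeros[OF solves_diff_scaled[OF f g, of "f 0"] mu _ _ _ _ x, of 0])
      (use fz gz half_width_pos in auto)
  then show ?thesis by simp
qed

section \<open>Quantitative bound for the gap of the principal eigenvalues\<close>

lemma tan_ge_self:
  assumes "0 \<le> x" "x < pi / 2"
  shows "x \<le> tan x"
proof -
  have "tan 0 - 0 \<le> tan x - x"
  proof (rule DERIV_nonneg_imp_nondecreasing[OF assms(1)])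
    fix y assume y: "0 \<le> y" "y \<le> x"
    then have c: "cos y > 0" using assms by (intro cos_gt_zero_pi) auto
    have "1 \<le> 1 / (cos y)\<^sup>2" using c by (simp add: le_divide_eq abs_square_le_1)
    moreover have "((\<lambda>x. tan x - x) has_real_derivative inverse ((cos y)\<^sup>2) - 1) (at y)"
      using c by (auto intro!: derivative_eq_intros)
    ultimately show "\<exists>z. ((\<lambda>x. tan x - x) has_real_derivative z) (at y) \<and> 0 \<le> z"
      by (auto simp: inverse_eq_divide)
  qed
  then show ?thesis by simp
qed

lemma inverse_cos_squared_ge:
  assumes "0 \<le> x" "x < pi / 2"
  shows "1 + x\<^sup>2 \<le> 1 / (cos x)\<^sup>2"
proof -
  have "cos x > 0" using assms by (intro cos_gt_zero_pi) auto
  then have "1 / (cos x)\<^sup>2 = 1 + (tan x)\<^sup>2" using tan_sec[of x] by (simp add: power_inverse divide_inverse)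
  moreover have "x\<^sup>2 \<le> (tan x)\<^sup>2" using tan_ge_self[OF assms] assms by (intro power_mono)
  ultimately show ?thesis by simp
qed

lemma half_width_less_pi_half: "half_width < pi / 2"
  by (simp add: half_width_def)

text \<open>From \<open>\<nu> \<le> \<mu>\<close> and \<open>1 / (cos x)\<^sup>2 \<ge> 1\<close> the
  potential is nonnegative, so \<open>h\<close> is concave on the half strip. The lower bound is its
  chord from height 1 at the centre to 0 at the end; the upper one comes from
  \<open>h' \<le> 0\<close>.\<close>

lemma half_strip_bounds:
  assumes h: "solves (potential \<mu> \<nu>) h h' strip" "h 0 = 1" "h' 0 = 0" "h half_width = 0"
    and pos: "\<And>x. x \<in> inner_strip \<Longrightarrow> h x > 0"
    and mu: "0 \<le> \<mu>" "\<nu> \<le> \<mu>" and x: "x \<in> {0..half_width}"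
  shows "1 - x / half_width \<le> h x" "h x \<le> 1"
proof -
  have h'': "potential \<mu> \<nu> y * h y \<ge> 0" if "y \<in> {0..half_width}" for y
  proof -
    have y: "y \<in> strip" using that half_width_pos by auto
    have "\<mu> * 1 \<le> \<mu> * (1 / (cos y)\<^sup>2)" using cos_strip(3)[OF y] mu by (intro mult_left_mono) auto
    then have "potential \<mu> \<nu> y \<ge> 0" using mu by (simp add: potential_def)
    moreover have "h y \<ge> 0"
      using pos[of y] h(4) that half_width_pos by (cases "y = half_width") auto
    ultimately show ?thesis by simp
  qed
  have sub: "{0..half_width} \<subseteq> strip" using half_width_pos by auto
  note d = solvesD[OF solves_subset[OF h(1) sub]]
  have h'le: "h' y \<le> h' 0" if y: "y \<in> {0..half_width}" for y
  proof (rule DERIV_nonpos_imp_nonincreasing[of 0 y h'])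
    fix z assume "0 \<le> z" "z \<le> y"
    then have z: "z \<in> {0..half_width}" using y by auto
    show "\<exists>w. (h' has_real_derivative w) (at z) \<and> w \<le> 0"
      using d(2)[OF z] h''[OF z] by (intro exI[of _ "- (potential \<mu> \<nu> z * h z)"]) auto
  qed (use y in auto)
  have "h x \<le> h 0"
  proof (rule DERIV_nonpos_imp_nonincreasing[of 0 x h])
    fix z assume "0 \<le> z" "z \<le> x"
    then have z: "z \<in> {0..half_width}" using x by auto
    show "\<exists>w. (h has_real_derivative w) (at z) \<and> w \<le> 0"
      using d(1)[OF z] h'le[OF z] h(3) by (intro exI[of _ "h' z"]) auto
  qed (use x in auto)
  then show "h x \<le> 1" using h by simp
  have "convex_on {0..half_width} (\<lambda>x. - h x)"
    by (rule f''_ge0_imp_convex[where f' = "\<lambda>x. - h' x" and f'' = "\<lambda>x. potential \<mu> \<nu> x * h x"])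
      (use d h'' in \<open>auto intro!: derivative_eq_intros\<close>)
  from convex_onD[OF this, of "x / half_width" 0 half_width]
  show "1 - x / half_width \<le> h x"
    using x h half_width_pos by (simp add: divide_le_eq)
qed

text \<open>The Wronskian identity on the half strip says that \<open>F\<close> has integral zero.
  For \<open>d \<le> 0\<close> it would be positive inside. If \<open>n\<close> were at most
  \<open>(1 + 1 / 200) * d\<close>, then \<open>1 / (cos x)\<^sup>2 \<ge> 1 + x\<^sup>2\<close> and
  the concavity bounds would place \<open>F\<close> below \<open>g\<close>, whose integral is
  negative.\<close>

lemma principal_gap_bound:
  assumes h1: "solves (potential \<mu>1 \<nu>\<^sub>1) h\<^sub>1 h\<^sub>1' strip" "h\<^sub>1 0 = 1" "h\<^sub>1' 0 = 0" "h\<^sub>1 half_width = 0"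
      "\<And>x. x \<in> inner_strip \<Longrightarrow> h\<^sub>1 x > 0" "0 \<le> \<mu>1" "\<nu>\<^sub>1 \<le> \<mu>1"
    and h2: "solves (potential \<mu>2 \<nu>\<^sub>2) h\<^sub>2 h\<^sub>2' strip" "h\<^sub>2 0 = 1" "h\<^sub>2' 0 = 0" "h\<^sub>2 half_width = 0"
      "\<And>x. x \<in> inner_strip \<Longrightarrow> h\<^sub>2 x > 0" "0 \<le> \<mu>2" "\<nu>\<^sub>2 \<le> \<mu>2"
    and nu: "\<nu>\<^sub>1 < \<nu>\<^sub>2"
  shows "\<mu>1 < \<mu>2" "(1 + 1 / 200) * (\<mu>2 - \<mu>1) < \<nu>\<^sub>2 - \<nu>\<^sub>1"
proof -
  let ?b = half_width
  define d where "d = \<mu>2 - \<mu>1"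
  define n where "n = \<nu>\<^sub>2 - \<nu>\<^sub>1"
  define F where "F = (\<lambda>x. (n - d * (1 / (cos x)\<^sup>2)) * (h\<^sub>1 x * h\<^sub>2 x))"
  have sub: "{0..?b} \<subseteq> strip" using half_width_pos by auto
  have "((\<lambda>x. (potential \<mu>1 \<nu>\<^sub>1 x - potential \<mu>2 \<nu>\<^sub>2 x) * (h\<^sub>1 x * h\<^sub>2 x)) has_integral 0) {0..?b}"
    by (rule wronskian_has_integral[OF solves_subset[OF h1(1) sub] solves_subset[OF h2(1) sub]])
      (use h1 h2 half_width_pos in auto)
  also have "(\<lambda>x. (potential \<mu>1 \<nu>\<^sub>1 x - potential \<mu>2 \<nu>\<^sub>2 x) * (h\<^sub>1 x * h\<^sub>2 x)) = F"
    by (auto simp: F_def potential_def n_def d_def algebra_simps diff_divide_distrib)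
  finally have F0: "(F has_integral 0) {0..?b}" .
  have cosnz: "\<forall>x\<in>{0..?b}. cos x \<noteq> 0"
    using cos_strip(1) sub by (metis less_irrefl subsetD)
  have Fc: "continuous_on {0..?b} F"
    unfolding F_def using cosnz
    by (intro continuous_intros continuous_on_subset[OF solves_continuous_on(1)[OF h1(1)] sub]
        continuous_on_subset[OF solves_continuous_on(1)[OF h2(1)] sub]) auto
  have dpos: "d > 0"
  proof (rule ccontr)
    assume "\<not> d > 0"
    have "integral {0..?b} F > 0"
    proof (rule integral_pos_if_pos_inside[OF Fc])
      fix x assume x: "x \<in> {0<..<?b}"
      have "d * (1 / (cos x)\<^sup>2) \<le> 0" using \<open>\<not> d > 0\<close> by (simp add: divide_nonpos_nonneg)
      then have "n - d * (1 / (cos x)\<^sup>2) > 0" using nu by (simp add: n_def)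
      then show "F x > 0" unfolding F_def using x h1(5)[of x] h2(5)[of x] by simp
    qed (rule half_width_pos)
    then show False using F0 by (simp add: integral_unique)
  qed
  then show "\<mu>1 < \<mu>2" by (simp add: d_def)
  show "(1 + 1 / 200) * (\<mu>2 - \<mu>1) < \<nu>\<^sub>2 - \<nu>\<^sub>1"
  proof (rule ccontr)
    assume "\<not> ?thesis"
    then have nd: "n \<le> (1 + 1 / 200) * d" by (simp add: n_def d_def)
    define k where "k = 1 / ?b"
    have kb: "k * ?b = 1" using half_width_pos by (simp add: k_def)
    \<comment> \<open>An antiderivative of the majorant \<open>g\<close>, which results from
      estimating \<open>h\<^sub>1 x * h\<^sub>2 x\<close> above by 1 in the positive term and below
      by the squared chord \<open>(1 - k * x)\<^sup>2\<close> in the negative one.\<close>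
    define G where "G = (\<lambda>x. d * (x / 200 - (x ^ 3 / 3 - k * x ^ 4 / 2 + k\<^sup>2 * x ^ 5 / 5)))"
    define g where "g = (\<lambda>x. d * (1 / 200 - x\<^sup>2 * (1 - k * x)\<^sup>2))"
    have "(g has_integral G ?b - G 0) {0..?b}"
    proof (rule has_integral_real_derivative)
      fix x
      have "(G has_real_derivative d * (1 / 200 - (x ^ 2 - k * (2 * x ^ 3) + k\<^sup>2 * x ^ 4))) (at x)"
        unfolding G_def by (auto intro!: derivative_eq_intros)
      also have "d * (1 / 200 - (x ^ 2 - k * (2 * x ^ 3) + k\<^sup>2 * x ^ 4)) = g x"
        unfolding g_def by (simp add: algebra_simps power2_eq_square eval_nat_numeral)
      finally show "(G has_real_derivative g x) (at x)" .
    qed (use half_width_pos in simp)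
    moreover have "G ?b - G 0 < 0"
    proof -
      \<comment> \<open>The origin of 200: the integral of
        \<open>x\<^sup>2 * (1 - x / ?b)\<^sup>2\<close> over the half strip is
        \<open>?b ^ 3 / 30\<close>, and \<open>?b \<ge> 1 / 2\<close> makes
        \<open>?b\<^sup>2 / 30\<close> at least \<open>1 / 120\<close>, more than
        \<open>1 / 200\<close>.\<close>
      have "?b \<ge> 1 / 2" using pi_ge_two by (simp add: half_width_def)
      then have "?b\<^sup>2 \<ge> (1 / 2)\<^sup>2" by (intro power_mono) auto
      then have "1 / 200 - ?b\<^sup>2 / 30 < 0" by (simp add: power2_eq_square)
      moreover have "G ?b = d * (?b / 200 - (?b ^ 3 / 3 - (k * ?b) * ?b ^ 3 / 2 + (k * ?b)\<^sup>2 * ?b ^ 3 / 5))"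
        by (simp add: G_def algebra_simps power2_eq_square eval_nat_numeral)
      then have "G ?b - G 0 = (d * ?b) * (1 / 200 - ?b\<^sup>2 / 30)"
        by (simp add: kb, simp add: G_def algebra_simps power2_eq_square eval_nat_numeral)
      ultimately show ?thesis using dpos half_width_pos by (simp add: mult_pos_neg)
    qed
    moreover have "0 \<le> G ?b - G 0"
    proof (rule has_integral_le[OF F0 \<open>(g has_integral G ?b - G 0) {0..?b}\<close>])
      fix x assume x: "x \<in> {0..?b}"
      note b1 = half_strip_bounds[OF h1 x]
      note b2 = half_strip_bounds[OF h2 x]
      define w where "w = h\<^sub>1 x * h\<^sub>2 x"
      have u0: "0 \<le> 1 - x / ?b" using x half_width_pos by (simp add: divide_le_eq)
      have wl: "(1 - x / ?b)\<^sup>2 \<le> w"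
        unfolding w_def power2_eq_square using b1(1) b2(1) u0 by (intro mult_mono) auto
      have wu: "w \<le> 1"
        unfolding w_def using b1 b2 u0 mult_mono[of "h\<^sub>1 x" 1 "h\<^sub>2 x" 1] by auto
      have w0: "w \<ge> 0" using wl by (rule order_trans[rotated]) simp
      have "n - d * (1 / (cos x)\<^sup>2) \<le> (1 + 1 / 200) * d - d * (1 + x\<^sup>2)"
        using nd inverse_cos_squared_ge[of x] x half_width_less_pi_half dpos
        by (intro diff_mono mult_left_mono) auto
      also have "\<dots> = d * (1 / 200 - x\<^sup>2)" by (simp add: algebra_simps)
      finally have "F x \<le> d * (1 / 200 - x\<^sup>2) * w"
        unfolding F_def w_def[symmetric] using w0 by (rule mult_right_mono)
      also have "\<dots> = d * (1 / 200 * w - x\<^sup>2 * w)" by (simp add: algebra_simps)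
      also have "\<dots> \<le> g x"
        unfolding g_def using wl wu dpos unfolding k_def by (intro mult_left_mono diff_mono) auto
      finally show "F x \<le> g x" .
    qed
    ultimately show False by simp
  qed
qed

section \<open>Completeness of the sine system\<close>

text \<open>One cosine factor averages the neighbouring frequencies \<open>k + 1\<close> and
  \<open>k - 1\<close>, so induction on \<open>n\<close> stays among vanishing sine coefficients as
  long as \<open>k\<close> is arbitrary; frequency 0 contributes nothing.\<close>

lemma sine_cos_power_integral_zero:
  fixes f :: "real \<Rightarrow> real"
  assumes f: "continuous_on {0..L} f" and L: "L > 0"
    and z: "\<And>k :: nat. integral {0..L} (\<lambda>t. f t * sin (k * (pi * t / L))) = 0"
  shows "integral {0..L} (\<lambda>t. f t * sin (real k * (pi * t / L)) * cos (pi * t / L) ^ n) = 0"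
proof (induction n arbitrary: k)
  case (Suc n)
  show ?case
  proof (cases k)
    case (Suc j)
    let ?g = "\<lambda>k t. f t * sin (real k * (pi * t / L)) * cos (pi * t / L) ^ n"
    have int: "?g k integrable_on {0..L}" for k
      using L by (intro integrable_continuous_interval continuous_intros f) auto
    have "integral {0..L} (\<lambda>t. f t * sin (k * (pi * t / L)) * cos (pi * t / L) ^ Suc n)
        = integral {0..L} (\<lambda>t. 1 / 2 * (?g (Suc k) t + ?g j t))"
    proof (rule integral_cong)
      fix t
      define x where "x = pi * t / L"
      have "sin (real k * x) * cos x = (sin (real (Suc k) * x) + sin (real j * x)) / 2"
        using sin_times_cos[of "real k * x" x] by (simp add: Suc algebra_simps)
      then have "f t * (sin (real k * x) * cos x) * cos x ^ n
          = f t * ((sin (real (Suc k) * x) + sin (real j * x)) / 2) * cos x ^ n" by simp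
      then show "f t * sin (k * (pi * t / L)) * cos (pi * t / L) ^ Suc n = 1 / 2 * (?g (Suc k) t + ?g j t)"
        unfolding x_def[symmetric] by (simp add: algebra_simps add_divide_distrib)
    qed
    also have "\<dots> = 0"
      by (simp only: integral_mult_right Henstock_Kurzweil_Integration.integral_add[OF int int] Suc.IH) simp
    finally show ?thesis .
  qed simp
qed (use z in simp)

text \<open>Frequency 1 in the preceding lemma shows that \<open>f\<close> times the first sine is
  orthogonal to all polynomials in the cosine. In the variable \<open>y = cos (pi * t / L)\<close>,
  Weierstrass approximation makes \<open>f\<close> uniformly close to such a polynomial, so the
  weighted square integral of \<open>f\<close> is zero.\<close>

lemma sine_coefficients_determine:
  fixes f :: "real \<Rightarrow> real"
  assumes f: "continuous_on {0..L} f" and L: "L > 0"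
    and z: "\<And>k :: nat. integral {0..L} (\<lambda>t. f t * sin (k * (pi * t / L))) = 0"
    and t: "t \<in> {0<..<L}"
  shows "f t = 0"
proof -
  let ?\<theta> = "\<lambda>t. pi * t / L"
  have th: "?\<theta> t \<in> {0..pi}" if "t \<in> {0..L}" for t
    using that L by (auto simp: divide_le_eq)
  have polyz: "integral {0..L} (\<lambda>t. f t * sin (?\<theta> t) * p (cos (?\<theta> t))) = 0"
    if p: "real_polynomial_function p" for p
  proof -
    obtain a n where p: "p = (\<lambda>x. \<Sum>i\<le>n. a i * x ^ i)"
      using p unfolding real_polynomial_function_iff_sum by blast
    have "integral {0..L} (\<lambda>t. f t * sin (?\<theta> t) * p (cos (?\<theta> t)))
        = integral {0..L} (\<lambda>t. \<Sum>i\<le>n. a i * (f t * sin (?\<theta> t) * cos (?\<theta> t) ^ i))"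
      by (simp add: p sum_distrib_left algebra_simps)
    also have "\<dots> = (\<Sum>i\<le>n. integral {0..L} (\<lambda>t. a i * (f t * sin (?\<theta> t) * cos (?\<theta> t) ^ i)))"
      using L by (intro integral_sum integrable_continuous_interval continuous_intros f) auto
    also have "\<dots> = 0"
      using sine_cos_power_integral_zero[OF f L z, of 1] by (simp del: times_divide_eq_right)
    finally show ?thesis .
  qed
  \<comment> \<open>The weight is the sine factor that is left once the other frequencies have
    become powers of the cosine. It is positive inside \<open>{0<..<L}\<close>, so
    \<open>I = 0\<close> suffices.\<close>
  define I where "I = integral {0..L} (\<lambda>t. (f t)\<^sup>2 * sin (?\<theta> t))"
  define A where "A = integral {0..L} (\<lambda>t. \<bar>f t\<bar>)"
  have sin01: "0 \<le> sin (?\<theta> t) \<and> sin (?\<theta> t) \<le> 1" if "t \<in> {0..L}" for t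
    using th[OF that] by (auto intro: sin_ge_zero)
  have "I \<le> e * A" if e: "e > 0" for e
  proof -
    have "continuous_on {-1..1} (\<lambda>y. f (L * arccos y / pi))"
    proof (rule continuous_on_compose2[OF f])
      show "continuous_on {-1..1} (\<lambda>y. L * arccos y / pi)" by (intro continuous_intros) auto
      show "(\<lambda>y. L * arccos y / pi) ` {-1..1} \<subseteq> {0..L}"
        using L arccos_bounded by (auto simp: divide_le_eq arccos_lbound arccos_ubound)
    qed
    then obtain p where p: "real_polynomial_function p"
      "\<And>y. y \<in> {-1..1} \<Longrightarrow> \<bar>f (L * arccos y / pi) - p y\<bar> < e"
      using Stone_Weierstrass_real_polynomial_function[OF compact_Icc _ e, of "-1" 1] by blast
    have pe: "\<bar>f t - p (cos (?\<theta> t))\<bar> \<le> e" if t: "t \<in> {0..L}" for t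
      using p(2)[of "cos (?\<theta> t)"] th[OF t] L by (simp add: arccos_cos)
    have pc: "continuous_on S p" for S
      using p(1) by (simp add: continuous_real_polymonial_function continuous_at_imp_continuous_on)
    have pc': "continuous_on S (\<lambda>t. p (cos (?\<theta> t)))" for S
      by (rule continuous_on_compose2[OF pc[of UNIV]]) (use L in \<open>auto intro!: continuous_intros\<close>)
    have c: "continuous_on S ?\<theta>" for S using L by (intro continuous_intros) auto
    have "I = integral {0..L} (\<lambda>t. (f t)\<^sup>2 * sin (?\<theta> t)) - integral {0..L} (\<lambda>t. f t * sin (?\<theta> t) * p (cos (?\<theta> t)))"
      using polyz[OF p(1)] by (simp add: I_def)
    also have "\<dots> = integral {0..L} (\<lambda>t. (f t)\<^sup>2 * sin (?\<theta> t) - f t * sin (?\<theta> t) * p (cos (?\<theta> t)))"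
      by (rule Henstock_Kurzweil_Integration.integral_diff[symmetric])
        (intro integrable_continuous_interval continuous_on_mult continuous_on_power continuous_on_sin f pc' c)+
    also have "\<dots> \<le> integral {0..L} (\<lambda>t. e * \<bar>f t\<bar>)"
    proof (rule integral_le)
      show "(\<lambda>t. (f t)\<^sup>2 * sin (?\<theta> t) - f t * sin (?\<theta> t) * p (cos (?\<theta> t))) integrable_on {0..L}"
        by (intro integrable_continuous_interval continuous_on_diff continuous_on_mult
            continuous_on_power continuous_on_sin f pc' c)
      show "(\<lambda>t. e * \<bar>f t\<bar>) integrable_on {0..L}"
        by (intro integrable_continuous_interval continuous_intros f)
      fix t assume t: "t \<in> {0..L}"
      have "(f t)\<^sup>2 * sin (?\<theta> t) - f t * sin (?\<theta> t) * p (cos (?\<theta> t))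
          = (f t * sin (?\<theta> t)) * (f t - p (cos (?\<theta> t)))" by (simp add: power2_eq_square algebra_simps)
      also have "\<dots> \<le> \<bar>f t * sin (?\<theta> t)\<bar> * \<bar>f t - p (cos (?\<theta> t))\<bar>"
        by (metis abs_ge_self abs_mult)
      also have "\<dots> \<le> (\<bar>f t\<bar> * 1) * e"
        unfolding abs_mult using pe[OF t] sin01[OF t] by (intro mult_mono mult_left_mono) auto
      finally show "(f t)\<^sup>2 * sin (?\<theta> t) - f t * sin (?\<theta> t) * p (cos (?\<theta> t)) \<le> e * \<bar>f t\<bar>"
        by (simp add: mult.commute)
    qed
    also have "\<dots> = e * A" by (simp add: A_def)
    finally show ?thesis .
  qed
  moreover have "A \<ge> 0" unfolding A_def
    by (intro integral_nonneg integrable_continuous_interval continuous_intros f) auto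
  ultimately have "I \<le> 0"
  proof (cases "A = 0")
    case False
    then have "A > 0" using \<open>A \<ge> 0\<close> by simp
    show ?thesis
    proof (rule ccontr)
      assume "\<not> I \<le> 0"
      then have "I > 0" by simp
      then have "I \<le> (I / (2 * A)) * A"
        using \<open>A > 0\<close> \<open>\<And>e. 0 < e \<Longrightarrow> I \<le> e * A\<close>[of "I / (2 * A)"] by simp
      then show False using \<open>A > 0\<close> \<open>I > 0\<close> by simp
    qed
  next
    case True
    then show ?thesis using \<open>\<And>e. 0 < e \<Longrightarrow> I \<le> e * A\<close>[of 1] by simp
  qed
  have c: "continuous_on {0..L} (\<lambda>t. (f t)\<^sup>2 * sin (?\<theta> t))"
    using L by (intro continuous_intros f) auto
  have nn: "(f t)\<^sup>2 * sin (?\<theta> t) \<ge> 0" if "t \<in> {0..L}" for t using sin01[OF that] by simp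
  have "I \<ge> 0" unfolding I_def
    by (rule integral_nonneg[OF integrable_continuous_interval[OF c] nn])
  with \<open>I \<le> 0\<close> have "(f t)\<^sup>2 * sin (?\<theta> t) = 0"
    using integral_eq_0_iff[OF c L nn] t by (auto simp: I_def)
  moreover have "sin (?\<theta> t) > 0"
    using t L by (intro sin_gt_zero) (auto simp: divide_less_eq)
  ultimately show ?thesis by simp
qed

section \<open>Geodesics and the polar rectangle\<close>

lemma norm_2: "norm (v :: real ^ 2) = sqrt ((v $ 1)\<^sup>2 + (v $ 2)\<^sup>2)"
  by (simp add: norm_vec_def L2_set_def sum_2)

lemma vector_eq_2: "(p :: real ^ 2) = q \<longleftrightarrow> p $ 1 = q $ 1 \<and> p $ 2 = q $ 2"
  by (simp add: vec_eq_iff forall_2)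

lemma vector_as_axes: "(vector [a, b] :: real ^ 2) = a *\<^sub>R axis 1 1 + b *\<^sub>R axis 2 1"
  by (simp add: vector_eq_2 axis_def)

lemma has_vector_derivative_vector_2:
  assumes "(f has_real_derivative f') (at t)" "(g has_real_derivative g') (at t)"
  shows "((\<lambda>t. vector [f t, g t] :: real ^ 2) has_vector_derivative vector [f', g']) (at t)"
  using has_vector_derivative_add[OF
      has_vector_derivative_scaleR[OF assms(1) has_vector_derivative_const[of "axis 1 1 :: real ^ 2"]]
      has_vector_derivative_scaleR[OF assms(2) has_vector_derivative_const[of "axis 2 1 :: real ^ 2"]]]
  by (simp add: vector_as_axes)

lemma has_derivative_nth: "((\<lambda>z. z $ i) has_derivative (\<lambda>v. v $ i)) (at (z :: real ^ 'n) within S)"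
  by (rule bounded_linear_imp_has_derivative[OF bounded_linear_vec_nth])

lemma matrix_vector_mult_mat: "mat c *v v = c *\<^sub>R (v :: real ^ 'n)"
  by (simp add: vec_eq_iff matrix_vector_mult_def mat_def if_distrib[where f = "\<lambda>z. z * _"] cong: if_cong)

lemma speed_hyperbolic:
  "speed hyperbolic_metric \<gamma> t = norm (vector_derivative \<gamma> (at t)) / \<bar>\<gamma> t $ 2\<bar>"
  by (simp add: speed_def hyperbolic_metric_def matrix_vector_mult_mat real_sqrt_divide
      power2_norm_eq_inner[symmetric])

text \<open>A function whose differential is bounded by the hyperbolic norm cannot grow faster than
  arc length. This bounds the length of every admissible path from below without any knowledge of
  geodesics.\<close>

lemma calibration_le_curve_length:
  assumes \<gamma>: "\<gamma> \<in> curves_between hyperbolic_plane hyperbolic_metric p q"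
    and F: "\<And>z. z \<in> hyperbolic_plane \<Longrightarrow> (F has_derivative F' z) (at z)"
    and le: "\<And>z v. z \<in> hyperbolic_plane \<Longrightarrow> \<bar>F' z v\<bar> \<le> norm v / z $ 2"
  shows "\<bar>F q - F p\<bar> \<le> curve_length hyperbolic_metric \<gamma>"
proof -
  from \<gamma> have \<gamma>': "\<gamma> piecewise_C1_differentiable_on {0..1}" "\<And>t. t \<in> {0..1} \<Longrightarrow> \<gamma> t \<in> hyperbolic_plane"
    "\<gamma> 0 = p" "\<gamma> 1 = q" "speed hyperbolic_metric \<gamma> integrable_on {0..1}"
    by (auto simp: curves_between_def valid_path_def path_image_def pathstart_def pathfinish_def)
  then obtain S where S: "finite S" "\<gamma> C1_differentiable_on {0..1} - S" "continuous_on {0..1} \<gamma>"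
    by (auto simp: piecewise_C1_differentiable_on_def)
  \<comment> \<open>Set to 0 at the ends and at the finitely many exceptional parameters, where
    \<open>vector_derivative\<close> carries no information; the fundamental theorem tolerates them
    because \<open>F\<close> is continuous along the path.\<close>
  define D where "D = (\<lambda>t. if t \<in> {0<..<1} - S then F' (\<gamma> t) (vector_derivative \<gamma> (at t)) else 0)"
  have "(D has_integral (F (\<gamma> 1) - F (\<gamma> 0))) {0..1}"
  proof (rule fundamental_theorem_of_calculus_interior_strong[OF S(1)])
    fix t assume t: "t \<in> {0<..<1} - S"
    then have th: "\<gamma> t \<in> hyperbolic_plane" using \<gamma>'(2) by auto
    have "(\<gamma> has_vector_derivative vector_derivative \<gamma> (at t)) (at t)"
      using S(2) t by (auto simp: C1_differentiable_on_eq vector_derivative_works[symmetric])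
    then have "((\<lambda>t. F (\<gamma> t)) has_derivative (\<lambda>h. F' (\<gamma> t) (h *\<^sub>R vector_derivative \<gamma> (at t)))) (at t)"
      unfolding has_vector_derivative_def by (rule has_derivative_compose[of \<gamma> _ t UNIV F "F' (\<gamma> t)"]) (rule F[OF th])
    moreover have "F' (\<gamma> t) (h *\<^sub>R v) = h *\<^sub>R F' (\<gamma> t) v" for h v
      by (rule linear_scale[OF has_derivative_linear[OF F[OF th]]])
    ultimately show "((\<lambda>t. F (\<gamma> t)) has_vector_derivative D t) (at t)"
      using t by (simp add: has_vector_derivative_def D_def)
  next
    have "continuous_on hyperbolic_plane F"
      using F by (meson has_derivative_continuous continuous_at_imp_continuous_on)
    then show "continuous_on {0..1} (\<lambda>t. F (\<gamma> t))"
      by (rule continuous_on_compose2[OF _ S(3)]) (use \<gamma>'(2) in auto)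
  qed simp
  moreover have "\<bar>D t\<bar> \<le> speed hyperbolic_metric \<gamma> t" if "t \<in> {0..1}" for t
    using le[OF \<gamma>'(2)[OF that], of "vector_derivative \<gamma> (at t)"] \<gamma>'(2)[OF that]
    by (auto simp: D_def speed_hyperbolic hyperbolic_plane_def)
  ultimately have "\<bar>integral {0..1} D\<bar> \<le> integral {0..1} (speed hyperbolic_metric \<gamma>)"
    using integral_norm_bound_integral[of D "{0..1}" "speed hyperbolic_metric \<gamma>"] \<gamma>'(5) by auto
  then show ?thesis
    using \<open>(D has_integral (F (\<gamma> 1) - F (\<gamma> 0))) {0..1}\<close> \<gamma>'(3,4)
    by (simp add: curve_length_def integral_unique)
qed

text \<open>One explicit curve and one explicit function settle the infimum: the function bounds all
  lengths from below, and the curve attains the bound.\<close>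

lemma calibrated_curve_minimizing:
  assumes \<gamma>: "\<gamma> \<in> curves_between hyperbolic_plane hyperbolic_metric p q"
    and F: "\<And>z. z \<in> hyperbolic_plane \<Longrightarrow> (F has_derivative F' z) (at z)"
    and le: "\<And>z v. z \<in> hyperbolic_plane \<Longrightarrow> \<bar>F' z v\<bar> \<le> norm v / z $ 2"
    and len: "curve_length hyperbolic_metric \<gamma> = \<bar>F q - F p\<bar>"
  shows "minimizing_geodesic hyperbolic_plane hyperbolic_metric p q \<gamma>"
    and "hyperbolic_dist p q = \<bar>F q - F p\<bar>"
proof -
  have "\<bar>F q - F p\<bar> \<le> hyperbolic_dist p q"
    unfolding riemannian_dist_def
    using \<gamma> calibration_le_curve_length[OF _ F le] by (intro cINF_greatest) auto
  moreover have "hyperbolic_dist p q \<le> curve_length hyperbolic_metric \<gamma>"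
    unfolding riemannian_dist_def
    using \<gamma> calibration_le_curve_length[OF _ F le] by (intro cINF_lower) (auto intro!: bdd_belowI2)
  ultimately show "hyperbolic_dist p q = \<bar>F q - F p\<bar>" using len by simp
  then show "minimizing_geodesic hyperbolic_plane hyperbolic_metric p q \<gamma>"
    using \<gamma> len by (simp add: minimizing_geodesic_def)
qed

lemma constant_speed_curve:
  assumes d: "\<And>t. (\<gamma> has_vector_derivative D t) (at t)" "continuous_on UNIV D"
    and pos: "\<And>t. \<gamma> t $ 2 > 0" and sp: "\<And>t. norm (D t) = l * \<gamma> t $ 2"
  shows "\<gamma> \<in> curves_between hyperbolic_plane hyperbolic_metric (\<gamma> 0) (\<gamma> 1)"
    and "curve_length hyperbolic_metric \<gamma> = l"
proof -
  have s: "speed hyperbolic_metric \<gamma> = (\<lambda>t. l)"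
    using vector_derivative_at[OF d(1)] sp pos less_imp_neq[OF pos]
    by (intro ext) (simp add: speed_hyperbolic abs_of_pos)
  have "\<gamma> C1_differentiable_on {0..1}"
    unfolding C1_differentiable_on_def using d by (meson continuous_on_subset subset_UNIV)
  then have "valid_path \<gamma>" by (simp add: valid_path_def C1_differentiable_imp_piecewise)
  then show "\<gamma> \<in> curves_between hyperbolic_plane hyperbolic_metric (\<gamma> 0) (\<gamma> 1)"
    using pos by (auto simp: curves_between_def path_image_def pathstart_def pathfinish_def
        hyperbolic_plane_def s)
  show "curve_length hyperbolic_metric \<gamma> = l" by (simp add: curve_length_def s)
qed

lemma calibration_vertical:
  assumes "z \<in> hyperbolic_plane"
  shows "((\<lambda>z. ln (z $ 2)) has_derivative (\<lambda>v. v $ 2 / z $ 2)) (at (z :: real ^ 2))"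
    and "\<bar>v $ 2 / z $ 2\<bar> \<le> norm v / z $ 2"
proof -
  have z: "z $ 2 > 0" using assms by (simp add: hyperbolic_plane_def)
  show "((\<lambda>z. ln (z $ 2)) has_derivative (\<lambda>v. v $ 2 / z $ 2)) (at z)"
    using z by (auto intro!: derivative_eq_intros has_derivative_nth[THEN has_derivative_eq_rhs] simp: field_simps)
  show "\<bar>v $ 2 / z $ 2\<bar> \<le> norm v / z $ 2"
    using z component_le_norm_cart[of v 2] by (simp add: divide_right_mono)
qed

lemma abs_linear_2_le_norm:
  fixes v :: "real ^ 2"
  shows "\<bar>a * v $ 1 + b * v $ 2\<bar> \<le> sqrt (a\<^sup>2 + b\<^sup>2) * norm v"
  using Cauchy_Schwarz_ineq2[of "vector [a, b]" v] by (simp add: inner_vec_def sum_2 norm_2)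

text \<open>The function is the signed hyperbolic distance from the vertical geodesic over
  \<open>c\<close>. Its gradient curves are the semicircles centred at \<open>c\<close>, so it
  calibrates all of them at once. The norm bound is Cauchy-Schwarz.\<close>

lemma calibration_circular:
  fixes c :: real and v z :: "real ^ 2"
  assumes "z \<in> hyperbolic_plane"
  defines "s \<equiv> (z $ 1 - c) / z $ 2"
  shows "((\<lambda>z. arsinh ((z $ 1 - c) / z $ 2)) has_derivative
      (\<lambda>v. (v $ 1 - s * v $ 2) / (z $ 2 * sqrt (s\<^sup>2 + 1)))) (at z)"
    and "\<bar>(v $ 1 - s * v $ 2) / (z $ 2 * sqrt (s\<^sup>2 + 1))\<bar> \<le> norm v / z $ 2"
proof -
  have z: "z $ 2 > 0" using assms by (simp add: hyperbolic_plane_def)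
  have d: "((\<lambda>z. (z $ 1 - c) / z $ 2) has_derivative (\<lambda>v. (v $ 1 - s * v $ 2) / z $ 2)) (at z)"
    unfolding s_def using z
    by (auto intro!: derivative_eq_intros has_derivative_nth[THEN has_derivative_eq_rhs] simp: field_simps)
  have "(arsinh has_real_derivative 1 / sqrt (s\<^sup>2 + 1)) (at ((z $ 1 - c) / z $ 2))"
    unfolding s_def by (rule arsinh_real_has_field_derivative)
  from has_derivative_compose[OF d this[unfolded has_field_derivative_def]]
  show "((\<lambda>z. arsinh ((z $ 1 - c) / z $ 2)) has_derivative
      (\<lambda>v. (v $ 1 - s * v $ 2) / (z $ 2 * sqrt (s\<^sup>2 + 1)))) (at z)"
    by (simp add: mult.commute)
  have p: "sqrt (s\<^sup>2 + 1) > 0" by (simp add: add_nonneg_pos)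
  have "\<bar>v $ 1 - s * v $ 2\<bar> \<le> sqrt (s\<^sup>2 + 1) * norm v"
    using abs_linear_2_le_norm[of 1 v "- s"] by (simp add: add.commute)
  then show "\<bar>(v $ 1 - s * v $ 2) / (z $ 2 * sqrt (s\<^sup>2 + 1))\<bar> \<le> norm v / z $ 2"
    using z p by (simp add: abs_mult divide_le_eq le_divide_eq mult.commute)
qed

definition vertical_geodesic :: "real \<Rightarrow> real \<Rightarrow> real \<Rightarrow> real \<Rightarrow> real ^ 2" where
  "vertical_geodesic x a b t = vector [x, exp (a + t * (b - a))]"

lemma vertical_geodesic:
  "vertical_geodesic x a b \<in> curves_between hyperbolic_plane hyperbolic_metric
     (vertical_geodesic x a b 0) (vertical_geodesic x a b 1)"
  "curve_length hyperbolic_metric (vertical_geodesic x a b) = \<bar>b - a\<bar>"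
proof -
  let ?D = "\<lambda>t. vector [0, (b - a) * exp (a + t * (b - a))] :: real ^ 2"
  have d: "(vertical_geodesic x a b has_vector_derivative ?D t) (at t)" for t
    unfolding vertical_geodesic_def
    by (intro has_vector_derivative_vector_2) (auto intro!: derivative_eq_intros)
  have c: "continuous_on UNIV ?D" unfolding vector_as_axes by (intro continuous_intros)
  have pos: "vertical_geodesic x a b t $ 2 > 0" for t by (simp add: vertical_geodesic_def)
  have n: "norm (?D t) = \<bar>b - a\<bar> * vertical_geodesic x a b t $ 2" for t
    by (simp add: norm_2 vertical_geodesic_def abs_mult)
  show "vertical_geodesic x a b \<in> curves_between hyperbolic_plane hyperbolic_metric
     (vertical_geodesic x a b 0) (vertical_geodesic x a b 1)"
    "curve_length hyperbolic_metric (vertical_geodesic x a b) = \<bar>b - a\<bar>"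
    using constant_speed_curve[OF d c _ n] pos by simp_all
qed

text \<open>The upper semicircle of radius \<open>\<rho>\<close> about the boundary point
  \<open>c\<close>, at constant hyperbolic speed for \<open>\<rho> > 0\<close>:
  \<open>a + t * (b - a)\<close> is the value at the current point of the function in
  \<open>calibration_circular\<close>.\<close>

definition circular_geodesic :: "real \<Rightarrow> real \<Rightarrow> real \<Rightarrow> real \<Rightarrow> real \<Rightarrow> real ^ 2" where
  "circular_geodesic c \<rho> a b t =
     vector [c + \<rho> * tanh (a + t * (b - a)), \<rho> / cosh (a + t * (b - a))]"

lemma circular_geodesic:
  assumes "\<rho> > 0"
  shows "circular_geodesic c \<rho> a b \<in> curves_between hyperbolic_plane hyperbolic_metric
     (circular_geodesic c \<rho> a b 0) (circular_geodesic c \<rho> a b 1)"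
  "curve_length hyperbolic_metric (circular_geodesic c \<rho> a b) = \<bar>b - a\<bar>"
proof -
  let ?s = "\<lambda>t. a + t * (b - a)"
  let ?D = "\<lambda>t. vector [\<rho> * (b - a) / (cosh (?s t))\<^sup>2, - \<rho> * (b - a) * sinh (?s t) / (cosh (?s t))\<^sup>2] :: real ^ 2"
  have ch: "cosh x \<noteq> 0" for x :: real using cosh_real_pos[of x] by linarith
  have d: "(circular_geodesic c \<rho> a b has_vector_derivative ?D t) (at t)" for t
    unfolding circular_geodesic_def
  proof (intro has_vector_derivative_vector_2)
    have "1 - (tanh x)\<^sup>2 = 1 / (cosh x)\<^sup>2" for x :: real
      using cosh_square_eq[of x] add_nonneg_pos[OF zero_le_power2 zero_less_one, of "sinh x"]
      by (simp add: tanh_def power_divide divide_eq_eq eq_divide_eq left_diff_distrib)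
    then show "((\<lambda>t. c + \<rho> * tanh (?s t)) has_real_derivative \<rho> * (b - a) / (cosh (?s t))\<^sup>2) (at t)"
      using ch by (auto intro!: derivative_eq_intros)
    show "((\<lambda>t. \<rho> / cosh (?s t)) has_real_derivative - \<rho> * (b - a) * sinh (?s t) / (cosh (?s t))\<^sup>2) (at t)"
      using ch by (auto intro!: derivative_eq_intros simp: power2_eq_square)
  qed
  have c: "continuous_on UNIV ?D" unfolding vector_as_axes using ch by (intro continuous_intros) auto
  have pos: "circular_geodesic c \<rho> a b t $ 2 > 0" for t using assms by (simp add: circular_geodesic_def)
  have n: "norm (?D t) = \<bar>b - a\<bar> * circular_geodesic c \<rho> a b t $ 2" for t
  proof -
    have "(\<rho> * (b - a) / (cosh (?s t))\<^sup>2)\<^sup>2 + (- \<rho> * (b - a) * sinh (?s t) / (cosh (?s t))\<^sup>2)\<^sup>2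
        = (\<rho> * (b - a))\<^sup>2 * ((sinh (?s t))\<^sup>2 + 1) / ((cosh (?s t))\<^sup>2)\<^sup>2"
      by (simp add: power_divide power_mult_distrib add_divide_distrib[symmetric] distrib_left)
    also have "\<dots> = (\<rho> * (b - a) / cosh (?s t))\<^sup>2"
      unfolding cosh_square_eq[symmetric] using ch[of "?s t"]
      by (simp add: power_divide power4_eq_xxxx power2_eq_square)
    finally show ?thesis using assms by (simp add: norm_2 circular_geodesic_def abs_mult)
  qed
  show "circular_geodesic c \<rho> a b \<in> curves_between hyperbolic_plane hyperbolic_metric
     (circular_geodesic c \<rho> a b 0) (circular_geodesic c \<rho> a b 1)"
    "curve_length hyperbolic_metric (circular_geodesic c \<rho> a b) = \<bar>b - a\<bar>"
    using constant_speed_curve[OF d c _ n] pos by simp_all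
qed

text \<open>A circle centred on the boundary line is encoded by its squared Euclidean norm being
  affine in the first coordinate, \<open>k + c * w $ 1\<close>; in this form convexity can be read
  off.\<close>

definition on_geodesic_between :: "real ^ 2 \<Rightarrow> real ^ 2 \<Rightarrow> real ^ 2 \<Rightarrow> bool" where
  "on_geodesic_between p q z \<longleftrightarrow> z $ 2 > 0 \<and>
       ((p $ 1 = q $ 1 \<and> z $ 1 = p $ 1 \<and> (p $ 2 \<le> z $ 2 \<and> z $ 2 \<le> q $ 2 \<or> q $ 2 \<le> z $ 2 \<and> z $ 2 \<le> p $ 2)) \<or>
        (p $ 1 \<le> z $ 1 \<and> z $ 1 \<le> q $ 1 \<or> q $ 1 \<le> z $ 1 \<and> z $ 1 \<le> p $ 1) \<and>
        (\<exists>c k. \<forall>w\<in>{p, q, z}. (w $ 1)\<^sup>2 + (w $ 2)\<^sup>2 = k + c * w $ 1))"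

lemma hyperbolic_geodesic:
  assumes p: "p $ 2 > 0" and q: "q $ 2 > 0"
  obtains \<gamma> where "minimizing_geodesic hyperbolic_plane hyperbolic_metric p q \<gamma>"
    "hyperbolic_dist p q \<ge> 0"
    "cosh (hyperbolic_dist p q) = ((p $ 1 - q $ 1)\<^sup>2 + (p $ 2)\<^sup>2 + (q $ 2)\<^sup>2) / (2 * p $ 2 * q $ 2)"
    "\<And>z. z \<in> path_image \<gamma> \<Longrightarrow> on_geodesic_between p q z"
proof (cases "p $ 1 = q $ 1")
  case True
  define a where "a = ln (p $ 2)"
  define b where "b = ln (q $ 2)"
  let ?\<gamma> = "vertical_geodesic (p $ 1) a b"
  have e: "exp a = p $ 2" "exp b = q $ 2" using p q by (auto simp: a_def b_def)
  have ends: "?\<gamma> 0 = p" "?\<gamma> 1 = q" using True e by (auto simp: vertical_geodesic_def vector_eq_2)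
  note v = vertical_geodesic[of "p $ 1" a b, unfolded ends]
  have "curve_length hyperbolic_metric ?\<gamma> = \<bar>ln (q $ 2) - ln (p $ 2)\<bar>"
    using v(2) by (simp add: a_def b_def)
  note m = calibrated_curve_minimizing[OF v(1) calibration_vertical this]
  have m2: "hyperbolic_dist p q = \<bar>b - a\<bar>" using m(2) by (simp add: a_def b_def)
  show ?thesis
  proof (rule that[OF m(1)])
    show "0 \<le> hyperbolic_dist p q" by (simp add: m2)
    have "cosh (b - a) = (exp b / exp a + exp a / exp b) / 2"
      by (simp add: cosh_def exp_diff exp_minus field_simps)
    then have "cosh \<bar>b - a\<bar> = (exp b / exp a + exp a / exp b) / 2" by simp
    then show "cosh (hyperbolic_dist p q) = ((p $ 1 - q $ 1)\<^sup>2 + (p $ 2)\<^sup>2 + (q $ 2)\<^sup>2) / (2 * p $ 2 * q $ 2)"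
      using p q True by (simp add: m2 e field_simps power2_eq_square)
    fix z assume "z \<in> path_image ?\<gamma>"
    then obtain t where t: "t \<in> {0..1}" "z = ?\<gamma> t" by (auto simp: path_image_def)
    have "a + t * (b - a) \<in> closed_segment a b"
      using t(1) by (auto simp: in_segment algebra_simps intro!: exI[of _ t])
    then show "on_geodesic_between p q z"
      unfolding on_geodesic_between_def t(2) e[symmetric] using True
      by (auto simp: vertical_geodesic_def closed_segment_eq_real_ivl split: if_splits)
  qed
next
  case False
  \<comment> \<open>The point of the boundary line at equal Euclidean distance from \<open>p\<close>
    and \<open>q\<close>, hence the centre of the semicircle through both.\<close>
  define c where "c = ((q $ 1)\<^sup>2 + (q $ 2)\<^sup>2 - (p $ 1)\<^sup>2 - (p $ 2)\<^sup>2) / (2 * (q $ 1 - p $ 1))"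
  define \<rho> where "\<rho> = sqrt ((p $ 1 - c)\<^sup>2 + (p $ 2)\<^sup>2)"
  have rp: "\<rho>\<^sup>2 = (p $ 1 - c)\<^sup>2 + (p $ 2)\<^sup>2" by (simp add: \<rho>_def)
  have "c * (2 * (q $ 1 - p $ 1)) = (q $ 1)\<^sup>2 + (q $ 2)\<^sup>2 - (p $ 1)\<^sup>2 - (p $ 2)\<^sup>2"
    unfolding c_def by (rule nonzero_eq_divide_eq[THEN iffD1, OF _ refl]) (use False in simp)
  then have c2: "2 * c * (q $ 1 - p $ 1) = (q $ 1)\<^sup>2 + (q $ 2)\<^sup>2 - (p $ 1)\<^sup>2 - (p $ 2)\<^sup>2"
    by (simp only: ac_simps)
  have rq: "\<rho>\<^sup>2 = (q $ 1 - c)\<^sup>2 + (q $ 2)\<^sup>2"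
    using c2 unfolding rp by (simp add: power2_eq_square algebra_simps)
  have r0: "\<rho> > 0" using p unfolding \<rho>_def by (simp add: add_nonneg_pos)
  define \<tau> where "\<tau> = (\<lambda>z :: real ^ 2. arsinh ((z $ 1 - c) / z $ 2))"
  have co: "cosh (\<tau> w) = \<rho> / w $ 2" "sinh (\<tau> w) = (w $ 1 - c) / w $ 2"
    if "w $ 2 > 0" "\<rho>\<^sup>2 = (w $ 1 - c)\<^sup>2 + (w $ 2)\<^sup>2" for w
  proof -
    have "((w $ 1 - c) / w $ 2)\<^sup>2 + 1 = (\<rho> / w $ 2)\<^sup>2"
      using that by (simp add: power_divide add_divide_distrib)
    then show "cosh (\<tau> w) = \<rho> / w $ 2" "sinh (\<tau> w) = (w $ 1 - c) / w $ 2"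
      using that r0 by (simp_all add: \<tau>_def cosh_arsinh_real)
  qed
  note cp = co[OF p rp] and cq = co[OF q rq]
  let ?\<gamma> = "circular_geodesic c \<rho> (\<tau> p) (\<tau> q)"
  have ends: "?\<gamma> 0 = p" "?\<gamma> 1 = q"
    using p q r0 cp cq by (auto simp: circular_geodesic_def vector_eq_2 tanh_def)
  note v = circular_geodesic[OF r0, of c "\<tau> p" "\<tau> q", unfolded ends]
  have "curve_length hyperbolic_metric ?\<gamma> = \<bar>arsinh ((q $ 1 - c) / q $ 2) - arsinh ((p $ 1 - c) / p $ 2)\<bar>"
    using v(2) by (simp add: \<tau>_def)
  note m = calibrated_curve_minimizing[OF v(1) calibration_circular this]
  have m2: "hyperbolic_dist p q = \<bar>\<tau> q - \<tau> p\<bar>" using m(2) by (simp add: \<tau>_def)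
  show ?thesis
  proof (rule that[OF m(1)])
    show "0 \<le> hyperbolic_dist p q" by (simp add: m2)
    have "cosh (hyperbolic_dist p q) = \<rho> / q $ 2 * (\<rho> / p $ 2) - (q $ 1 - c) / q $ 2 * ((p $ 1 - c) / p $ 2)"
      by (simp add: m2 cosh_real_abs cosh_diff cp cq)
    also have "\<dots> = (2 * \<rho>\<^sup>2 - 2 * (q $ 1 - c) * (p $ 1 - c)) / (2 * p $ 2 * q $ 2)"
      using p q by (simp add: field_simps power2_eq_square)
    also have "2 * \<rho>\<^sup>2 - 2 * (q $ 1 - c) * (p $ 1 - c) = (p $ 1 - q $ 1)\<^sup>2 + (p $ 2)\<^sup>2 + (q $ 2)\<^sup>2"
      using rp rq by (simp add: power2_eq_square algebra_simps)
    finally show "cosh (hyperbolic_dist p q) = ((p $ 1 - q $ 1)\<^sup>2 + (p $ 2)\<^sup>2 + (q $ 2)\<^sup>2) / (2 * p $ 2 * q $ 2)" .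
    fix z assume "z \<in> path_image ?\<gamma>"
    then obtain t where t: "t \<in> {0..1}" "z = ?\<gamma> t" by (auto simp: path_image_def)
    define s where "s = \<tau> p + t * (\<tau> q - \<tau> p)"
    have z: "z $ 1 = c + \<rho> * tanh s" "z $ 2 = \<rho> / cosh s"
      by (auto simp: t(2) circular_geodesic_def s_def)
    have p1: "p $ 1 = c + \<rho> * tanh (\<tau> p)" and q1: "q $ 1 = c + \<rho> * tanh (\<tau> q)"
      using ends by (auto simp: circular_geodesic_def vector_eq_2)
    have "s \<in> closed_segment (\<tau> p) (\<tau> q)"
      using t(1) by (auto simp: in_segment s_def algebra_simps intro!: exI[of _ t])
    then have "p $ 1 \<le> z $ 1 \<and> z $ 1 \<le> q $ 1 \<or> q $ 1 \<le> z $ 1 \<and> z $ 1 \<le> p $ 1"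
      unfolding z p1 q1 using r0 by (auto simp: closed_segment_eq_real_ivl split: if_splits)
    moreover have "z $ 2 > 0" using r0 by (simp add: z)
    moreover have "\<rho>\<^sup>2 = (z $ 1 - c)\<^sup>2 + (z $ 2)\<^sup>2"
    proof -
      have "(z $ 1 - c)\<^sup>2 + (z $ 2)\<^sup>2 = \<rho>\<^sup>2 * (((sinh s)\<^sup>2 + 1) / (cosh s)\<^sup>2)"
        by (simp add: z tanh_def power_divide power_mult_distrib add_divide_distrib distrib_left)
      also have "((sinh s)\<^sup>2 + 1) / (cosh s)\<^sup>2 = 1"
        using cosh_real_pos[of s] by (simp add: cosh_square_eq[symmetric])
      finally show ?thesis by simp
    qed
    then have "\<forall>w\<in>{p, q, z}. (w $ 1)\<^sup>2 + (w $ 2)\<^sup>2 = (\<rho>\<^sup>2 - c\<^sup>2) + 2 * c * w $ 1"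
      using rp rq by (auto simp: power2_eq_square algebra_simps)
    ultimately show "on_geodesic_between p q z"
      unfolding on_geodesic_between_def by blast
  qed
qed

section \<open>The polar rectangle: convexity, boundedness and diameter\<close>

definition polar_rectangle :: "real \<Rightarrow> (real ^ 2) set" where
  "polar_rectangle L = {p. 1 < (p $ 1)\<^sup>2 + (p $ 2)\<^sup>2 \<and> (p $ 1)\<^sup>2 + (p $ 2)\<^sup>2 < exp (2 * L) \<and> \<bar>p $ 1\<bar> < p $ 2}"

definition closed_rectangle :: "real \<Rightarrow> (real ^ 2) set" where
  "closed_rectangle L = {p. 1 \<le> (p $ 1)\<^sup>2 + (p $ 2)\<^sup>2 \<and> (p $ 1)\<^sup>2 + (p $ 2)\<^sup>2 \<le> exp (2 * L) \<and> \<bar>p $ 1\<bar> \<le> p $ 2}"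

lemma polar_rectangle_subset_closed: "polar_rectangle L \<subseteq> closed_rectangle L"
  by (auto simp: polar_rectangle_def closed_rectangle_def)

lemma open_polar_rectangle: "open (polar_rectangle L)"
  unfolding polar_rectangle_def
  by (intro open_Collect_conj open_Collect_less continuous_intros)

lemma closed_closed_rectangle: "closed (closed_rectangle L)"
  unfolding closed_rectangle_def
  by (intro closed_Collect_conj closed_Collect_le continuous_intros)

lemma closed_rectangle_pos:
  assumes "p \<in> closed_rectangle L"
  shows "p $ 2 > 0"
proof (rule ccontr)
  assume "\<not> p $ 2 > 0"
  then have "p $ 2 = 0" "p $ 1 = 0" using assms by (auto simp: closed_rectangle_def)
  then show False using assms by (simp add: closed_rectangle_def)
qed

lemma bounded_closed_rectangle: "bounded (closed_rectangle L)"
proof (rule boundedI)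
  fix p assume "p \<in> closed_rectangle L"
  then show "norm p \<le> sqrt (exp (2 * L))"
    by (simp add: norm_2 closed_rectangle_def)
qed

lemma affine_between:
  fixes c k l :: real
  assumes "a \<le> z \<and> z \<le> b \<or> b \<le> z \<and> z \<le> a"
  shows "k + c * a < l \<Longrightarrow> k + c * b < l \<Longrightarrow> k + c * z < l"
    and "l < k + c * a \<Longrightarrow> l < k + c * b \<Longrightarrow> l < k + c * z"
proof -
  obtain u v where uv: "0 \<le> u" "0 \<le> v" "u + v = 1" "z = u * a + v * b"
  proof -
    have "z \<in> closed_segment a b" using assms by (auto simp: closed_segment_eq_real_ivl)
    then obtain u where "0 \<le> u" "u \<le> 1" "z = (1 - u) * a + u * b" by (auto simp: closed_segment_def)
    then show ?thesis using that[of "1 - u" u] by simp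
  qed
  have e: "k + c * z = u * (k + c * a) + v * (k + c * b)"
  proof -
    have "k + c * z = (u + v) * k + c * (u * a + v * b)" using uv by simp
    then show ?thesis by (simp add: algebra_simps)
  qed
  show "k + c * a < l \<Longrightarrow> k + c * b < l \<Longrightarrow> k + c * z < l"
    unfolding e using convex_bound_lt[of "k + c * a" l "k + c * b" u v] uv by simp
  show "l < k + c * a \<Longrightarrow> l < k + c * b \<Longrightarrow> l < k + c * z"
    unfolding e using convex_bound_lt[of "- (k + c * a)" "- l" "- (k + c * b)" u v] uv
    by (simp add: algebra_simps)
qed

text \<open>Between \<open>a\<close> and \<open>b\<close> the parabola lies below its chord, and the
  chord lies below the affine function because it does so at both ends.\<close>

lemma convex_quadratic_between:
  fixes c k :: real
  assumes z: "a \<le> z \<and> z \<le> b \<or> b \<le> z \<and> z \<le> a"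
    and ab: "2 * a\<^sup>2 < k + c * a" "2 * b\<^sup>2 < k + c * b"
  shows "2 * z\<^sup>2 < k + c * z"
proof -
  have "(z - a) * (z - b) \<le> 0" using z by (auto intro: mult_nonneg_nonpos mult_nonpos_nonneg)
  then have "2 * z\<^sup>2 \<le> - 2 * (a * b) + 2 * (a + b) * z" by (simp add: power2_eq_square algebra_simps)
  also have "- 2 * (a * b) + 2 * (a + b) * z < k + c * z"
  proof -
    have "0 < (k + 2 * (a * b)) + (c - 2 * (a + b)) * z"
      by (rule affine_between(2)[OF z]) (use ab in \<open>simp_all add: power2_eq_square algebra_simps\<close>)
    then show ?thesis by (simp add: algebra_simps)
  qed
  finally show ?thesis .
qed

text \<open>On a circular geodesic the squared norm is affine in the first coordinate, so the radial
  bounds pass from the ends to the points between. The angular condition reads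
  \<open>2 * (z $ 1)\<^sup>2 < (z $ 1)\<^sup>2 + (z $ 2)\<^sup>2\<close>, a convex quadratic below
  an affine function, and passes on too.\<close>

lemma hyperbolic_convex_polar_rectangle: "hyperbolic_convex (polar_rectangle L)"
  unfolding hyperbolic_convex_def
proof (intro ballI)
  fix p q assume p: "p \<in> polar_rectangle L" and q: "q \<in> polar_rectangle L"
  have "p $ 2 > 0" "q $ 2 > 0" using p q by (auto simp: polar_rectangle_def)
  then obtain \<gamma> where \<gamma>: "minimizing_geodesic hyperbolic_plane hyperbolic_metric p q \<gamma>"
    and im: "\<And>z. z \<in> path_image \<gamma> \<Longrightarrow> on_geodesic_between p q z"
    by (rule hyperbolic_geodesic) blast
  have "z \<in> polar_rectangle L" if z: "z \<in> path_image \<gamma>" for z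
  proof -
    consider (vertical) "p $ 1 = q $ 1" "z $ 1 = p $ 1"
        "p $ 2 \<le> z $ 2 \<and> z $ 2 \<le> q $ 2 \<or> q $ 2 \<le> z $ 2 \<and> z $ 2 \<le> p $ 2"
      | (circular) c k where "p $ 1 \<le> z $ 1 \<and> z $ 1 \<le> q $ 1 \<or> q $ 1 \<le> z $ 1 \<and> z $ 1 \<le> p $ 1"
        "\<forall>w\<in>{p, q, z}. (w $ 1)\<^sup>2 + (w $ 2)\<^sup>2 = k + c * w $ 1"
      using im[OF z] unfolding on_geodesic_between_def by blast
    then show ?thesis
    proof cases
      case vertical
      then have "(p $ 2)\<^sup>2 \<le> (z $ 2)\<^sup>2 \<and> (z $ 2)\<^sup>2 \<le> (q $ 2)\<^sup>2 \<or> (q $ 2)\<^sup>2 \<le> (z $ 2)\<^sup>2 \<and> (z $ 2)\<^sup>2 \<le> (p $ 2)\<^sup>2"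
        using \<open>p $ 2 > 0\<close> \<open>q $ 2 > 0\<close> by (auto intro!: power_mono)
      moreover have "(z $ 1)\<^sup>2 = (p $ 1)\<^sup>2" "(q $ 1)\<^sup>2 = (p $ 1)\<^sup>2" "\<bar>z $ 1\<bar> = \<bar>p $ 1\<bar>" "\<bar>q $ 1\<bar> = \<bar>p $ 1\<bar>"
        using vertical by simp_all
      ultimately show ?thesis
        using vertical(3) p q unfolding polar_rectangle_def mem_Collect_eq
        by (elim disjE conjE; intro conjI; linarith)
    next
      case circular
      note b = circular(1)
      have "z $ 2 > 0" using im[OF z] unfolding on_geodesic_between_def by blast
    from circular(2) have e: "(p $ 1)\<^sup>2 + (p $ 2)\<^sup>2 = k + c * p $ 1" "(q $ 1)\<^sup>2 + (q $ 2)\<^sup>2 = k + c * q $ 1"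
      "(z $ 1)\<^sup>2 + (z $ 2)\<^sup>2 = k + c * z $ 1" by auto
    have sq: "\<bar>w $ 1\<bar> < w $ 2 \<longleftrightarrow> 2 * (w $ 1)\<^sup>2 < (w $ 1)\<^sup>2 + (w $ 2)\<^sup>2" if "w $ 2 > 0" for w :: "real ^ 2"
      using that abs_le_square_iff[of "w $ 2" "w $ 1"] by auto
    have "1 < k + c * z $ 1" "k + c * z $ 1 < exp (2 * L)"
      using affine_between[OF b] p q unfolding polar_rectangle_def e[symmetric] by (auto simp: e)
    moreover have "2 * (z $ 1)\<^sup>2 < k + c * z $ 1"
      by (rule convex_quadratic_between[OF b])
        (use p q sq[OF \<open>p $ 2 > 0\<close>] sq[OF \<open>q $ 2 > 0\<close>] in \<open>auto simp: polar_rectangle_def e\<close>)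
    ultimately show ?thesis using sq[OF \<open>z $ 2 > 0\<close>] by (simp add: polar_rectangle_def e)
    qed
  qed
  then show "\<exists>\<gamma>. minimizing_geodesic hyperbolic_plane hyperbolic_metric p q \<gamma> \<and> path_image \<gamma> \<subseteq> polar_rectangle L"
    using \<gamma> by blast
qed

lemma vertical_in_polar_rectangle:
  assumes "0 < t" "t < L"
  shows "vector [0, exp t] \<in> polar_rectangle L"
  using assms by (simp add: polar_rectangle_def exp_double[symmetric])

lemma hyperbolic_domain_polar_rectangle:
  assumes "L > 0"
  shows "hyperbolic_domain (polar_rectangle L)"
  unfolding hyperbolic_domain_def
proof (intro conjI)
  have cl: "closure (polar_rectangle L) \<subseteq> closed_rectangle L"
    using polar_rectangle_subset_closed closed_closed_rectangle by (rule closure_minimal)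
  then show "closure (polar_rectangle L) \<subseteq> hyperbolic_plane"
    using closed_rectangle_pos by (auto simp: hyperbolic_plane_def)
  show "compact (closure (polar_rectangle L))"
    using bounded_subset[OF bounded_closed_rectangle cl] by (simp add: compact_eq_bounded_closed)
  show "polar_rectangle L \<noteq> {}"
    using vertical_in_polar_rectangle[of "L / 2" L] assms by auto
  have "path_connected (polar_rectangle L)"
    unfolding path_connected_def
  proof (intro ballI)
    fix p q assume "p \<in> polar_rectangle L" "q \<in> polar_rectangle L"
    then obtain \<gamma> where "minimizing_geodesic hyperbolic_plane hyperbolic_metric p q \<gamma>" "path_image \<gamma> \<subseteq> polar_rectangle L"
      using hyperbolic_convex_polar_rectangle unfolding hyperbolic_convex_def by blast
    then show "\<exists>g. path g \<and> path_image g \<subseteq> polar_rectangle L \<and> pathstart g = p \<and> pathfinish g = q"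
      by (auto simp: minimizing_geodesic_def curves_between_def intro: valid_path_imp_path)
  qed
  then show "connected (polar_rectangle L)" by (rule path_connected_imp_connected)
qed (rule open_polar_rectangle)

text \<open>In the sector the Euclidean norms satisfy \<open>P * Q \<le> 2 * p $ 2 * q $ 2\<close>,
  so the distance formula gives \<open>cosh d \<le> P / Q + Q / P + 1 \<le> 3 * exp L\<close>. The
  additive 3 absorbs the resulting factor in \<open>exp d \<le> 2 * cosh d \<le> 6 * exp L\<close>,
  as \<open>exp 3 \<ge> 8\<close>.\<close>

lemma hyperbolic_dist_polar_rectangle_le:
  assumes p: "p \<in> polar_rectangle L" and q: "q \<in> polar_rectangle L"
  shows "hyperbolic_dist p q \<le> L + 3"
proof -
  have pos: "p $ 2 > 0" "q $ 2 > 0" using p q by (auto simp: polar_rectangle_def)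
  define d where "d = hyperbolic_dist p q"
  have d: "cosh d = ((p $ 1 - q $ 1)\<^sup>2 + (p $ 2)\<^sup>2 + (q $ 2)\<^sup>2) / (2 * p $ 2 * q $ 2)"
    unfolding d_def using pos by (rule hyperbolic_geodesic)
  have half: "(norm w)\<^sup>2 \<le> 2 * (w $ 2)\<^sup>2" "1 < norm w" "norm w < exp L" "\<bar>w $ 1\<bar> \<le> w $ 2"
    if "w \<in> polar_rectangle L" for w
  proof -
    have "(w $ 1)\<^sup>2 \<le> (w $ 2)\<^sup>2" using that by (intro power2_le_iff_abs_le[THEN iffD2]) (auto simp: polar_rectangle_def)
    then show "(norm w)\<^sup>2 \<le> 2 * (w $ 2)\<^sup>2" by (simp add: norm_2)
    show "1 < norm w" using that by (simp add: norm_2 polar_rectangle_def)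
    have "norm w < sqrt (exp (2 * L))" using that by (simp add: norm_2 polar_rectangle_def)
    also have "sqrt (exp (2 * L)) = exp L" by (simp add: exp_double)
    finally show "norm w < exp L" .
    show "\<bar>w $ 1\<bar> \<le> w $ 2" using that by (auto simp: polar_rectangle_def)
  qed
  define P where "P = norm p"
  define Q where "Q = norm q"
  have P: "1 < P" "P < exp L" "P\<^sup>2 = (p $ 1)\<^sup>2 + (p $ 2)\<^sup>2" and Q: "1 < Q" "Q < exp L" "Q\<^sup>2 = (q $ 1)\<^sup>2 + (q $ 2)\<^sup>2"
    using half[OF p] half[OF q] by (auto simp: P_def Q_def norm_2)
  have PQ: "P * Q \<le> 2 * p $ 2 * q $ 2"
  proof (rule power2_le_imp_le)
    have "(P * Q)\<^sup>2 \<le> (2 * (p $ 2)\<^sup>2) * (2 * (q $ 2)\<^sup>2)"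
      unfolding power_mult_distrib P_def Q_def using half[OF p] half[OF q] by (intro mult_mono) auto
    then show "(P * Q)\<^sup>2 \<le> (2 * p $ 2 * q $ 2)\<^sup>2" by (simp add: power_mult_distrib)
  qed (use pos in simp)
  have "\<bar>p $ 1 * q $ 1\<bar> \<le> p $ 2 * q $ 2"
    unfolding abs_mult using half(4)[OF p] half(4)[OF q] pos by (intro mult_mono) auto
  then have "(p $ 1 - q $ 1)\<^sup>2 + (p $ 2)\<^sup>2 + (q $ 2)\<^sup>2 \<le> P\<^sup>2 + Q\<^sup>2 + 2 * p $ 2 * q $ 2"
    using P(3) Q(3) by (simp add: power2_diff abs_le_iff)
  then have "cosh d \<le> (P\<^sup>2 + Q\<^sup>2 + 2 * p $ 2 * q $ 2) / (2 * p $ 2 * q $ 2)"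
    unfolding d using pos by (intro divide_right_mono) auto
  also have "\<dots> = (P\<^sup>2 + Q\<^sup>2) / (2 * p $ 2 * q $ 2) + 1" using pos by (simp add: add_divide_distrib)
  also have "(P\<^sup>2 + Q\<^sup>2) / (2 * p $ 2 * q $ 2) \<le> (P\<^sup>2 + Q\<^sup>2) / (P * Q)"
    using PQ P Q pos by (intro divide_left_mono) auto
  also have "(P\<^sup>2 + Q\<^sup>2) / (P * Q) = P / Q + Q / P"
    using P Q by (simp add: power2_eq_square field_simps)
  also have "P / Q \<le> exp L / 1" using P Q by (intro frac_le) auto
  also have "Q / P \<le> exp L / 1" using P Q by (intro frac_le) auto
  also have "exp L / 1 + exp L / 1 + 1 \<le> 3 * exp L" using P(1,2) unfolding div_by_1 by linarith
  finally have "cosh d \<le> 3 * exp L" by simp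
  moreover have "exp d \<le> 2 * cosh d" by (simp add: cosh_def)
  ultimately have "exp d \<le> 6 * exp L" by simp
  also have "6 \<le> exp (3 :: real)"
  proof -
    have "2 \<le> exp (1 :: real)" using exp_ge_add_one_self[of 1] by simp
    then have "2 ^ 3 \<le> exp (1 :: real) ^ 3" by (intro power_mono) auto
    then show ?thesis by (simp add: exp_of_nat_mult[symmetric])
  qed
  then have "6 * exp L \<le> exp (L + 3)" by (simp add: exp_add mult.commute)
  finally show ?thesis by (simp add: d_def)
qed

text \<open>Positivity is recorded because the final bound divides by the squared diameter, and
  division by zero would return 0.\<close>

lemma hyperbolic_diameter_polar_rectangle:
  assumes "L > 0"
  shows "0 < hyperbolic_diameter (polar_rectangle L)" "hyperbolic_diameter (polar_rectangle L) \<le> L + 3"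
proof -
  let ?p = "vector [0, exp (L / 3)] :: real ^ 2" and ?q = "vector [0, exp (L / 2)] :: real ^ 2"
  have mem: "?p \<in> polar_rectangle L" "?q \<in> polar_rectangle L"
    using assms by (auto intro!: vertical_in_polar_rectangle)
  show "hyperbolic_diameter (polar_rectangle L) \<le> L + 3"
    unfolding hyperbolic_diameter_def
    using mem hyperbolic_dist_polar_rectangle_le by (intro cSUP_least) auto
  have bdd: "bdd_above ((\<lambda>(p, q). hyperbolic_dist p q) ` (polar_rectangle L \<times> polar_rectangle L))"
    by (rule bdd_aboveI2[where M = "L + 3"]) (auto intro: hyperbolic_dist_polar_rectangle_le)
  have "hyperbolic_dist ?p ?q \<le> hyperbolic_diameter (polar_rectangle L)"
    unfolding hyperbolic_diameter_def
    using cSUP_upper[OF _ bdd, of "(?p, ?q)"] mem by simp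
  moreover have "hyperbolic_dist ?p ?q > 0"
  proof -
    have pos: "?p $ 2 > 0" "?q $ 2 > 0" by auto
    have d: "hyperbolic_dist ?p ?q \<ge> 0" using pos by (rule hyperbolic_geodesic)
    have "cosh (hyperbolic_dist ?p ?q) =
        ((?p $ 1 - ?q $ 1)\<^sup>2 + (?p $ 2)\<^sup>2 + (?q $ 2)\<^sup>2) / (2 * ?p $ 2 * ?q $ 2)"
      using pos by (rule hyperbolic_geodesic)
    moreover have "(exp (L / 3) - exp (L / 2))\<^sup>2 > 0" using assms by simp
    ultimately have "cosh (hyperbolic_dist ?p ?q) > 1"
      by (simp add: less_divide_eq power2_diff)
    then show ?thesis using d by (cases "hyperbolic_dist ?p ?q = 0") auto
  qed
  ultimately show "0 < hyperbolic_diameter (polar_rectangle L)" by simp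
qed

section \<open>The Laplacian in polar coordinates\<close>

lemma partial_deriv_eq:
  assumes "(u has_derivative D) (at p)"
  shows "partial_deriv i u p = D (axis i 1)"
proof -
  have "((\<lambda>t. p + t *\<^sub>R axis i 1) has_derivative (\<lambda>t. t *\<^sub>R axis i 1)) (at 0)"
    by (auto intro!: derivative_eq_intros)
  from has_derivative_compose[OF this, of u D]
  have "((\<lambda>t. u (p + t *\<^sub>R axis i 1)) has_derivative (\<lambda>t. D (t *\<^sub>R axis i 1))) (at 0)"
    using assms by simp
  then have "((\<lambda>t. u (p + t *\<^sub>R axis i 1)) has_real_derivative D (axis i 1)) (at 0)"
    using linear_scale[OF has_derivative_linear[OF assms]]
    by (simp add: has_field_derivative_def mult.commute[of "D _"] mult_commute_abs)
  then show ?thesis unfolding partial_deriv_def by (rule DERIV_imp_deriv)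
qed

lemma partial_deriv_cong:
  fixes p :: "real ^ 'n"
  assumes "open S" "p \<in> S" "\<And>q. q \<in> S \<Longrightarrow> u q = w q"
  shows "partial_deriv i u p = partial_deriv i w p"
  unfolding partial_deriv_def
proof (rule deriv_cong_ev[OF _ refl])
  have "((\<lambda>t. p + t *\<^sub>R axis i 1) \<longlongrightarrow> p + 0 *\<^sub>R axis i 1) (nhds (0::real))"
    by (intro tendsto_intros filterlim_ident)
  then have "eventually (\<lambda>t. p + t *\<^sub>R axis i 1 \<in> S) (nhds (0::real))"
    using assms(1,2) by (simp add: topological_tendstoD)
  then show "\<forall>\<^sub>F t in nhds 0. u (p + t *\<^sub>R axis i 1) = w (p + t *\<^sub>R axis i 1)"
    by eventually_elim (rule assms(3))
qed

text \<open>Keeping both partial derivatives as explicit coefficients lets second derivatives be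
  computed by rules on coefficient functions.\<close>

definition has_gradient :: "(real ^ 2 \<Rightarrow> real) \<Rightarrow> real \<Rightarrow> real \<Rightarrow> real ^ 2 \<Rightarrow> bool" where
  "has_gradient u a b p \<longleftrightarrow> (u has_derivative (\<lambda>v. a * v $ 1 + b * v $ 2)) (at p)"

lemma has_gradient_partial_deriv:
  assumes "has_gradient u a b p"
  shows "partial_deriv 1 u p = a" "partial_deriv 2 u p = b"
  using partial_deriv_eq[OF assms[unfolded has_gradient_def]] by (auto simp: axis_def)

lemma differentiable_has_gradient:
  assumes "u differentiable (at p)"
  shows "has_gradient u (partial_deriv 1 u p) (partial_deriv 2 u p) p"
proof -
  obtain D where D: "(u has_derivative D) (at p)" using assms by (auto simp: differentiable_def)
  have "D v = partial_deriv 1 u p * v $ 1 + partial_deriv 2 u p * v $ 2" for v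
  proof -
    have "v = v $ 1 *\<^sub>R axis 1 1 + v $ 2 *\<^sub>R axis 2 1" by (simp add: vector_eq_2 axis_def)
    then have "D v = D (v $ 1 *\<^sub>R axis 1 1 + v $ 2 *\<^sub>R axis 2 1)" by simp
    also have "\<dots> = v $ 1 * D (axis 1 1) + v $ 2 * D (axis 2 1)"
      using has_derivative_linear[OF D] by (simp add: linear_add linear_scale)
    finally show ?thesis by (simp add: partial_deriv_eq[OF D] mult.commute)
  qed
  then have "D = (\<lambda>v. partial_deriv 1 u p * v $ 1 + partial_deriv 2 u p * v $ 2)" by auto
  then show ?thesis using D by (simp add: has_gradient_def)
qed

lemma has_gradient_cong:
  assumes "has_gradient u a b p" "open S" "p \<in> S" "\<And>q. q \<in> S \<Longrightarrow> u q = w q"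
  shows "has_gradient w a b p"
  using has_derivative_transform_within_open[OF assms(1)[unfolded has_gradient_def] assms(2-4)]
  by (simp add: has_gradient_def)

lemma C1_onI:
  assumes "\<And>p. p \<in> S \<Longrightarrow> has_gradient u (a p) (b p) p"
    and "continuous_on S a" "continuous_on S b"
  shows "C1_on S u"
  unfolding C1_on_def forall_2
proof (intro conjI ballI)
  show "u differentiable at p" if "p \<in> S" for p
    using assms(1)[OF that] by (auto simp: has_gradient_def differentiable_def)
  show "continuous_on S (partial_deriv 1 u)" "continuous_on S (partial_deriv 2 u)"
    using assms has_gradient_partial_deriv[OF assms(1)] by (simp_all cong: continuous_on_cong)
qed

lemma C1_on_cong:
  fixes u w :: "real ^ 2 \<Rightarrow> real"
  assumes "C1_on S u" "open S" "\<And>q. q \<in> S \<Longrightarrow> u q = w q"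
  shows "C1_on S w"
proof (rule C1_onI)
  fix p assume p: "p \<in> S"
  show "has_gradient w (partial_deriv 1 u p) (partial_deriv 2 u p) p"
    by (rule has_gradient_cong[OF differentiable_has_gradient assms(2) p assms(3)])
      (use assms(1) p in \<open>auto simp: C1_on_def\<close>)
qed (use assms(1) in \<open>auto simp: C1_on_def\<close>)

lemma C1_on_has_gradient:
  assumes "C1_on S u" "p \<in> S"
  shows "has_gradient u (partial_deriv 1 u p) (partial_deriv 2 u p) p"
  using assms by (intro differentiable_has_gradient) (auto simp: C1_on_def)

lemma matrix_inv_mat:
  fixes c :: real
  assumes "c \<noteq> 0"
  shows "matrix_inv (mat c :: real ^ 'n ^ 'n) = mat (1 / c)"
proof -
  have m: "mat a ** (mat b :: real ^ 'n ^ 'n) = mat (a * b)" for a b :: real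
    by (simp add: matrix_matrix_mult_def mat_def vec_eq_iff if_distrib[where f = "\<lambda>z. z * _"] cong: if_cong)
  have "\<exists>B. (mat c :: real ^ 'n ^ 'n) ** B = mat 1 \<and> B ** mat c = mat 1"
    using assms by (intro exI[of _ "mat (1 / c)"]) (simp add: m)
  then have "matrix_inv (mat c :: real ^ 'n ^ 'n) ** mat c = mat 1"
    unfolding matrix_inv_def by (rule someI2_ex) simp
  then have "matrix_inv (mat c) ** (mat c ** mat (1 / c)) = mat 1 ** (mat (1 / c) :: real ^ 'n ^ 'n)"
    by (simp add: matrix_mul_assoc)
  then show ?thesis using assms by (simp add: m)
qed

text \<open>In dimension two the volume factor and the inverse metric cancel inside the divergence,
  so only the outer factor \<open>(p $ 2)\<^sup>2\<close> remains in front of the Euclidean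
  Laplacian.\<close>

lemma laplace_beltrami_hyperbolic:
  assumes "p $ 2 > 0"
  shows "laplace_beltrami hyperbolic_metric u p =
    (p $ 2)\<^sup>2 * (partial_deriv 1 (partial_deriv 1 u) p + partial_deriv 2 (partial_deriv 2 u) p)"
proof -
  let ?w = "\<lambda>i q. sqrt (det (hyperbolic_metric q)) *
    (\<Sum>j\<in>UNIV. matrix_inv (hyperbolic_metric q) $ i $ j * partial_deriv j u q)"
  have det: "sqrt (det (hyperbolic_metric q)) = 1 / (q $ 2)\<^sup>2" for q
  proof -
    have "det (hyperbolic_metric q) = (1 / (q $ 2)\<^sup>2)\<^sup>2"
      by (simp add: hyperbolic_metric_def det_2 mat_def power2_eq_square)
    then show ?thesis by (simp only: real_sqrt_abs) simp
  qed
  have w: "?w i q = partial_deriv i u q" if "q \<in> {q. q $ 2 > 0}" for i and q :: "real ^ 2"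
  proof -
    have "q $ 2 > 0" using that by simp
    then have inv: "matrix_inv (hyperbolic_metric q) = mat ((q $ 2)\<^sup>2)"
      by (simp add: hyperbolic_metric_def matrix_inv_mat)
    have "(\<Sum>j\<in>UNIV. matrix_inv (hyperbolic_metric q) $ i $ j * partial_deriv j u q)
        = (q $ 2)\<^sup>2 * partial_deriv i u q"
      unfolding inv by (simp add: mat_def if_distrib[where f = "\<lambda>z. z * _"] cong: if_cong)
    then show ?thesis using \<open>q $ 2 > 0\<close> by (simp add: det)
  qed
  \<comment> \<open>The cancellation needs positive height; the outer derivative only sees a
    neighbourhood of \<open>p\<close>, where this holds.\<close>
  have "open {q :: real ^ 2. q $ 2 > 0}" by (intro open_Collect_less continuous_intros)
  then have "partial_deriv i (?w i) p = partial_deriv i (partial_deriv i u) p" for i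
    using assms w by (intro partial_deriv_cong[of "{q. q $ 2 > 0}"]) auto
  then show ?thesis
    unfolding laplace_beltrami_def det by (simp add: sum_2)
qed

section \<open>Polar coordinates, their inverse, and the equation in them\<close>

definition polar :: "real \<Rightarrow> real \<Rightarrow> real ^ 2" where
  "polar t x = vector [exp t * sin x, exp t * cos x]"

lemma polar_nth [simp]: "polar t x $ 1 = exp t * sin x" "polar t x $ 2 = exp t * cos x"
  by (simp_all add: polar_def)

lemma polar_norm: "(polar t x $ 1)\<^sup>2 + (polar t x $ 2)\<^sup>2 = exp (2 * t)"
proof -
  have "(polar t x $ 1)\<^sup>2 + (polar t x $ 2)\<^sup>2 = (exp t)\<^sup>2 * ((sin x)\<^sup>2 + (cos x)\<^sup>2)"
    by (simp only: polar_nth power_mult_distrib distrib_left)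
  then show ?thesis by (simp add: exp_double)
qed

lemma continuous_on_polar [continuous_intros]:
  fixes S :: "'a :: t2_space set"
  shows "continuous_on S f \<Longrightarrow> continuous_on S g \<Longrightarrow> continuous_on S (\<lambda>z. polar (f z) (g z))"
  unfolding polar_def vector_as_axes by (intro continuous_intros)

lemma polar_in_polar_rectangle:
  assumes x: "x \<in> strip"
  shows "polar t x \<in> polar_rectangle L \<longleftrightarrow> 0 < t \<and> t < L \<and> x \<in> inner_strip"
proof -
  have c: "cos x > 0" using cos_strip(1)[OF x] .
  have "\<bar>sin x\<bar> < cos x \<longleftrightarrow> (sin x)\<^sup>2 < (cos x)\<^sup>2"
    using abs_le_square_iff[of "cos x" "sin x"] c by auto
  also have "\<dots> \<longleftrightarrow> cos (pi / 2) < cos (2 * \<bar>x\<bar>)"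
    by (cases "x \<ge> 0") (simp_all add: cos_double)
  also have "\<dots> \<longleftrightarrow> 2 * \<bar>x\<bar> < pi / 2"
    using x by (intro cos_mono_less_eq) (auto simp: half_width_def)
  also have "\<dots> \<longleftrightarrow> x \<in> inner_strip"
    by (auto simp: half_width_def)
  finally have "\<bar>polar t x $ 1\<bar> < polar t x $ 2 \<longleftrightarrow> x \<in> inner_strip"
    by (simp add: abs_mult)
  then show ?thesis unfolding polar_rectangle_def mem_Collect_eq polar_norm by simp
qed

definition log_radius :: "real ^ 2 \<Rightarrow> real" where
  "log_radius p = ln ((p $ 1)\<^sup>2 + (p $ 2)\<^sup>2) / 2"

definition angle :: "real ^ 2 \<Rightarrow> real" where
  "angle p = arctan (p $ 1 / p $ 2)"

lemma log_radius_polar: "log_radius (polar t x) = t"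
  unfolding log_radius_def polar_norm by simp

lemma angle_polar:
  assumes "x \<in> strip"
  shows "angle (polar t x) = x"
proof -
  have "angle (polar t x) = arctan (tan x)" by (simp add: angle_def tan_def)
  then show ?thesis
    using assms half_width_less_pi_half by (simp add: arctan_tan)
qed

lemma angle_in_strip:
  assumes "\<bar>p $ 1\<bar> \<le> p $ 2" "p $ 2 > 0"
  shows "angle p \<in> strip"
proof -
  have "p $ 1 / p $ 2 \<le> 1" "- 1 \<le> p $ 1 / p $ 2" using assms by (auto simp: divide_le_eq le_divide_eq)
  then have "angle p \<le> arctan 1" "arctan (- 1) \<le> angle p" by (auto simp: angle_def arctan_le_iff simp del: arctan_one)
  then show ?thesis by (simp add: arctan_one half_width_def arctan_minus)
qed

lemma polar_log_radius_angle:
  assumes "p $ 2 > 0"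
  shows "polar (log_radius p) (angle p) = p"
proof -
  define r where "r = sqrt ((p $ 1)\<^sup>2 + (p $ 2)\<^sup>2)"
  have r0: "r > 0" using assms by (simp add: r_def add_nonneg_pos)
  have e: "exp (log_radius p) = r"
    using assms by (simp add: log_radius_def r_def ln_sqrt[symmetric] add_nonneg_pos)
  have "sqrt (1 + (p $ 1 / p $ 2)\<^sup>2) = r / p $ 2"
  proof -
    have "1 + (p $ 1 / p $ 2)\<^sup>2 = (r / p $ 2)\<^sup>2"
      using assms by (simp add: r_def power_divide field_simps)
    then show ?thesis using r0 assms by simp
  qed
  then have "sin (angle p) = p $ 1 / r" "cos (angle p) = p $ 2 / r"
    using assms by (simp_all add: angle_def sin_arctan cos_arctan)
  then show ?thesis using r0 by (simp add: vector_eq_2 e)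
qed

lemma has_gradient_nth:
  "has_gradient (\<lambda>p. p $ 1) 1 0 p" "has_gradient (\<lambda>p. p $ 2) 0 1 p"
  unfolding has_gradient_def using has_derivative_nth[of 1] has_derivative_nth[of 2] by auto

lemma has_gradient_eq:
  "has_gradient u a b p \<Longrightarrow> a = a' \<Longrightarrow> b = b' \<Longrightarrow> has_gradient u a' b' p"
  by simp

lemma has_gradient_add:
  assumes "has_gradient u a b p" "has_gradient w c d p"
  shows "has_gradient (\<lambda>p. u p + w p) (a + c) (b + d) p"
  using has_derivative_add[OF assms[unfolded has_gradient_def]]
  by (simp add: has_gradient_def algebra_simps)

lemma has_gradient_diff:
  assumes "has_gradient u a b p" "has_gradient w c d p"
  shows "has_gradient (\<lambda>p. u p - w p) (a - c) (b - d) p"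
  using has_derivative_diff[OF assms[unfolded has_gradient_def]]
  by (simp add: has_gradient_def algebra_simps)

lemma has_gradient_mult:
  assumes "has_gradient u a b p" "has_gradient w c d p"
  shows "has_gradient (\<lambda>p. u p * w p) (a * w p + u p * c) (b * w p + u p * d) p"
  using has_derivative_mult[OF assms[unfolded has_gradient_def]]
  by (simp add: has_gradient_def algebra_simps)

lemma has_gradient_compose:
  assumes "(g has_real_derivative g') (at (u p))" "has_gradient u a b p"
  shows "has_gradient (\<lambda>p. g (u p)) (g' * a) (g' * b) p"
  using has_derivative_compose[OF assms(2)[unfolded has_gradient_def] assms(1)[unfolded has_field_derivative_def]]
  by (simp add: has_gradient_def algebra_simps)

lemma has_gradient_polar:
  assumes "has_gradient w a b (polar t x)"
  shows "((\<lambda>t. w (polar t x)) has_real_derivative exp t * (sin x * a + cos x * b)) (at t)"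
    and "((\<lambda>x. w (polar t x)) has_real_derivative exp t * (cos x * a - sin x * b)) (at x)"
proof -
  have *: "((\<lambda>s. w (c s)) has_real_derivative a * d $ 1 + b * d $ 2) (at r)"
    if c: "(c has_vector_derivative d) (at r)" "c r = polar t x" for c d r
  proof -
    have "((\<lambda>s. w (c s)) has_derivative (\<lambda>h. a * (h *\<^sub>R d) $ 1 + b * (h *\<^sub>R d) $ 2)) (at r)"
      using has_derivative_compose[OF c(1)[unfolded has_vector_derivative_def], of w
          "\<lambda>v. a * v $ 1 + b * v $ 2"] assms c(2)
      unfolding has_gradient_def by simp
    moreover have "(\<lambda>h. a * (h *\<^sub>R d) $ 1 + b * (h *\<^sub>R d) $ 2) = (*) (a * d $ 1 + b * d $ 2)"
      by (simp add: fun_eq_iff algebra_simps)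
    ultimately show ?thesis by (simp only: has_field_derivative_def)
  qed
  have "((\<lambda>t. polar t x) has_vector_derivative vector [exp t * sin x, exp t * cos x]) (at t)"
    unfolding polar_def by (intro has_vector_derivative_vector_2) (auto intro!: derivative_eq_intros)
  from *[OF this] show "((\<lambda>t. w (polar t x)) has_real_derivative exp t * (sin x * a + cos x * b)) (at t)"
    by (simp add: algebra_simps)
  have "((\<lambda>x. polar t x) has_vector_derivative vector [exp t * cos x, - exp t * sin x]) (at x)"
    unfolding polar_def by (intro has_vector_derivative_vector_2) (auto intro!: derivative_eq_intros)
  from *[OF this] show "((\<lambda>x. w (polar t x)) has_real_derivative exp t * (cos x * a - sin x * b)) (at x)"
    by (simp add: algebra_simps)
qed

text \<open>The chart multiplies the Euclidean Laplacian by \<open>exp t * exp t\<close>, and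
  multiplying this by \<open>(cos x)\<^sup>2\<close> gives the squared height, whence the weight.
  Continuity is recorded for the derivatives in \<open>x\<close>, the variable in which integrals
  over \<open>t\<close> will be differentiated.\<close>

lemma eigenfunction_polar_derivatives:
  assumes u: "u \<in> dirichlet_eigenspace hyperbolic_metric (polar_rectangle L) \<mu>"
  defines "U \<equiv> \<lambda>t x. apply_bcontfun u (polar t x)"
    and "R \<equiv> {0<..<L} \<times> inner_strip"
  obtains Ut Utt Ux Uxx where
    "\<And>t x. (t, x) \<in> R \<Longrightarrow> ((\<lambda>t. U t x) has_real_derivative Ut t x) (at t)"
    "\<And>t x. (t, x) \<in> R \<Longrightarrow> ((\<lambda>t. Ut t x) has_real_derivative Utt t x) (at t)"
    "\<And>t x. (t, x) \<in> R \<Longrightarrow> ((\<lambda>x. U t x) has_real_derivative Ux t x) (at x)"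
    "\<And>t x. (t, x) \<in> R \<Longrightarrow> ((\<lambda>x. Ux t x) has_real_derivative Uxx t x) (at x)"
    "continuous_on R (\<lambda>(t, x). Ux t x)" "continuous_on R (\<lambda>(t, x). Uxx t x)"
    "\<And>t x. (t, x) \<in> R \<Longrightarrow> Utt t x + Uxx t x = - (\<mu> / (cos x)\<^sup>2) * U t x"
proof -
  let ?\<Omega> = "polar_rectangle L"
  let ?d = "\<lambda>i. partial_deriv i (apply_bcontfun u)"
  let ?dd = "\<lambda>i j. partial_deriv j (partial_deriv i (apply_bcontfun u))"
  have C: "C1_on ?\<Omega> (apply_bcontfun u)" "C1_on ?\<Omega> (?d 1)" "C1_on ?\<Omega> (?d 2)"
    and lap: "\<And>p. p \<in> ?\<Omega> \<Longrightarrow> laplace_beltrami hyperbolic_metric (apply_bcontfun u) p = - \<mu> * apply_bcontfun u p"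
    using u by (auto simp: dirichlet_eigenspace_def C2_on_def)
  have in\<Omega>: "polar t x \<in> ?\<Omega>" if "(t, x) \<in> R" for t x
    using that by (subst polar_in_polar_rectangle) (auto simp: R_def)
  define Ut where "Ut = (\<lambda>t x. exp t * (sin x * ?d 1 (polar t x) + cos x * ?d 2 (polar t x)))"
  define Ux where "Ux = (\<lambda>t x. exp t * (cos x * ?d 1 (polar t x) - sin x * ?d 2 (polar t x)))"
  define Utt where "Utt = (\<lambda>t x. Ut t x + exp t * (sin x * (exp t * (sin x * ?dd 1 1 (polar t x) + cos x * ?dd 1 2 (polar t x)))
      + cos x * (exp t * (sin x * ?dd 2 1 (polar t x) + cos x * ?dd 2 2 (polar t x)))))"
  define Uxx where "Uxx = (\<lambda>t x. - Ut t x + exp t * (cos x * (exp t * (cos x * ?dd 1 1 (polar t x) - sin x * ?dd 1 2 (polar t x)))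
      - sin x * (exp t * (cos x * ?dd 2 1 (polar t x) - sin x * ?dd 2 2 (polar t x)))))"
  have pc: "continuous_on R (\<lambda>z. f (polar (fst z) (snd z)))" if "continuous_on ?\<Omega> f" for f :: "real ^ 2 \<Rightarrow> real"
    by (rule continuous_on_compose2[OF that]) (use in\<Omega> in \<open>auto intro!: continuous_intros\<close>)
  have cs: "continuous_on ?\<Omega> (?d i)" "continuous_on ?\<Omega> (?dd 1 i)" "continuous_on ?\<Omega> (?dd 2 i)" for i
    using C by (auto simp: C1_on_def)
  \<comment> \<open>The first-order contribution \<open>y\<close> cancels, and so do the mixed
    derivatives \<open>d12\<close> and \<open>d21\<close>, each against itself.\<close>
  have alg: "(y + e * (s * (e * (s * d11 + c * d12)) + c * (e * (s * d21 + c * d22)))) +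
      (- y + e * (c * (e * (c * d11 - s * d12)) - s * (e * (c * d21 - s * d22)))) =
      e * e * (s\<^sup>2 + c\<^sup>2) * (d11 + d22)" for y e s c d11 d12 d21 d22 :: real
    by (simp add: algebra_simps power2_eq_square)
  show ?thesis
  proof
    fix t x assume tx: "(t, x) \<in> R"
    note g = C1_on_has_gradient[OF C(1) in\<Omega>[OF tx]] C1_on_has_gradient[OF C(2) in\<Omega>[OF tx]]
      C1_on_has_gradient[OF C(3) in\<Omega>[OF tx]]
    show "((\<lambda>t. U t x) has_real_derivative Ut t x) (at t)"
      unfolding U_def Ut_def by (rule has_gradient_polar[OF g(1)])
    show "((\<lambda>x. U t x) has_real_derivative Ux t x) (at x)"
      unfolding U_def Ux_def by (rule has_gradient_polar[OF g(1)])
    show "((\<lambda>t. Ut t x) has_real_derivative Utt t x) (at t)"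
      unfolding Ut_def Utt_def
      by (rule derivative_eq_intros has_gradient_polar(1)[OF g(2)] has_gradient_polar(1)[OF g(3)] refl)+ simp
    show "((\<lambda>x. Ux t x) has_real_derivative Uxx t x) (at x)"
      unfolding Ux_def Uxx_def Ut_def
      by (rule derivative_eq_intros has_gradient_polar(2)[OF g(2)] has_gradient_polar(2)[OF g(3)] refl)+
        (simp add: algebra_simps)
    have xs: "x \<in> strip" using tx by (auto simp: R_def)
    have c: "cos x > 0" using cos_strip(1)[OF xs] .
    have "Utt t x + Uxx t x = exp t * exp t * ((sin x)\<^sup>2 + (cos x)\<^sup>2) * (?dd 1 1 (polar t x) + ?dd 2 2 (polar t x))"
      unfolding Utt_def Uxx_def by (rule alg)
    then have "(cos x)\<^sup>2 * (Utt t x + Uxx t x) = (polar t x $ 2)\<^sup>2 * (?dd 1 1 (polar t x) + ?dd 2 2 (polar t x))"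
      by (simp add: power_mult_distrib power2_eq_square[of "exp t"])
    also have "\<dots> = - \<mu> * U t x"
      using laplace_beltrami_hyperbolic[of "polar t x" "apply_bcontfun u"] lap[OF in\<Omega>[OF tx]] c
      by (simp add: U_def)
    finally show "Utt t x + Uxx t x = - (\<mu> / (cos x)\<^sup>2) * U t x"
      using c by (simp add: field_simps)
  next
    show "continuous_on R (\<lambda>(t, x). Ux t x)"
      unfolding Ux_def case_prod_beta by (intro continuous_intros pc cs)
    show "continuous_on R (\<lambda>(t, x). Uxx t x)"
      unfolding Uxx_def Ut_def case_prod_beta by (intro continuous_intros pc cs)
  qed
qed

section \<open>Separated eigenfunctions\<close>

lemma norm_squared_has_gradient:
  "has_gradient (\<lambda>p. (p $ 1)\<^sup>2 + (p $ 2)\<^sup>2) (2 * p $ 1) (2 * p $ 2) p"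
  using has_gradient_add[OF has_gradient_mult[OF has_gradient_nth(1) has_gradient_nth(1)]
      has_gradient_mult[OF has_gradient_nth(2) has_gradient_nth(2)], of p]
  by (simp add: power2_eq_square)

lemma log_radius_has_gradient:
  assumes "p $ 2 > 0"
  shows "has_gradient log_radius (p $ 1 / ((p $ 1)\<^sup>2 + (p $ 2)\<^sup>2)) (p $ 2 / ((p $ 1)\<^sup>2 + (p $ 2)\<^sup>2)) p"
proof -
  have r: "(p $ 1)\<^sup>2 + (p $ 2)\<^sup>2 > 0" using assms by (simp add: add_nonneg_pos)
  have s: "((\<lambda>s. ln s / 2) has_real_derivative 1 / (2 * s)) (at s)" if "s > 0" for s :: real
    using that by (auto intro!: derivative_eq_intros)
  have e: "1 / (2 * s) * (2 * y) = y / s" for s y :: real by simp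
  show ?thesis
    unfolding log_radius_def[abs_def]
    by (rule has_gradient_eq[OF has_gradient_compose[OF s[OF r] norm_squared_has_gradient] e e])
qed

lemma angle_has_gradient:
  assumes "p $ 2 > 0"
  shows "has_gradient angle (p $ 2 / ((p $ 1)\<^sup>2 + (p $ 2)\<^sup>2)) (- (p $ 1 / ((p $ 1)\<^sup>2 + (p $ 2)\<^sup>2))) p"
proof -
  have r: "(p $ 1)\<^sup>2 + (p $ 2)\<^sup>2 > 0" using assms by (simp add: add_nonneg_pos)
  have "has_gradient (\<lambda>p. p $ 1 / p $ 2) (1 / p $ 2) (- (p $ 1 / (p $ 2)\<^sup>2)) p"
    unfolding has_gradient_def using assms
    by (auto intro!: derivative_eq_intros has_derivative_nth[THEN has_derivative_eq_rhs]
        simp: field_simps power2_eq_square)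
  from has_gradient_compose[OF DERIV_arctan this]
  have "has_gradient angle (inverse (1 + (p $ 1 / p $ 2)\<^sup>2) * (1 / p $ 2))
      (inverse (1 + (p $ 1 / p $ 2)\<^sup>2) * - (p $ 1 / (p $ 2)\<^sup>2)) p"
    by (simp add: angle_def[abs_def])
  moreover have "inverse (1 + (p $ 1 / p $ 2)\<^sup>2) = (p $ 2)\<^sup>2 / ((p $ 1)\<^sup>2 + (p $ 2)\<^sup>2)"
    using assms r by (simp add: field_simps)
  ultimately show ?thesis using assms by (simp add: power2_eq_square)
qed

text \<open>\<open>(a, b)\<close> is the gradient of \<open>log_radius\<close> and
  \<open>(b, - a)\<close> that of \<open>angle\<close>, so these are the second derivatives of both
  coordinates.\<close>

lemma polar_coefficients_has_gradient:
  assumes "p $ 2 > 0"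
  defines "r \<equiv> \<lambda>p :: real ^ 2. (p $ 1)\<^sup>2 + (p $ 2)\<^sup>2"
  defines "a \<equiv> \<lambda>p. p $ 1 / r p" and "b \<equiv> \<lambda>p. p $ 2 / r p"
  shows "has_gradient a (1 / r p - 2 * (a p)\<^sup>2) (- 2 * a p * b p) p"
    and "has_gradient b (- 2 * a p * b p) (1 / r p - 2 * (b p)\<^sup>2) p"
proof -
  have r: "r p > 0" using assms by (simp add: r_def add_nonneg_pos)
  have "has_gradient r (2 * p $ 1) (2 * p $ 2) p"
    unfolding r_def by (rule norm_squared_has_gradient)
  moreover have "(inverse has_real_derivative - (1 / (r p)\<^sup>2)) (at (r p))"
    by (rule DERIV_cong[OF DERIV_inverse]) (use r in \<open>simp_all add: power2_eq_square divide_inverse\<close>)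
  ultimately have i: "has_gradient (\<lambda>p. inverse (r p)) (- (1 / (r p)\<^sup>2) * (2 * p $ 1)) (- (1 / (r p)\<^sup>2) * (2 * p $ 2)) p"
    by (rule has_gradient_compose[rotated])
  show "has_gradient a (1 / r p - 2 * (a p)\<^sup>2) (- 2 * a p * b p) p"
    using has_gradient_mult[OF has_gradient_nth(1) i]
    by (simp add: a_def b_def divide_inverse power_mult_distrib algebra_simps power2_eq_square)
  show "has_gradient b (- 2 * a p * b p) (1 / r p - 2 * (b p)\<^sup>2) p"
    using has_gradient_mult[OF has_gradient_nth(2) i]
    by (simp add: a_def b_def divide_inverse power_mult_distrib algebra_simps power2_eq_square)
qed

text \<open>\<open>log_radius\<close> and \<open>angle\<close> are harmonic, with orthogonal
  gradients of equal squared length \<open>1 / r p\<close>. In the Laplacian of the product the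
  terms in \<open>A\<close>, \<open>B\<close> and \<open>W\<close> therefore cancel, and
  \<open>(F p + H p) / r p\<close> is left.\<close>

lemma separated_C2_laplace:
  assumes f: "\<And>t. (f has_real_derivative f' t) (at t)" "\<And>t. (f' has_real_derivative - (\<kappa>\<^sup>2 * f t)) (at t)"
    and h: "solves (potential \<mu> (\<kappa>\<^sup>2)) h h' strip"
  defines "w \<equiv> \<lambda>p. f (log_radius p) * h (angle p)"
  shows "C2_on (polar_rectangle L) w"
    and "p \<in> polar_rectangle L \<Longrightarrow> laplace_beltrami hyperbolic_metric w p = - \<mu> * w p"
proof -
  let ?\<Omega> = "polar_rectangle L"
  define r where "r = (\<lambda>p :: real ^ 2. (p $ 1)\<^sup>2 + (p $ 2)\<^sup>2)"
  define a where "a = (\<lambda>p. p $ 1 / r p)"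
  define b where "b = (\<lambda>p. p $ 2 / r p)"
  define q where "q = potential \<mu> (\<kappa>\<^sup>2)"
  \<comment> \<open>Products of derivatives of the factors: \<open>A\<close> and \<open>B\<close>
    carry one derivative, on \<open>f\<close> and on \<open>h\<close>; \<open>F\<close>,
    \<open>W\<close> and \<open>H\<close> carry two, with the differential equations already
    substituted in \<open>F\<close> and \<open>H\<close>.\<close>
  define W where "W = (\<lambda>p. f' (log_radius p) * h' (angle p))"
  define A where "A = (\<lambda>p. f' (log_radius p) * h (angle p))"
  define B where "B = (\<lambda>p. f (log_radius p) * h' (angle p))"
  define F where "F = (\<lambda>p. - (\<kappa>\<^sup>2 * w p))"
  define H where "H = (\<lambda>p. - (q (angle p) * w p))"
  have pos: "p $ 2 > 0" "angle p \<in> strip" if "p \<in> ?\<Omega>" for p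
  proof -
    show "p $ 2 > 0" using that by (auto simp: polar_rectangle_def)
    then show "angle p \<in> strip" using that by (intro angle_in_strip) (auto simp: polar_rectangle_def)
  qed
  have T: "has_gradient log_radius (a p) (b p) p" and X: "has_gradient angle (b p) (- a p) p"
    and ag: "has_gradient a (1 / r p - 2 * (a p)\<^sup>2) (- 2 * a p * b p) p"
    and bg: "has_gradient b (- 2 * a p * b p) (1 / r p - 2 * (b p)\<^sup>2) p" if "p \<in> ?\<Omega>" for p
    using log_radius_has_gradient[OF pos(1)[OF that]] angle_has_gradient[OF pos(1)[OF that]]
      polar_coefficients_has_gradient[OF pos(1)[OF that]]
    by (simp_all add: a_def[abs_def] b_def[abs_def] r_def)
  have fT: "has_gradient (\<lambda>p. f (log_radius p)) (f' (log_radius p) * a p) (f' (log_radius p) * b p) p"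
    "has_gradient (\<lambda>p. f' (log_radius p)) (- (\<kappa>\<^sup>2 * f (log_radius p)) * a p) (- (\<kappa>\<^sup>2 * f (log_radius p)) * b p) p"
    if "p \<in> ?\<Omega>" for p
    using has_gradient_compose[OF f(1) T[OF that]] has_gradient_compose[OF f(2) T[OF that]] by simp_all
  have hX: "has_gradient (\<lambda>p. h (angle p)) (h' (angle p) * b p) (h' (angle p) * - a p) p"
    "has_gradient (\<lambda>p. h' (angle p)) (- (q (angle p) * h (angle p)) * b p) (- (q (angle p) * h (angle p)) * - a p) p"
    if "p \<in> ?\<Omega>" for p
    using has_gradient_compose[OF solvesD(1)[OF h pos(2)[OF that]] X[OF that]]
      has_gradient_compose[OF solvesD(2)[OF h pos(2)[OF that]] X[OF that]] by (simp_all add: q_def)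
  have wg: "has_gradient w (A p * a p + B p * b p) (A p * b p - B p * a p) p" if "p \<in> ?\<Omega>" for p
    by (rule has_gradient_eq[OF has_gradient_mult[OF fT(1)[OF that] hX(1)[OF that], folded w_def]])
      (simp_all add: A_def B_def algebra_simps)
  have Ag: "has_gradient A (F p * a p + W p * b p) (F p * b p - W p * a p) p" if "p \<in> ?\<Omega>" for p
    by (rule has_gradient_eq[OF has_gradient_mult[OF fT(2)[OF that] hX(1)[OF that], folded A_def]])
      (simp_all add: F_def w_def W_def algebra_simps)
  have Bg: "has_gradient B (W p * a p + H p * b p) (W p * b p - H p * a p) p" if "p \<in> ?\<Omega>" for p
    by (rule has_gradient_eq[OF has_gradient_mult[OF fT(1)[OF that] hX(2)[OF that], folded B_def]])
      (simp_all add: H_def w_def W_def algebra_simps)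
  define D1 where "D1 = (\<lambda>p. A p * a p + B p * b p)"
  define D2 where "D2 = (\<lambda>p. A p * b p - B p * a p)"
  define D11 where "D11 = (\<lambda>p. ((F p * a p + W p * b p) * a p + A p * (1 / r p - 2 * (a p)\<^sup>2))
    + ((W p * a p + H p * b p) * b p + B p * (- 2 * a p * b p)))"
  define D12 where "D12 = (\<lambda>p. ((F p * b p - W p * a p) * a p + A p * (- 2 * a p * b p))
    + ((W p * b p - H p * a p) * b p + B p * (1 / r p - 2 * (b p)\<^sup>2)))"
  define D21 where "D21 = (\<lambda>p. ((F p * a p + W p * b p) * b p + A p * (- 2 * a p * b p))
    - ((W p * a p + H p * b p) * a p + B p * (1 / r p - 2 * (a p)\<^sup>2)))"
  define D22 where "D22 = (\<lambda>p. ((F p * b p - W p * a p) * b p + A p * (1 / r p - 2 * (b p)\<^sup>2))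
    - ((W p * b p - H p * a p) * a p + B p * (- 2 * a p * b p)))"
  have D1g: "has_gradient D1 (D11 p) (D12 p) p" if "p \<in> ?\<Omega>" for p
    unfolding D1_def D11_def D12_def
    by (intro has_gradient_add has_gradient_mult Ag Bg ag bg that)
  have D2g: "has_gradient D2 (D21 p) (D22 p) p" if "p \<in> ?\<Omega>" for p
    unfolding D2_def D21_def D22_def
    by (intro has_gradient_diff has_gradient_mult Ag Bg ag bg that)
  have gc: "continuous_on ?\<Omega> v" if "\<And>p. p \<in> ?\<Omega> \<Longrightarrow> \<exists>c d. has_gradient v c d p" for v
    using that unfolding has_gradient_def
    by (meson has_derivative_continuous continuous_at_imp_continuous_on)
  have cT: "continuous_on ?\<Omega> log_radius" and cX: "continuous_on ?\<Omega> angle"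
    and ca: "continuous_on ?\<Omega> a" and cb: "continuous_on ?\<Omega> b" and cw: "continuous_on ?\<Omega> w"
    and cA: "continuous_on ?\<Omega> A" and cB: "continuous_on ?\<Omega> B"
    by (rule gc, use T X ag bg wg Ag Bg in blast)+
  have cf': "continuous_on UNIV f'" using f(2) by (meson DERIV_isCont continuous_at_imp_continuous_on)
  have cW: "continuous_on ?\<Omega> W"
    unfolding W_def
    by (intro continuous_on_mult continuous_on_compose2[OF cf' cT]
        continuous_on_compose2[OF solves_continuous_on(2)[OF h] cX]) (use pos in auto)
  have cq: "continuous_on ?\<Omega> (\<lambda>p. q (angle p))"
    unfolding q_def by (rule continuous_on_compose2[OF continuous_on_potential cX]) (use pos in auto)
  have cr: "continuous_on ?\<Omega> (\<lambda>p. 1 / r p)"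
    unfolding r_def using pos(1)
    by (intro continuous_intros) (metis add_nonneg_pos less_irrefl zero_le_power2 zero_less_power)
  note cs = ca cb cw cA cB cW cq cr
  have D1c: "continuous_on ?\<Omega> D1" "continuous_on ?\<Omega> D2"
    unfolding D1_def D2_def by (intro continuous_intros cs)+
  have D2c: "continuous_on ?\<Omega> D11" "continuous_on ?\<Omega> D12" "continuous_on ?\<Omega> D21" "continuous_on ?\<Omega> D22"
    unfolding D11_def D12_def D21_def D22_def F_def H_def
    by (intro continuous_on_add continuous_on_diff continuous_on_mult continuous_on_minus
        continuous_on_power continuous_on_const cs)+
  have wg': "has_gradient w (D1 p) (D2 p) p" if "p \<in> ?\<Omega>" for p
    using wg[OF that] by (simp add: D1_def D2_def)
  have pd: "partial_deriv 1 w p = D1 p" "partial_deriv 2 w p = D2 p" if "p \<in> ?\<Omega>" for p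
    using has_gradient_partial_deriv[OF wg'[OF that]] by auto
  have "C1_on ?\<Omega> (partial_deriv 1 w)"
    by (rule C1_on_cong[OF C1_onI[OF D1g D2c(1,2)] open_polar_rectangle]) (simp_all add: pd)
  moreover have "C1_on ?\<Omega> (partial_deriv 2 w)"
    by (rule C1_on_cong[OF C1_onI[OF D2g D2c(3,4)] open_polar_rectangle]) (simp_all add: pd)
  ultimately show "C2_on ?\<Omega> w"
    unfolding C2_on_def forall_2 using C1_onI[OF wg' D1c] by blast
  show "laplace_beltrami hyperbolic_metric w p = - \<mu> * w p" if p: "p \<in> ?\<Omega>"
  proof -
    have r0: "r p > 0" using pos(1)[OF p] by (simp add: r_def add_nonneg_pos)
    have ab: "(a p)\<^sup>2 + (b p)\<^sup>2 = 1 / r p"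
    proof -
      have "(a p)\<^sup>2 + (b p)\<^sup>2 = r p / (r p)\<^sup>2"
        by (simp add: a_def b_def r_def power_divide add_divide_distrib)
      then show ?thesis using r0 by (simp add: power2_eq_square)
    qed
    have "D11 p + D22 p = (F p + H p) * ((a p)\<^sup>2 + (b p)\<^sup>2) + 2 * A p * (1 / r p - ((a p)\<^sup>2 + (b p)\<^sup>2))"
      unfolding D11_def D22_def by (simp add: algebra_simps power2_eq_square)
    then have lap: "D11 p + D22 p = (F p + H p) / r p" by (simp add: ab)
    have cos: "(cos (angle p))\<^sup>2 = (p $ 2)\<^sup>2 / r p"
    proof -
      have "(cos (angle p))\<^sup>2 = 1 / (1 + (p $ 1 / p $ 2)\<^sup>2)"
        by (simp add: angle_def cos_arctan power_divide add_nonneg_nonneg)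
      then show ?thesis using pos(1)[OF p] r0 by (simp add: r_def field_simps)
    qed
    have FH: "F p + H p = - (\<mu> / (cos (angle p))\<^sup>2) * w p"
      by (simp add: F_def H_def q_def potential_def algebra_simps)
    have "partial_deriv i (partial_deriv j w) p = partial_deriv i (if j = 1 then D1 else D2) p" for i j
      by (rule partial_deriv_cong[OF open_polar_rectangle p]) (use pd exhaust_2[of j] in auto)
    then have "laplace_beltrami hyperbolic_metric w p = (p $ 2)\<^sup>2 * (D11 p + D22 p)"
      using laplace_beltrami_hyperbolic[OF pos(1)[OF p], of w]
        has_gradient_partial_deriv[OF D1g[OF p]] has_gradient_partial_deriv[OF D2g[OF p]] by simp
    also have "\<dots> = (cos (angle p))\<^sup>2 * (F p + H p)" unfolding lap cos by simp
    also have "\<dots> = - \<mu> * w p" unfolding FH using cos_strip(1)[OF pos(2)[OF p]] by simp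
    finally show ?thesis .
  qed
qed

text \<open>The zero ends of \<open>h\<close> and \<open>sin (\<kappa> * L) = 0\<close> make the
  product vanish on the boundary, so cutting it off outside leaves a bounded continuous function.
  The value formula includes the closed edges because integrals over \<open>{0..L}\<close> use
  it.\<close>

lemma separated_eigenfunction:
  assumes h: "solves (potential \<mu> (\<kappa>\<^sup>2)) h h' strip" "h (- half_width) = 0" "h half_width = 0"
    and k: "sin (\<kappa> * L) = 0"
  obtains u where "u \<in> dirichlet_eigenspace hyperbolic_metric (polar_rectangle L) \<mu>"
    "\<And>t x. t \<in> {0..L} \<Longrightarrow> x \<in> strip \<Longrightarrow> apply_bcontfun u (polar t x) = sin (\<kappa> * t) * h x"
proof -
  let ?\<Omega> = "polar_rectangle L" and ?C = "closed_rectangle L"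
  define w where "w = (\<lambda>p. sin (\<kappa> * log_radius p) * h (angle p))"
  define v where "v = (\<lambda>p. if p \<in> ?\<Omega> then w p else 0)"
  have C: "p $ 2 > 0" "angle p \<in> strip" "(p $ 1)\<^sup>2 + (p $ 2)\<^sup>2 \<noteq> 0" if "p \<in> ?C" for p
  proof -
    show "p $ 2 > 0" using closed_rectangle_pos[OF that] .
    then show "angle p \<in> strip" using that by (intro angle_in_strip) (auto simp: closed_rectangle_def)
    show "(p $ 1)\<^sup>2 + (p $ 2)\<^sup>2 \<noteq> 0" using that by (auto simp: closed_rectangle_def)
  qed
  have wz: "w p = 0" if p: "p \<in> ?C" "p \<notin> ?\<Omega>" for p
  proof -
    define t where "t = log_radius p"
    define x where "x = angle p"
    have x: "x \<in> strip" using C(2)[OF p(1)] by (simp add: x_def)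
    have pp: "polar t x = p" using polar_log_radius_angle[OF C(1)[OF p(1)]] by (simp add: t_def x_def)
    have "0 \<le> t" "t \<le> L" using p(1) polar_norm[of t x] by (auto simp: closed_rectangle_def pp)
    moreover have "\<not> (0 < t \<and> t < L \<and> x \<in> inner_strip)"
      using p(2) polar_in_polar_rectangle[OF x, of t L] by (simp add: pp)
    ultimately have "t = 0 \<or> t = L \<or> x = half_width \<or> x = - half_width" using x by auto
    then show ?thesis using h(2,3) k by (auto simp: w_def t_def[symmetric] x_def[symmetric])
  qed
  have v: "v p = w p" if "p \<in> ?C" for p using wz[OF that] by (simp add: v_def)
  have wc: "continuous_on ?C w"
    unfolding w_def
  proof (intro continuous_on_mult continuous_on_compose2[OF solves_continuous_on(1)[OF h(1)]])
    show "continuous_on ?C (\<lambda>p. sin (\<kappa> * log_radius p))"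
      unfolding log_radius_def using C(3) by (intro continuous_intros) auto
    show "continuous_on ?C angle"
      unfolding angle_def using C(1) by (intro continuous_intros) force
  qed (use C(2) in auto)
  \<comment> \<open>Gluing along two closed sets that cover the plane: on the closed rectangle
    \<open>v\<close> is \<open>w\<close>, on the complement of the open one it is zero.\<close>
  have "continuous_on (?C \<union> - ?\<Omega>) v"
  proof (rule continuous_on_closed_Un[OF closed_closed_rectangle])
    show "closed (- ?\<Omega>)" using open_polar_rectangle by (simp add: closed_Compl)
    show "continuous_on ?C v" using wc v by (simp cong: continuous_on_cong)
    show "continuous_on (- ?\<Omega>) v" by (rule continuous_on_eq[where f = "\<lambda>_. 0"]) (auto simp: v_def)
  qed
  moreover have "?C \<union> - ?\<Omega> = UNIV" using polar_rectangle_subset_closed by blast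
  ultimately have vc: "continuous_on UNIV v" by simp
  have "compact ?C"
    using closed_closed_rectangle bounded_closed_rectangle by (simp add: compact_eq_bounded_closed)
  then have "bounded (w ` ?C)" using wc by (intro compact_imp_bounded compact_continuous_image)
  then have "bounded (insert 0 (w ` ?C))" by simp
  then have "bounded (range v)"
    by (rule bounded_subset) (use polar_rectangle_subset_closed in \<open>auto simp: v_def\<close>)
  then have "v \<in> bcontfun" using vc by (simp add: bcontfun_def)
  then obtain u where u: "apply_bcontfun u = v" by (metis Bcontfun_inverse)
  have sin': "((\<lambda>t. sin (\<kappa> * t)) has_real_derivative \<kappa> * cos (\<kappa> * t)) (at t)"
    "((\<lambda>t. \<kappa> * cos (\<kappa> * t)) has_real_derivative - (\<kappa>\<^sup>2 * sin (\<kappa> * t))) (at t)" for t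
    by (auto intro!: derivative_eq_intros simp: power2_eq_square)
  note sep = separated_C2_laplace[OF sin' h(1), folded w_def]
  have vw: "w p = v p" if "p \<in> ?\<Omega>" for p using that by (simp add: v_def)
  have C1w: "C1_on ?\<Omega> w" "\<And>i. C1_on ?\<Omega> (partial_deriv i w)"
    using sep(1) by (auto simp: C2_on_def)
  have pdv: "partial_deriv i w p = partial_deriv i v p" if "p \<in> ?\<Omega>" for i p
    using partial_deriv_cong[OF open_polar_rectangle that vw] .
  have "C2_on ?\<Omega> v"
    unfolding C2_on_def
    using C1_on_cong[OF C1w(1) open_polar_rectangle vw] C1_on_cong[OF C1w(2) open_polar_rectangle pdv]
    by blast
  moreover have "laplace_beltrami hyperbolic_metric v p = - \<mu> * v p" if p: "p \<in> ?\<Omega>" for p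
  proof -
    have p2: "p $ 2 > 0" using p by (auto simp: polar_rectangle_def)
    have "partial_deriv i (partial_deriv j w) p = partial_deriv i (partial_deriv j v) p" for i j
      by (rule partial_deriv_cong[OF open_polar_rectangle p pdv])
    moreover have "sin (\<kappa> * log_radius p) * h (angle p) = v p" using vw[OF p] by (simp add: w_def)
    ultimately show ?thesis
      using sep(2)[OF p] by (simp add: laplace_beltrami_hyperbolic[OF p2])
  qed
  ultimately have "u \<in> dirichlet_eigenspace hyperbolic_metric ?\<Omega> \<mu>"
    by (simp add: dirichlet_eigenspace_def u) (simp add: v_def)
  moreover have "apply_bcontfun u (polar t x) = sin (\<kappa> * t) * h x" if t: "t \<in> {0..L}" and x: "x \<in> strip" for t x
  proof -
    have "sin (\<kappa> * t) * h x = 0" if "polar t x \<notin> ?\<Omega>"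
    proof -
      have "t = 0 \<or> t = L \<or> x = half_width \<or> x = - half_width"
        using that t x polar_in_polar_rectangle[OF x, of t L] by auto
      then show ?thesis using h(2,3) k by auto
    qed
    then show ?thesis by (simp add: u v_def w_def log_radius_polar angle_polar[OF x])
  qed
  ultimately show ?thesis using that by blast
qed

section \<open>Projection of eigenfunctions to the sine modes\<close>

lemma mean_value_open:
  fixes f :: "real \<Rightarrow> real"
  assumes "a < b" "continuous_on {a..b} f"
    and "\<And>x. x \<in> {a<..<b} \<Longrightarrow> (f has_real_derivative f' x) (at x)"
  obtains z where "a < z" "z < b" "f b - f a = (b - a) * f' z"
  using mvt[of a b f "\<lambda>x. (*) (f' x)"] assms
  by (auto simp: has_field_derivative_def mult.commute)

text \<open>Rolle's theorem gives a zero of \<open>d'\<close>; the mean value theorem for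
  \<open>d'\<close> and then for \<open>d\<close> costs one factor \<open>b - a\<close>
  each.\<close>

lemma small_second_derivative:
  fixes d :: "real \<Rightarrow> real"
  assumes ab: "a < b" and c: "continuous_on {a..b} d" and z: "d a = 0" "d b = 0"
    and d': "\<And>x. x \<in> {a<..<b} \<Longrightarrow> (d has_real_derivative d' x) (at x)"
    and d'': "\<And>x. x \<in> {a<..<b} \<Longrightarrow> (d' has_real_derivative d'' x) (at x)"
    and e: "\<And>x. x \<in> {a<..<b} \<Longrightarrow> \<bar>d'' x\<bar> \<le> e" and x: "x \<in> {a..b}"
  shows "\<bar>d x\<bar> \<le> e * (b - a)\<^sup>2"
proof -
  have mid: "(a + b) / 2 \<in> {a<..<b}" using ab by auto
  have e0: "e \<ge> 0" using e[OF mid] by (rule order_trans[rotated]) simp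
  obtain y where y: "a < y" "y < b" "d' y = 0"
    using mean_value_open[OF ab c d'] z ab by auto
  have d'le: "\<bar>d' w\<bar> \<le> e * (b - a)" if w: "w \<in> {a<..<b}" for w
  proof -
    have "norm (d' w - d' y) \<le> e * norm (w - y)"
      by (rule field_differentiable_bound[of "{a<..<b}" d' d''])
        (use d'' e w y in \<open>auto intro: has_field_derivative_at_within\<close>)
    also have "\<dots> \<le> e * (b - a)" using w y e0 by (intro mult_left_mono) auto
    finally show ?thesis using y by simp
  qed
  show ?thesis
  proof (cases "a < x")
    case True
    have "continuous_on {a..x} d" by (rule continuous_on_subset[OF c]) (use x in auto)
    moreover have "(d has_real_derivative d' v) (at v)" if "v \<in> {a<..<x}" for v
      using d'[of v] that x by auto
    ultimately obtain w where w: "a < w" "w < x" "d x - d a = (x - a) * d' w"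
      by (rule mean_value_open[OF True])
    have "\<bar>d x\<bar> = (x - a) * \<bar>d' w\<bar>" using w z True by (simp add: abs_mult)
    also have "\<dots> \<le> (b - a) * (e * (b - a))"
      using d'le[of w] w x e0 ab by (intro mult_mono) auto
    finally show ?thesis by (simp add: power2_eq_square mult_ac)
  next
    case False
    then have "x = a" using x by auto
    then show ?thesis using z e0 by simp
  qed
qed

text \<open>The derivatives of \<open>U\<close> need not extend to the boundary, so the integration by parts in \<open>t\<close>
  is carried out for \<open>U\<close> shrunk towards the middle of \<open>{0..L}\<close>; in the limit only the values
  of \<open>U\<close> itself enter.\<close>

lemma shrunk_sine_projection:
  fixes U :: "real \<Rightarrow> real \<Rightarrow> real" and \<eta> :: real
  assumes L: "L > 0" and k: "sin (\<kappa> * L) = 0"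
    and Uc: "continuous_on ({0..L} \<times> strip) (\<lambda>(t, x). U t x)"
    and d: "\<And>t x. (t, x) \<in> R \<Longrightarrow> ((\<lambda>t. U t x) has_real_derivative Ut t x) (at t)"
      "\<And>t x. (t, x) \<in> R \<Longrightarrow> ((\<lambda>t. Ut t x) has_real_derivative Utt t x) (at t)"
      "\<And>t x. (t, x) \<in> R \<Longrightarrow> ((\<lambda>x. U t x) has_real_derivative Ux t x) (at x)"
      "\<And>t x. (t, x) \<in> R \<Longrightarrow> ((\<lambda>x. Ux t x) has_real_derivative Uxx t x) (at x)"
    and c: "continuous_on R (\<lambda>(t, x). Ux t x)" "continuous_on R (\<lambda>(t, x). Uxx t x)"
    and pde: "\<And>t x. (t, x) \<in> R \<Longrightarrow> Utt t x + Uxx t x = - (\<mu> / (cos x)\<^sup>2) * U t x"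
    and R: "R = {0<..<L} \<times> inner_strip"
    and eta: "0 < \<eta>" "\<eta> < 1"
  defines "\<sigma> \<equiv> \<lambda>r. L / 2 + (1 - \<eta>) * (r - L / 2)"
  defines "A \<equiv> \<lambda>x. integral {0..L} (\<lambda>r. U (\<sigma> r) x * sin (\<kappa> * r))"
  obtains A' where "continuous_on strip A"
    "\<And>x. x \<in> inner_strip \<Longrightarrow> (A has_real_derivative A' x) (at x)"
    "\<And>x. x \<in> inner_strip \<Longrightarrow> (A' has_real_derivative
       - (\<mu> / (cos x)\<^sup>2 * A x) + (\<kappa>\<^sup>2 * A x + \<kappa> * (cos (\<kappa> * L) * U (\<sigma> L) x - U (\<sigma> 0) x)) / (1 - \<eta>)\<^sup>2) (at x)"
proof -
  let ?J = "inner_strip"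
  \<comment> \<open>Shrinking sends the closed interval into the open one, so along
    \<open>\<sigma>\<close> the functions \<open>Ux\<close> and \<open>Uxx\<close> are continuous up
    to \<open>r = 0\<close> and \<open>r = L\<close>, as differentiation under the integral
    requires.\<close>
  have \<sigma>: "\<sigma> r \<in> {0<..<L}" if "r \<in> {0..L}" for r
  proof -
    have "(1 - \<eta>) * \<bar>r - L / 2\<bar> \<le> (1 - \<eta>) * (L / 2)"
      using that eta by (intro mult_left_mono) (auto simp: abs_if field_simps)
    also have "\<dots> < L / 2" using L eta by (simp add: algebra_simps)
    finally have "\<bar>(1 - \<eta>) * (r - L / 2)\<bar> < L / 2" using eta by (simp add: abs_mult)
    then show ?thesis unfolding \<sigma>_def by (simp only: greaterThanLessThan_iff abs_less_iff) linarith
  qed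
  have \<sigma>R: "(\<sigma> r, x) \<in> R" if "r \<in> {0..L}" "x \<in> ?J" for r x
    using \<sigma>[OF that(1)] that(2) by (simp add: R)
  have \<sigma>c: "continuous_on S \<sigma>" for S unfolding \<sigma>_def by (intro continuous_intros)
  have slice: "continuous_on ({0..L} \<times> strip) (\<lambda>(r, x). U (\<sigma> r) x)"
  proof -
    have "continuous_on ({0..L} \<times> strip) (\<lambda>z. (\<lambda>(t, x). U t x) (\<sigma> (fst z), snd z))"
      by (rule continuous_on_compose2[OF Uc])
        (use \<sigma> in \<open>force simp: \<sigma>_def intro!: continuous_intros\<close>)+
    then show ?thesis by (simp add: case_prod_beta)
  qed
  have sliceR: "continuous_on ({0..L} \<times> ?J) (\<lambda>(r, x). F (\<sigma> r) x)"
    if "continuous_on R (\<lambda>(t, x). F t x)" for F :: "real \<Rightarrow> real \<Rightarrow> real"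
  proof -
    have "continuous_on ({0..L} \<times> ?J) (\<lambda>z. (\<lambda>(t, x). F t x) (\<sigma> (fst z), snd z))"
      by (rule continuous_on_compose2[OF that])
        (use \<sigma>R in \<open>force simp: \<sigma>_def intro!: continuous_intros\<close>)+
    then show ?thesis by (simp add: case_prod_beta)
  qed
  have swap: "continuous_on (T \<times> {0..L}) (\<lambda>(x, r). F r x * sin (\<kappa> * r))"
    if "continuous_on ({0..L} \<times> T) (\<lambda>(r, x). F r x)" for F :: "real \<Rightarrow> real \<Rightarrow> real" and T
  proof -
    have "continuous_on (T \<times> {0..L}) (\<lambda>z. (\<lambda>(r, x). F r x) (snd z, fst z))"
      by (rule continuous_on_compose2[OF that]) (auto intro!: continuous_intros)
    then show ?thesis unfolding case_prod_beta by (intro continuous_intros) simp_all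
  qed
  have int: "(\<lambda>r. F r x * sin (\<kappa> * r)) integrable_on {0..L}"
    if "continuous_on ({0..L} \<times> T) (\<lambda>(r, x). F r x)" "x \<in> T" for F :: "real \<Rightarrow> real \<Rightarrow> real" and T x
  proof (rule integrable_continuous_interval)
    have "continuous_on {0..L} (\<lambda>r. (\<lambda>(x, r). F r x * sin (\<kappa> * r)) (x, r))"
      by (rule continuous_on_compose2[OF swap[OF that(1)]]) (use that in \<open>auto intro!: continuous_intros\<close>)
    then show "continuous_on {0..L} (\<lambda>r. F r x * sin (\<kappa> * r))" by simp
  qed
  have sliceJ: "continuous_on ({0..L} \<times> ?J) (\<lambda>(r, x). U (\<sigma> r) x)"
    by (rule continuous_on_subset[OF slice]) auto
  have leibniz: "((\<lambda>x. integral {0..L} (\<lambda>r. F (\<sigma> r) x * sin (\<kappa> * r))) has_real_derivative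
      integral {0..L} (\<lambda>r. F' (\<sigma> r) x * sin (\<kappa> * r))) (at x)"
    if F: "\<And>t x. (t, x) \<in> R \<Longrightarrow> ((\<lambda>x. F t x) has_real_derivative F' t x) (at x)"
      and Fc: "continuous_on ({0..L} \<times> ?J) (\<lambda>(r, x). F (\<sigma> r) x)"
      and F'c: "continuous_on ({0..L} \<times> ?J) (\<lambda>(r, x). F' (\<sigma> r) x)" and x: "x \<in> ?J"
    for F F' :: "real \<Rightarrow> real \<Rightarrow> real" and x
  proof -
    have "((\<lambda>x. integral (cbox 0 L) (\<lambda>r. F (\<sigma> r) x * sin (\<kappa> * r))) has_field_derivative
      integral (cbox 0 L) (\<lambda>r. F' (\<sigma> r) x * sin (\<kappa> * r))) (at x within ?J)"
    proof (rule leibniz_rule_field_derivative)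
      show "((\<lambda>x. F (\<sigma> r) x * sin (\<kappa> * r)) has_real_derivative F' (\<sigma> r) y * sin (\<kappa> * r)) (at y within ?J)"
        if "y \<in> ?J" "r \<in> cbox 0 L" for y r
        by (rule DERIV_cmult_right[OF has_field_derivative_at_within[OF F]]) (use \<sigma>R that in simp)
    qed (use int[OF Fc] swap[OF F'c] x in simp_all)
    then show ?thesis using x by (simp add: at_within_open[OF x open_greaterThanLessThan])
  qed
  show ?thesis
  proof
    have "continuous_on strip (\<lambda>x. integral (cbox 0 L) (\<lambda>r. U (\<sigma> r) x * sin (\<kappa> * r)))"
      by (rule integral_continuous_on_param) (use swap[OF slice] in simp)
    then show "continuous_on strip A" by (simp add: A_def)
    fix x assume x: "x \<in> ?J"
    show "(A has_real_derivative integral {0..L} (\<lambda>r. Ux (\<sigma> r) x * sin (\<kappa> * r))) (at x)"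
      unfolding A_def by (rule leibniz[OF d(3) sliceJ sliceR[OF c(1)] x])
    define e where "e = 1 - \<eta>"
    have e0: "e > 0" using eta by (simp add: e_def)
    \<comment> \<open>The boundary terms of two integrations by parts; each costs a factor
      \<open>1 / e\<close> because \<open>\<sigma>\<close> has slope \<open>e\<close>. The sine
      vanishes at both ends, so no value of \<open>Ut\<close> survives in
      \<open>P L - P 0\<close>.\<close>
    define P where "P = (\<lambda>r. (1 / e) * (Ut (\<sigma> r) x * sin (\<kappa> * r)) - (1 / e\<^sup>2) * (U (\<sigma> r) x * (\<kappa> * cos (\<kappa> * r))))"
    have "((\<lambda>r. Utt (\<sigma> r) x * sin (\<kappa> * r) + \<kappa>\<^sup>2 / e\<^sup>2 * (U (\<sigma> r) x * sin (\<kappa> * r))) has_integral P L - P 0) {0..L}"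
    proof (rule has_integral_real_derivative)
      fix r assume r: "r \<in> {0..L}"
      have s: "(\<sigma> has_real_derivative e) (at r)"
        unfolding \<sigma>_def e_def by (auto intro!: derivative_eq_intros)
      note d1 = DERIV_chain2[OF d(1)[OF \<sigma>R[OF r x]] s] and d2 = DERIV_chain2[OF d(2)[OF \<sigma>R[OF r x]] s]
      have "(P has_real_derivative
          (1 / e) * (Utt (\<sigma> r) x * e * sin (\<kappa> * r) + (\<kappa> * cos (\<kappa> * r)) * Ut (\<sigma> r) x)
          - (1 / e\<^sup>2) * (Ut (\<sigma> r) x * e * (\<kappa> * cos (\<kappa> * r)) + (- (\<kappa>\<^sup>2 * sin (\<kappa> * r))) * U (\<sigma> r) x)) (at r)"
        unfolding P_def
        by (intro DERIV_diff DERIV_cmult DERIV_mult d1 d2)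
          (auto intro!: derivative_eq_intros simp: power2_eq_square)
      also have "(1 / e) * (Utt (\<sigma> r) x * e * sin (\<kappa> * r) + (\<kappa> * cos (\<kappa> * r)) * Ut (\<sigma> r) x)
          - (1 / e\<^sup>2) * (Ut (\<sigma> r) x * e * (\<kappa> * cos (\<kappa> * r)) + (- (\<kappa>\<^sup>2 * sin (\<kappa> * r))) * U (\<sigma> r) x)
          = Utt (\<sigma> r) x * sin (\<kappa> * r) + \<kappa>\<^sup>2 / e\<^sup>2 * (U (\<sigma> r) x * sin (\<kappa> * r))"
        using e0 by (simp add: field_simps power2_eq_square)
      finally show "(P has_real_derivative Utt (\<sigma> r) x * sin (\<kappa> * r) + \<kappa>\<^sup>2 / e\<^sup>2 * (U (\<sigma> r) x * sin (\<kappa> * r)))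
          (at r)" .
    qed (use L in simp)
    moreover have "((\<lambda>r. (\<kappa>\<^sup>2 / e\<^sup>2 - \<mu> / (cos x)\<^sup>2) * (U (\<sigma> r) x * sin (\<kappa> * r))) has_integral
        (\<kappa>\<^sup>2 / e\<^sup>2 - \<mu> / (cos x)\<^sup>2) * A x) {0..L}"
      unfolding A_def by (intro has_integral_mult_right integrable_integral int[OF sliceJ x])
    ultimately have "((\<lambda>r. (\<kappa>\<^sup>2 / e\<^sup>2 - \<mu> / (cos x)\<^sup>2) * (U (\<sigma> r) x * sin (\<kappa> * r)) -
          (Utt (\<sigma> r) x * sin (\<kappa> * r) + \<kappa>\<^sup>2 / e\<^sup>2 * (U (\<sigma> r) x * sin (\<kappa> * r)))) has_integral
        (\<kappa>\<^sup>2 / e\<^sup>2 - \<mu> / (cos x)\<^sup>2) * A x - (P L - P 0)) {0..L}"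
      by (intro has_integral_diff)
    also have "?this \<longleftrightarrow> ((\<lambda>r. Uxx (\<sigma> r) x * sin (\<kappa> * r)) has_integral
        (\<kappa>\<^sup>2 / e\<^sup>2 - \<mu> / (cos x)\<^sup>2) * A x - (P L - P 0)) {0..L}"
    proof (rule has_integral_cong)
      fix r assume r: "r \<in> {0..L}"
      have "Uxx (\<sigma> r) x = - (\<mu> / (cos x)\<^sup>2) * U (\<sigma> r) x - Utt (\<sigma> r) x"
        using pde[OF \<sigma>R[OF r x]] by linarith
      then show "(\<kappa>\<^sup>2 / e\<^sup>2 - \<mu> / (cos x)\<^sup>2) * (U (\<sigma> r) x * sin (\<kappa> * r)) -
          (Utt (\<sigma> r) x * sin (\<kappa> * r) + \<kappa>\<^sup>2 / e\<^sup>2 * (U (\<sigma> r) x * sin (\<kappa> * r)))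
          = Uxx (\<sigma> r) x * sin (\<kappa> * r)" by (simp only: left_diff_distrib)
    qed
    finally have "integral {0..L} (\<lambda>r. Uxx (\<sigma> r) x * sin (\<kappa> * r))
        = (\<kappa>\<^sup>2 / e\<^sup>2 - \<mu> / (cos x)\<^sup>2) * A x - (P L - P 0)" by (rule integral_unique)
    also have "\<dots> = - (\<mu> / (cos x)\<^sup>2 * A x) + (\<kappa>\<^sup>2 * A x + \<kappa> * (cos (\<kappa> * L) * U (\<sigma> L) x - U (\<sigma> 0) x)) / e\<^sup>2"
      using k by (simp add: P_def algebra_simps add_divide_distrib diff_divide_distrib)
    finally show "((\<lambda>x. integral {0..L} (\<lambda>r. Ux (\<sigma> r) x * sin (\<kappa> * r))) has_real_derivative
       - (\<mu> / (cos x)\<^sup>2 * A x) + (\<kappa>\<^sup>2 * A x + \<kappa> * (cos (\<kappa> * L) * U (\<sigma> L) x - U (\<sigma> 0) x)) / (1 - \<eta>)\<^sup>2) (at x)"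
      using leibniz[OF d(4) sliceR[OF c(1)] sliceR[OF c(2)] x] by (simp add: e_def)
  qed
qed

lemma antiderivative_twice:
  fixes G :: "real \<Rightarrow> real"
  assumes "continuous_on UNIV G" "a < b"
  obtains F F' where "\<And>x. (F has_real_derivative F' x) (at x)" "\<And>x. (F' has_real_derivative G x) (at x)"
    "F a = 0" "F b = 0"
proof -
  obtain F1 where F1: "\<And>x. (F1 has_real_derivative G x) (at x)"
    using global_antiderivative[OF assms(1)] by blast
  then have "continuous_on UNIV F1" by (meson DERIV_isCont continuous_at_imp_continuous_on)
  then obtain F2 where F2: "\<And>x. (F2 has_real_derivative F1 x) (at x)"
    using global_antiderivative by blast
  define m where "m = (F2 b - F2 a) / (b - a)"
  show ?thesis
  proof
    show "((\<lambda>x. F2 x - F2 a - m * (x - a)) has_real_derivative F1 x - m) (at x)" for x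
      by (auto intro!: derivative_eq_intros F2)
    show "((\<lambda>x. F1 x - m) has_real_derivative G x) (at x)" for x
      by (auto intro!: derivative_eq_intros F1)
    show "F2 b - F2 a - m * (b - a) = 0" using assms(2) by (simp add: m_def)
  qed simp
qed

text \<open>The coefficient \<open>A\<close> is not differentiated directly. \<open>F\<close> is the
  twofold antiderivative, with zero ends, of what the second derivative of \<open>A\<close> should
  be; the coefficients \<open>B\<close> of shrunk functions converge to \<open>A\<close> and their
  second derivatives to that of \<open>F\<close>, which forces \<open>A = F\<close>. Since
  \<open>F\<close> lives on the whole line, it also has the two-sided derivatives that
  \<open>solves\<close> demands at the ends of the strip.\<close>

lemma sine_projection_solves:
  fixes U :: "real \<Rightarrow> real \<Rightarrow> real"
  assumes L: "L > 0" and k: "sin (\<kappa> * L) = 0"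
    and Uc: "continuous_on ({0..L} \<times> strip) (\<lambda>(t, x). U t x)"
    and U0: "\<And>x. x \<in> strip \<Longrightarrow> U 0 x = 0" "\<And>x. x \<in> strip \<Longrightarrow> U L x = 0"
      "\<And>t. t \<in> {0..L} \<Longrightarrow> U t (- half_width) = 0" "\<And>t. t \<in> {0..L} \<Longrightarrow> U t half_width = 0"
    and d: "\<And>t x. (t, x) \<in> R \<Longrightarrow> ((\<lambda>t. U t x) has_real_derivative Ut t x) (at t)"
      "\<And>t x. (t, x) \<in> R \<Longrightarrow> ((\<lambda>t. Ut t x) has_real_derivative Utt t x) (at t)"
      "\<And>t x. (t, x) \<in> R \<Longrightarrow> ((\<lambda>x. U t x) has_real_derivative Ux t x) (at x)"
      "\<And>t x. (t, x) \<in> R \<Longrightarrow> ((\<lambda>x. Ux t x) has_real_derivative Uxx t x) (at x)"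
    and c: "continuous_on R (\<lambda>(t, x). Ux t x)" "continuous_on R (\<lambda>(t, x). Uxx t x)"
    and pde: "\<And>t x. (t, x) \<in> R \<Longrightarrow> Utt t x + Uxx t x = - (\<mu> / (cos x)\<^sup>2) * U t x"
    and R: "R = {0<..<L} \<times> inner_strip"
  obtains a a' where "solves (potential \<mu> (\<kappa>\<^sup>2)) a a' strip" "a (- half_width) = 0" "a half_width = 0"
    "\<And>x. x \<in> strip \<Longrightarrow> a x = integral {0..L} (\<lambda>t. U t x * sin (\<kappa> * t))"
proof -
  let ?J = "inner_strip"
  define A where "A = (\<lambda>x. integral {0..L} (\<lambda>t. U t x * sin (\<kappa> * t)))"
  define clamp where "clamp = (\<lambda>x. max (- half_width) (min half_width x))"
  have clamp: "clamp x \<in> strip" for x using half_width_pos by (auto simp: clamp_def)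
  have clamp_eq: "clamp x = x" if "x \<in> strip" for x using that by (auto simp: clamp_def)
  have slice: "continuous_on {0..L} (\<lambda>t. U t x)" if "x \<in> strip" for x
  proof -
    have "continuous_on {0..L} (\<lambda>t. (\<lambda>(t, x). U t x) (t, x))"
      by (rule continuous_on_compose2[OF Uc]) (use that in \<open>auto intro!: continuous_intros\<close>)
    then show ?thesis by simp
  qed
  have Ac: "continuous_on strip A"
  proof -
    have "continuous_on (strip \<times> {0..L}) (\<lambda>z. (\<lambda>(t, x). U t x) (snd z, fst z))"
      by (rule continuous_on_compose2[OF Uc]) (auto intro!: continuous_intros)
    then have "continuous_on (strip \<times> {0..L}) (\<lambda>(x, t). U t x * sin (\<kappa> * t))"
      unfolding case_prod_beta by (intro continuous_intros) simp_all
    then have "continuous_on strip (\<lambda>x. integral (cbox 0 L) (\<lambda>t. U t x * sin (\<kappa> * t)))"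
      by (intro integral_continuous_on_param) simp
    then show ?thesis by (simp add: A_def)
  qed
  define G where "G = (\<lambda>x. - (potential \<mu> (\<kappa>\<^sup>2) (clamp x) * A (clamp x)))"
  have "continuous_on UNIV clamp" unfolding clamp_def by (intro continuous_intros)
  then have "continuous_on UNIV G"
    unfolding G_def using clamp
    by (intro continuous_on_minus continuous_on_mult continuous_on_compose2[OF Ac]
        continuous_on_compose2[OF continuous_on_potential]) auto
  then obtain F F' where F: "\<And>x. (F has_real_derivative F' x) (at x)"
    "\<And>x. (F' has_real_derivative G x) (at x)" "F (- half_width) = 0" "F half_width = 0"
    by (rule antiderivative_twice[of G "- half_width" half_width]) (use half_width_pos in auto)
  have "compact ({0..L} \<times> strip)" by (intro compact_Times compact_Icc)
  then have "bounded ((\<lambda>(t, x). U t x) ` ({0..L} \<times> strip))"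
    using Uc by (intro compact_imp_bounded compact_continuous_image)
  then obtain M where M: "M > 0" "\<And>t x. t \<in> {0..L} \<Longrightarrow> x \<in> strip \<Longrightarrow> \<bar>U t x\<bar> \<le> M"
    unfolding bounded_pos by force
  have uc: "uniformly_continuous_on ({0..L} \<times> strip) (\<lambda>(t, x). U t x)"
    by (rule compact_uniformly_continuous[OF Uc]) (intro compact_Times compact_Icc)
  have sin1: "\<bar>y * sin z\<bar> \<le> \<bar>y\<bar>" for y z :: real
    by (simp add: abs_mult mult_left_le)
  have Ab: "\<bar>A x\<bar> \<le> M * L" if x: "x \<in> strip" for x
  proof -
    have "norm (A x) \<le> M * measure lborel (cbox 0 L)"
      unfolding A_def
    proof (rule has_integral_bound[where f = "\<lambda>t. U t x * sin (\<kappa> * t)"])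
      show "((\<lambda>t. U t x * sin (\<kappa> * t)) has_integral integral {0..L} (\<lambda>t. U t x * sin (\<kappa> * t))) (cbox 0 L)"
        using slice[OF x] by (auto intro!: integrable_integral integrable_continuous_interval continuous_intros)
      show "norm (U t x * sin (\<kappa> * t)) \<le> M" if "t \<in> cbox 0 L" for t
        using M(2)[of t x] sin1[of "U t x" "\<kappa> * t"] that x by auto
    qed (use M(1) in simp)
    then show ?thesis using L by simp
  qed
  \<comment> \<open>The summand \<open>L\<close> accounts for the distance from \<open>B\<close> to
    \<open>A\<close>, the bracket for the four parts of the error in the second derivative; only
    independence of \<open>x\<close> and \<open>\<epsilon>\<close> matters.\<close>
  define K where "K = L + (2 * \<bar>\<mu>\<bar> * L + 2 * \<kappa>\<^sup>2 * L + \<kappa>\<^sup>2 * (M * L) + 4 * \<bar>\<kappa>\<bar>) * (half_width - - half_width)\<^sup>2"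
  have close: "\<bar>A x - F x\<bar> \<le> K * \<epsilon>" if x: "x \<in> strip" and e: "\<epsilon> > 0" for x \<epsilon>
  proof -
    obtain \<delta> where \<delta>: "\<delta> > 0" "\<And>s t x. s \<in> {0..L} \<Longrightarrow> t \<in> {0..L} \<Longrightarrow> x \<in> strip \<Longrightarrow> \<bar>s - t\<bar> < \<delta> \<Longrightarrow> \<bar>U s x - U t x\<bar> < \<epsilon>"
    proof -
      obtain \<delta> where "\<delta> > 0" and \<delta>: "\<And>z w. z \<in> {0..L} \<times> strip \<Longrightarrow> w \<in> {0..L} \<times> strip \<Longrightarrow> dist w z < \<delta> \<Longrightarrow>
          dist ((\<lambda>(t, x). U t x) w) ((\<lambda>(t, x). U t x) z) < \<epsilon>"
        using uc e unfolding uniformly_continuous_on_def by metis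
      have "\<bar>U s x - U t x\<bar> < \<epsilon>" if "s \<in> {0..L}" "t \<in> {0..L}" "x \<in> strip" "\<bar>s - t\<bar> < \<delta>" for s t x
        using \<delta>[of "(t, x)" "(s, x)"] that by (auto simp: dist_Pair_Pair dist_real_def)
      then show ?thesis using that \<open>\<delta> > 0\<close> by blast
    qed
    \<comment> \<open>The three bounds keep \<open>q\<close> at most 2, make
      \<open>\<bar>q - 1\<bar> \<le> 4 * \<eta> \<le> \<epsilon>\<close>, and keep the displacement
      by \<open>\<sigma>\<close> below \<open>\<delta>\<close>.\<close>
    define \<eta> where "\<eta> = min (1 / 4) (min (\<epsilon> / 4) (\<delta> / L))"
    have "\<eta> \<le> 1 / 4" "\<eta> \<le> \<epsilon> / 4" "\<eta> \<le> \<delta> / L" unfolding \<eta>_def by linarith+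
    moreover have "0 < \<eta>" using e \<delta>(1) L by (simp add: \<eta>_def)
    ultimately have eta: "0 < \<eta>" "\<eta> < 1" "\<eta> \<le> 1 / 4" "\<eta> \<le> \<epsilon> / 4" "\<eta> * L \<le> \<delta>"
      using L by (simp_all add: pos_le_divide_eq)
    define q where "q = 1 / (1 - \<eta>)\<^sup>2"
    have q: "0 \<le> q" "q \<le> 2" "\<bar>q - 1\<bar> \<le> \<epsilon>"
    proof -
      have "(3 / 4)\<^sup>2 \<le> (1 - \<eta>)\<^sup>2" using eta by (intro power_mono) auto
      then have h: "(1 - \<eta>)\<^sup>2 \<ge> 1 / 2" by (simp add: power2_eq_square)
      show "0 \<le> q" by (simp add: q_def)
      show q2: "q \<le> 2" using h by (simp add: q_def divide_le_eq)
      have "(1 - \<eta>)\<^sup>2 \<noteq> 0" using h by linarith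
      then have "q - 1 = q * (1 - (1 - \<eta>)\<^sup>2)" by (simp add: q_def right_diff_distrib)
      also have "\<dots> = q * (\<eta> * (2 - \<eta>))" by (simp add: power2_eq_square algebra_simps)
      finally have "\<bar>q - 1\<bar> = q * (\<eta> * (2 - \<eta>))" using \<open>0 \<le> q\<close> eta by simp
      also have "\<dots> \<le> 2 * (\<eta> * 2)" using q2 \<open>0 \<le> q\<close> eta by (intro mult_mono) auto
      finally show "\<bar>q - 1\<bar> \<le> \<epsilon>" using eta by simp
    qed
    define \<sigma> where "\<sigma> = (\<lambda>r. L / 2 + (1 - \<eta>) * (r - L / 2))"
    define B where "B = (\<lambda>x. integral {0..L} (\<lambda>r. U (\<sigma> r) x * sin (\<kappa> * r)))"
    have \<sigma>1: "\<sigma> r \<in> {0..L}" "\<bar>\<sigma> r - r\<bar> < \<delta>" if r: "r \<in> {0..L}" for r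
    proof -
      have h: "\<bar>r - L / 2\<bar> \<le> L / 2" using r by (auto simp: abs_if field_simps)
      have "\<bar>\<sigma> r - r\<bar> = \<eta> * \<bar>r - L / 2\<bar>"
      proof -
        have "\<sigma> r - r = - (\<eta> * (r - L / 2))" by (simp add: \<sigma>_def field_simps)
        then show ?thesis using eta by (simp add: abs_mult)
      qed
      also have "\<dots> \<le> \<eta> * (L / 2)" using h eta by (intro mult_left_mono) auto
      also have "\<dots> < \<delta>" using eta(5) \<delta>(1) by simp
      finally show "\<bar>\<sigma> r - r\<bar> < \<delta>" .
      have "(1 - \<eta>) * \<bar>r - L / 2\<bar> \<le> 1 * (L / 2)" using h eta by (intro mult_mono) auto
      then have "\<bar>(1 - \<eta>) * (r - L / 2)\<bar> \<le> L / 2" using eta by (simp add: abs_mult)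
      then show "\<sigma> r \<in> {0..L}" unfolding \<sigma>_def by (simp only: atLeastAtMost_iff abs_le_iff) linarith
    qed
    have close\<sigma>: "\<bar>U (\<sigma> r) y - U r y\<bar> \<le> \<epsilon>" if "r \<in> {0..L}" "y \<in> strip" for r y
      using \<delta>(2)[OF \<sigma>1(1)[OF that(1)] that(1,2) \<sigma>1(2)[OF that(1)]] by simp
    have slice\<sigma>: "continuous_on {0..L} (\<lambda>r. U (\<sigma> r) y)" if "y \<in> strip" for y
      by (rule continuous_on_compose2[OF slice[OF that]])
        (use \<sigma>1(1) in \<open>auto simp: \<sigma>_def intro!: continuous_intros\<close>)
    have BA: "\<bar>B y - A y\<bar> \<le> \<epsilon> * L" if y: "y \<in> strip" for y
    proof -
      have "norm (B y - A y) \<le> \<epsilon> * measure lborel (cbox 0 L)"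
      proof (rule has_integral_bound[where f = "\<lambda>t. U (\<sigma> t) y * sin (\<kappa> * t) - U t y * sin (\<kappa> * t)"])
        show "((\<lambda>t. U (\<sigma> t) y * sin (\<kappa> * t) - U t y * sin (\<kappa> * t)) has_integral B y - A y) (cbox 0 L)"
          unfolding A_def B_def using slice[OF y] slice\<sigma>[OF y]
          by (auto intro!: has_integral_diff integrable_integral integrable_continuous_interval continuous_intros)
        show "norm (U (\<sigma> t) y * sin (\<kappa> * t) - U t y * sin (\<kappa> * t)) \<le> \<epsilon>" if "t \<in> cbox 0 L" for t
          using close\<sigma>[of t y] sin1[of "U (\<sigma> t) y - U t y" "\<kappa> * t"] that y by (simp add: left_diff_distrib)
      qed (use e in simp)
      then show ?thesis using L by simp
    qed
    obtain B' where B': "continuous_on strip B"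
      "\<And>x. x \<in> ?J \<Longrightarrow> (B has_real_derivative B' x) (at x)"
      "\<And>x. x \<in> ?J \<Longrightarrow> (B' has_real_derivative
       - (\<mu> / (cos x)\<^sup>2 * B x) + (\<kappa>\<^sup>2 * B x + \<kappa> * (cos (\<kappa> * L) * U (\<sigma> L) x - U (\<sigma> 0) x)) / (1 - \<eta>)\<^sup>2) (at x)"
      using shrunk_sine_projection[OF L k Uc d c pde R eta(1,2)] unfolding B_def \<sigma>_def by blast
    have ends: "B (- half_width) = 0" "B half_width = 0"
    proof -
      have "B y = integral {0..L} (\<lambda>_. 0)" if "\<And>t. t \<in> {0..L} \<Longrightarrow> U t y = 0" for y
        unfolding B_def by (rule integral_cong) (use that \<sigma>1(1) in simp)
      then show "B (- half_width) = 0" "B half_width = 0" using U0(3,4) by simp_all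
    qed
    have "\<bar>B x - F x\<bar> \<le> \<epsilon> * (2 * \<bar>\<mu>\<bar> * L + 2 * \<kappa>\<^sup>2 * L + \<kappa>\<^sup>2 * (M * L) + 4 * \<bar>\<kappa>\<bar>) * (half_width - - half_width)\<^sup>2"
    proof (rule small_second_derivative[of "- half_width" half_width "\<lambda>x. B x - F x" "\<lambda>x. B' x - F' x"])
      show "- half_width < half_width" using half_width_pos by simp
      show "continuous_on strip (\<lambda>x. B x - F x)"
        using F(1) by (intro continuous_on_diff B'(1)) (meson DERIV_isCont continuous_at_imp_continuous_on)
      show "B (- half_width) - F (- half_width) = 0" "B half_width - F half_width = 0" using ends F(3,4) by simp_all
      fix y assume y: "y \<in> ?J"
      then have ys: "y \<in> strip" by auto
      show "((\<lambda>x. B x - F x) has_real_derivative B' y - F' y) (at y)"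
        by (rule DERIV_diff[OF B'(2)[OF y] F(1)])
      define E where "E = - (\<mu> / (cos y)\<^sup>2 * B y) + (\<kappa>\<^sup>2 * B y + \<kappa> * (cos (\<kappa> * L) * U (\<sigma> L) y - U (\<sigma> 0) y)) / (1 - \<eta>)\<^sup>2 - G y"
      show "((\<lambda>x. B' x - F' x) has_real_derivative E) (at y)"
        unfolding E_def by (rule DERIV_diff[OF B'(3)[OF y] F(2)])
      have "G y = - ((\<mu> / (cos y)\<^sup>2 - \<kappa>\<^sup>2) * A y)" by (simp add: G_def clamp_eq[OF ys] potential_def)
      then have "E = - (\<mu> / (cos y)\<^sup>2 * B y) + q * (\<kappa>\<^sup>2 * B y + \<kappa> * (cos (\<kappa> * L) * U (\<sigma> L) y - U (\<sigma> 0) y))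
          + (\<mu> / (cos y)\<^sup>2 - \<kappa>\<^sup>2) * A y" by (simp add: E_def q_def)
      \<comment> \<open>Regrouped so that each summand contains one small quantity:
        \<open>B y - A y\<close>, \<open>q - 1\<close>, or the shrunk boundary values of
        \<open>U\<close>.\<close>
      also have "\<dots> = - (\<mu> * (1 / (cos y)\<^sup>2) * (B y - A y)) + q * \<kappa>\<^sup>2 * (B y - A y) + (q - 1) * \<kappa>\<^sup>2 * A y
          + q * \<kappa> * (cos (\<kappa> * L) * U (\<sigma> L) y - U (\<sigma> 0) y)"
        by (simp add: algebra_simps diff_divide_distrib)
      finally have E: "\<bar>E\<bar> \<le> \<bar>\<mu> * (1 / (cos y)\<^sup>2) * (B y - A y)\<bar> + \<bar>q * \<kappa>\<^sup>2 * (B y - A y)\<bar> + \<bar>(q - 1) * \<kappa>\<^sup>2 * A y\<bar>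
          + \<bar>q * \<kappa> * (cos (\<kappa> * L) * U (\<sigma> L) y - U (\<sigma> 0) y)\<bar>" by linarith
      have "\<bar>\<mu> * (1 / (cos y)\<^sup>2) * (B y - A y)\<bar> \<le> (\<bar>\<mu>\<bar> * 2) * (\<epsilon> * L)"
        unfolding abs_mult using cos_strip(3,4)[OF ys] BA[OF ys] by (intro mult_mono) auto
      moreover have "\<bar>q * \<kappa>\<^sup>2 * (B y - A y)\<bar> \<le> (2 * \<kappa>\<^sup>2) * (\<epsilon> * L)"
        unfolding abs_mult using q BA[OF ys] by (intro mult_mono) auto
      moreover have "\<bar>(q - 1) * \<kappa>\<^sup>2 * A y\<bar> \<le> (\<epsilon> * \<kappa>\<^sup>2) * (M * L)"
        unfolding abs_mult using q Ab[OF ys] e by (intro mult_mono) auto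
      moreover have "\<bar>q * \<kappa> * (cos (\<kappa> * L) * U (\<sigma> L) y - U (\<sigma> 0) y)\<bar> \<le> (2 * \<bar>\<kappa>\<bar>) * (2 * \<epsilon>)"
      proof -
        \<comment> \<open>The Dirichlet condition at \<open>0\<close> and \<open>L\<close> enters
          here: the shrunk boundary values differ by at most \<open>\<epsilon>\<close> from values
          that are zero.\<close>
        have "\<bar>U (\<sigma> L) y\<bar> \<le> \<epsilon>" "\<bar>U (\<sigma> 0) y\<bar> \<le> \<epsilon>"
          using close\<sigma>[of L y] close\<sigma>[of 0 y] U0(1,2)[OF ys] L ys by auto
        moreover have "\<bar>cos (\<kappa> * L) * U (\<sigma> L) y\<bar> \<le> 1 * \<bar>U (\<sigma> L) y\<bar>"
          unfolding abs_mult by (intro mult_right_mono) auto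
        ultimately have "\<bar>cos (\<kappa> * L) * U (\<sigma> L) y - U (\<sigma> 0) y\<bar> \<le> 2 * \<epsilon>" by linarith
        then show ?thesis unfolding abs_mult[of _ "_ - _"] abs_mult[of q]
          using q by (intro mult_mono) auto
      qed
      ultimately show "\<bar>E\<bar> \<le> \<epsilon> * (2 * \<bar>\<mu>\<bar> * L + 2 * \<kappa>\<^sup>2 * L + \<kappa>\<^sup>2 * (M * L) + 4 * \<bar>\<kappa>\<bar>)"
        using E by (simp add: algebra_simps)
    qed (rule x)
    moreover have "\<bar>A x - F x\<bar> \<le> \<bar>B x - A x\<bar> + \<bar>B x - F x\<bar>" by linarith
    moreover have distrib: "(l + m * w) * \<epsilon> = \<epsilon> * l + \<epsilon> * m * w" for l m w by (simp add: algebra_simps)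
    ultimately show ?thesis using BA[OF x] unfolding K_def distrib by linarith
  qed
  have AF: "A x = F x" if x: "x \<in> strip" for x
  proof (rule ccontr)
    assume "A x \<noteq> F x"
    then have p: "\<bar>A x - F x\<bar> > 0" by simp
    have "K \<ge> 0" using close[OF x, of 1] p by linarith
    have "\<bar>A x - F x\<bar> \<le> K * (\<bar>A x - F x\<bar> / (K + 1))"
      by (rule close[OF x]) (use p \<open>K \<ge> 0\<close> in simp)
    also have "\<dots> < \<bar>A x - F x\<bar>"
      using p \<open>K \<ge> 0\<close> by (simp add: divide_less_eq distrib_left mult.commute)
    finally show False by simp
  qed
  show ?thesis
  proof (rule that)
    show "solves (potential \<mu> (\<kappa>\<^sup>2)) F F' strip"
      unfolding solves_def
    proof (intro ballI conjI)
      fix x assume x: "x \<in> strip"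
      show "(F has_real_derivative F' x) (at x)" by (rule F(1))
      show "(F' has_real_derivative - (potential \<mu> (\<kappa>\<^sup>2) x * F x)) (at x)"
        using F(2)[of x] by (simp add: G_def clamp_eq[OF x] AF[OF x])
    qed
    show "F (- half_width) = 0" "F half_width = 0" by (rule F)+
    show "F x = integral {0..L} (\<lambda>t. U t x * sin (\<kappa> * t))" if "x \<in> strip" for x
      using AF[OF that] by (simp add: A_def)
  qed
qed

section \<open>The first two eigenvalues\<close>

definition wave_number :: "real \<Rightarrow> nat \<Rightarrow> real" where
  "wave_number L k = real k * pi / L"

definition sine_coefficient :: "real \<Rightarrow> nat \<Rightarrow> ((real ^ 2) \<Rightarrow>\<^sub>C real) \<Rightarrow> real \<Rightarrow> real" where
  "sine_coefficient L k u x = integral {0..L} (\<lambda>t. apply_bcontfun u (polar t x) * sin (wave_number L k * t))"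

lemma sin_wave_number_end: "L > 0 \<Longrightarrow> sin (wave_number L k * L) = 0"
  by (simp add: wave_number_def)

lemma continuous_on_polar_slice:
  fixes u :: "(real ^ 2) \<Rightarrow>\<^sub>C real"
  shows "continuous_on S (\<lambda>t. apply_bcontfun u (polar t x))"
  by (rule continuous_on_compose2[OF continuous_on_apply_bcontfun[of UNIV]]) (auto intro!: continuous_intros)

lemma sine_coefficient_solves:
  assumes L: "L > 0" and u: "u \<in> dirichlet_eigenspace hyperbolic_metric (polar_rectangle L) \<mu>"
  obtains a a' where "solves (potential \<mu> ((wave_number L k)\<^sup>2)) a a' strip" "a (- half_width) = 0" "a half_width = 0"
    "\<And>x. x \<in> strip \<Longrightarrow> a x = sine_coefficient L k u x"
proof -
  let ?R = "{0<..<L} \<times> inner_strip"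
  obtain Ut Utt Ux Uxx where d:
    "\<And>t x. (t, x) \<in> ?R \<Longrightarrow>
      ((\<lambda>t. apply_bcontfun u (polar t x)) has_real_derivative Ut t x) (at t)"
    "\<And>t x. (t, x) \<in> ?R \<Longrightarrow> ((\<lambda>t. Ut t x) has_real_derivative Utt t x) (at t)"
    "\<And>t x. (t, x) \<in> ?R \<Longrightarrow>
      ((\<lambda>x. apply_bcontfun u (polar t x)) has_real_derivative Ux t x) (at x)"
    "\<And>t x. (t, x) \<in> ?R \<Longrightarrow> ((\<lambda>x. Ux t x) has_real_derivative Uxx t x) (at x)"
    "continuous_on (?R) (\<lambda>(t, x). Ux t x)"
    "continuous_on (?R) (\<lambda>(t, x). Uxx t x)"
    "\<And>t x. (t, x) \<in> ?R \<Longrightarrow>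
      Utt t x + Uxx t x = - (\<mu> / (cos x)\<^sup>2) * apply_bcontfun u (polar t x)"
    by (rule eigenfunction_polar_derivatives[OF u]) blast
  have off: "apply_bcontfun u p = 0" if "p \<notin> polar_rectangle L" for p
    using u that by (simp add: dirichlet_eigenspace_def)
  have c: "continuous_on ({0..L} \<times> strip) (\<lambda>(t, x). apply_bcontfun u (polar t x))"
    unfolding case_prod_beta
    by (rule continuous_on_compose2[OF continuous_on_apply_bcontfun[of UNIV]]) (auto intro!: continuous_intros)
  show ?thesis
  proof (rule sine_projection_solves[OF L sin_wave_number_end[OF L] c _ _ _ _ d refl])
    show "apply_bcontfun u (polar 0 x) = 0" "apply_bcontfun u (polar L x) = 0" if "x \<in> strip" for x
      using that by (auto intro!: off simp: polar_in_polar_rectangle)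
    show "apply_bcontfun u (polar t (- half_width)) = 0" "apply_bcontfun u (polar t half_width) = 0" for t
      using half_width_pos by (auto intro!: off simp: polar_in_polar_rectangle)
  next
    fix a a'
    assume "solves (potential \<mu> ((wave_number L k)\<^sup>2)) a a' strip" "a (- half_width) = 0" "a half_width = 0"
      "\<And>x. x \<in> strip \<Longrightarrow> a x = integral {0..L} (\<lambda>t. apply_bcontfun u (polar t x) * sin (wave_number L k * t))"
    then show ?thesis using that[of a a'] by (simp add: sine_coefficient_def)
  qed
qed

text \<open>Completeness of the sines on each ray of constant angle; outside the rectangle both
  functions are zero.\<close>

lemma sine_coefficient_eq_imp_eq:
  assumes L: "L > 0"
    and off: "\<And>p. p \<notin> polar_rectangle L \<Longrightarrow> apply_bcontfun u p = 0" "\<And>p. p \<notin> polar_rectangle L \<Longrightarrow> apply_bcontfun w p = 0"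
    and eq: "\<And>k x. x \<in> strip \<Longrightarrow> sine_coefficient L k u x = sine_coefficient L k w x"
  shows "u = w"
proof (rule bcontfun_eqI)
  fix p
  show "apply_bcontfun u p = apply_bcontfun w p"
  proof (cases "p \<in> polar_rectangle L")
    case True
    then have p2: "p $ 2 > 0" by (auto simp: polar_rectangle_def)
    define t where "t = log_radius p"
    define x where "x = angle p"
    have x: "x \<in> strip"
      unfolding x_def by (rule angle_in_strip[OF _ p2]) (use True in \<open>auto simp: polar_rectangle_def\<close>)
    have pp: "polar t x = p" using polar_log_radius_angle[OF p2] by (simp add: t_def x_def)
    have t: "t \<in> {0<..<L}" using True polar_in_polar_rectangle[OF x, of t L] by (simp add: pp)
    have "apply_bcontfun u (polar t x) - apply_bcontfun w (polar t x) = 0"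
    proof (rule sine_coefficients_determine[OF _ L _ t, where f = "\<lambda>t. apply_bcontfun u (polar t x) - apply_bcontfun w (polar t x)"])
      show "continuous_on {0..L} (\<lambda>t. apply_bcontfun u (polar t x) - apply_bcontfun w (polar t x))"
        by (intro continuous_on_diff continuous_on_polar_slice)
      fix k
      have int: "(\<lambda>t. apply_bcontfun v (polar t x) * sin (wave_number L k * t)) integrable_on {0..L}" for v
        by (intro integrable_continuous_interval continuous_on_mult continuous_on_polar_slice continuous_intros)
      have "integral {0..L} (\<lambda>t. (apply_bcontfun u (polar t x) - apply_bcontfun w (polar t x)) * sin (real k * (pi * t / L)))
          = integral {0..L} (\<lambda>t. apply_bcontfun u (polar t x) * sin (wave_number L k * t) -
              apply_bcontfun w (polar t x) * sin (wave_number L k * t))"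
        by (rule integral_cong) (simp add: wave_number_def left_diff_distrib mult.assoc)
      also have "\<dots> = sine_coefficient L k u x - sine_coefficient L k w x"
        unfolding sine_coefficient_def by (rule Henstock_Kurzweil_Integration.integral_diff[OF int int])
      finally show "integral {0..L} (\<lambda>t. (apply_bcontfun u (polar t x) - apply_bcontfun w (polar t x)) * sin (real k * (pi * t / L))) = 0"
        using eq[OF x] by simp
    qed
    then show ?thesis by (simp add: pp)
  qed (simp add: off)
qed

text \<open>The \<open>k\<close>-th coefficient of any eigenfunction is proportional to
  \<open>h\<close>, as is that of the separated eigenfunction \<open>w\<close>. All other
  coefficients vanish, so a multiple of \<open>w\<close> has the same coefficients and is the same
  function.\<close>

lemma dim_one_if_other_coefficients_vanish:
  assumes L: "L > 0" and k: "k > 0" and mu: "\<mu> \<le> 5"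
    and h: "solves (potential \<mu> ((wave_number L k)\<^sup>2)) h h' strip" "h 0 = 1" "h (- half_width) = 0" "h half_width = 0"
    and others: "\<And>u j x. u \<in> dirichlet_eigenspace hyperbolic_metric (polar_rectangle L) \<mu> \<Longrightarrow>
      j \<noteq> k \<Longrightarrow> x \<in> strip \<Longrightarrow> sine_coefficient L j u x = 0"
  shows "\<mu> \<in> dirichlet_spectrum hyperbolic_metric (polar_rectangle L)"
    and "\<exists>B. finite B \<and> dirichlet_eigenspace hyperbolic_metric (polar_rectangle L) \<mu> \<subseteq> span B"
    and "dim (dirichlet_eigenspace hyperbolic_metric (polar_rectangle L) \<mu>) = 1"
proof -
  let ?E = "dirichlet_eigenspace hyperbolic_metric (polar_rectangle L) \<mu>"
  define \<kappa> where "\<kappa> = wave_number L k"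
  have kp: "\<kappa> > 0" using L k by (simp add: \<kappa>_def wave_number_def)
  obtain w where w: "w \<in> ?E" "\<And>t x. t \<in> {0..L} \<Longrightarrow> x \<in> strip \<Longrightarrow> apply_bcontfun w (polar t x) = sin (\<kappa> * t) * h x"
    using separated_eigenfunction[OF h(1,3,4) sin_wave_number_end[OF L]] unfolding \<kappa>_def by blast
  define S where "S = integral {0..L} (\<lambda>t. (sin (\<kappa> * t))\<^sup>2)"
  have cw: "sine_coefficient L k w x = S * h x" if "x \<in> strip" for x
  proof -
    have "sine_coefficient L k w x = integral {0..L} (\<lambda>t. (sin (\<kappa> * t))\<^sup>2 * h x)"
      unfolding sine_coefficient_def \<kappa>_def[symmetric]
      by (rule integral_cong) (simp add: w(2)[OF _ that] power2_eq_square)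
    then show ?thesis by (simp add: S_def)
  qed
  have zero: "(0 :: real) \<in> strip" using half_width_pos by simp
  have w0: "w \<noteq> 0"
  proof
    assume "w = 0"
    \<comment> \<open>\<open>pi / (2 * \<kappa>)\<close> is the first crest of the sine, and at
      angle 0 \<open>h\<close> is normalized to 1.\<close>
    then have "apply_bcontfun w (polar (pi / (2 * \<kappa>)) 0) = 0" by simp
    moreover have "pi / (2 * \<kappa>) \<in> {0..L}"
    proof -
      have "pi / (2 * \<kappa>) = L / (2 * real k)" using L k by (simp add: \<kappa>_def wave_number_def)
      also have "\<dots> \<le> L / 1" using L k by (intro divide_left_mono) auto
      finally show ?thesis using kp by simp
    qed
    ultimately have "sin (\<kappa> * (pi / (2 * \<kappa>))) * h 0 = 0" using w(2)[OF _ zero] by metis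
    then show False using kp h(2) by simp
  qed
  \<comment> \<open>The integral need not be computed: if it were zero, all sine coefficients of
    \<open>w\<close> would vanish.\<close>
  have S: "S \<noteq> 0"
  proof
    assume "S = 0"
    have "w = 0"
    proof (rule sine_coefficient_eq_imp_eq[OF L])
      fix j x assume x: "x \<in> strip"
      have "sine_coefficient L j w x = 0"
        using others[OF w(1) _ x, of j] cw[OF x] \<open>S = 0\<close> by (cases "j = k") auto
      then show "sine_coefficient L j w x = sine_coefficient L j 0 x" by (simp add: sine_coefficient_def)
    qed (use w(1) in \<open>auto simp: dirichlet_eigenspace_def\<close>)
    then show False using w0 by simp
  qed
  have sub: "?E \<subseteq> span {w}"
  proof
    fix u assume u: "u \<in> ?E"
    obtain a a' where a: "solves (potential \<mu> ((wave_number L k)\<^sup>2)) a a' strip" "a (- half_width) = 0" "a half_width = 0"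
      "\<And>x. x \<in> strip \<Longrightarrow> a x = sine_coefficient L k u x"
      by (rule sine_coefficient_solves[OF L u]) blast
    define c where "c = a 0 / S"
    have cs: "sine_coefficient L j (c *\<^sub>R w) x = c * sine_coefficient L j w x" for j x
      by (simp add: sine_coefficient_def scaleR_bcontfun.rep_eq mult.assoc)
    have "u = c *\<^sub>R w"
    proof (rule sine_coefficient_eq_imp_eq[OF L])
      fix j x assume x: "x \<in> strip"
      show "sine_coefficient L j u x = sine_coefficient L j (c *\<^sub>R w) x"
      proof (cases "j = k")
        case True
        have "sine_coefficient L k u x = a 0 * h x"
          using solution_proportional[OF a(1) mu zero_le_power2 a(2,3) h(1,3,4,2) x] a(4)[OF x] by simp
        moreover have "c * S = a 0" using S by (simp add: c_def)
        ultimately show ?thesis by (simp add: True cs cw[OF x] mult.assoc[symmetric])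
      next
        case False
        then show ?thesis using others[OF u False x] others[OF w(1) False x] by (simp add: cs)
      qed
    qed (use u w(1) in \<open>auto simp: dirichlet_eigenspace_def scaleR_bcontfun.rep_eq\<close>)
    then show "u \<in> span {w}" by (simp add: span_base span_scale)
  qed
  then show "\<exists>B. finite B \<and> ?E \<subseteq> span B" by blast
  show "dim ?E = 1"
    by (rule real_vector.dim_unique[OF _ sub]) (use w(1) w0 in auto)
  show "\<mu> \<in> dirichlet_spectrum hyperbolic_metric (polar_rectangle L)"
    using w(1) w0 by (auto simp: dirichlet_spectrum_def)
qed

text \<open>Up to \<open>\<mu>2\<close> the spectrum consists of exactly two simple eigenvalues.
  This settles at once the finiteness conditions and the counts in
  \<open>is_dirichlet_eigenvalue\<close>.\<close>

lemma polar_rectangle_eigenvalues: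
  assumes L: "L > 8"
  obtains \<mu>1 \<mu>2 where "is_dirichlet_eigenvalue hyperbolic_metric (polar_rectangle L) 1 \<mu>1"
    "is_dirichlet_eigenvalue hyperbolic_metric (polar_rectangle L) 2 \<mu>2"
    "(1 + 1 / 200) * (\<mu>2 - \<mu>1) < 3 * pi\<^sup>2 / L\<^sup>2"
proof -
  let ?g = hyperbolic_metric and ?\<Omega> = "polar_rectangle L"
  define \<nu> where "\<nu> = (\<lambda>k. (wave_number L k)\<^sup>2)"
  have L0: "L > 0" using L by simp
  have \<nu>_mono: "\<nu> j < \<nu> k" if "j < k" for j k
    unfolding \<nu>_def wave_number_def using that L0
    by (intro power_strict_mono divide_strict_right_mono mult_strict_right_mono) auto
  have \<nu>0: "\<nu> k \<ge> 0" for k by (simp add: \<nu>_def)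
  \<comment> \<open>Here \<open>L > 8\<close> is used, together with \<open>pi < 4\<close>;
    principal pairs are available for \<open>\<nu> < 1\<close>.\<close>
  have \<nu>2: "\<nu> 2 < 1"
    unfolding \<nu>_def wave_number_def using L pi_less_4 by (simp add: abs_square_less_1 divide_less_eq)
  have \<nu>1: "\<nu> 1 < 1" using \<nu>_mono[of 1 2] \<nu>2 by simp
  obtain \<mu>1 h\<^sub>1 h\<^sub>1' where h1: "1 < \<mu>1" "\<mu>1 \<le> 5" "solves (potential \<mu>1 (\<nu> 1)) h\<^sub>1 h\<^sub>1' strip" "h\<^sub>1 0 = 1" "h\<^sub>1' 0 = 0"
    "h\<^sub>1 (- half_width) = 0" "h\<^sub>1 half_width = 0" "\<And>x. x \<in> inner_strip \<Longrightarrow> h\<^sub>1 x > 0"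
    by (rule principal_eigenpair_exists[OF \<nu>0 \<nu>1]) blast
  obtain \<mu>2 h\<^sub>2 h\<^sub>2' where h2: "1 < \<mu>2" "\<mu>2 \<le> 5" "solves (potential \<mu>2 (\<nu> 2)) h\<^sub>2 h\<^sub>2' strip" "h\<^sub>2 0 = 1" "h\<^sub>2' 0 = 0"
    "h\<^sub>2 (- half_width) = 0" "h\<^sub>2 half_width = 0" "\<And>x. x \<in> inner_strip \<Longrightarrow> h\<^sub>2 x > 0"
    by (rule principal_eigenpair_exists[OF \<nu>0 \<nu>2]) blast
  have gap: "\<mu>1 < \<mu>2" "(1 + 1 / 200) * (\<mu>2 - \<mu>1) < \<nu> 2 - \<nu> 1"
    using principal_gap_bound[OF h1(3,4,5,7,8) _ _ h2(3,4,5,7,8)] h1(1) h2(1) \<nu>1 \<nu>2 \<nu>_mono[of 1 2] by auto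
  \<comment> \<open>Modes 1 and 2 are compared with their own principal solution at another
    parameter, all higher modes with \<open>h\<^sub>2\<close>, since
    \<open>\<mu> \<le> \<mu>2\<close>. Mode 0 is trivial because its sine is zero.\<close>
  have vanish: "sine_coefficient L k u x = 0"
    if u: "u \<in> dirichlet_eigenspace ?g ?\<Omega> \<mu>" and mu: "\<mu> \<le> \<mu>2" and k: "k = 1 \<Longrightarrow> \<mu> \<noteq> \<mu>1" "k = 2 \<Longrightarrow> \<mu> \<noteq> \<mu>2"
      and x: "x \<in> strip" for u \<mu> k x
  proof -
    obtain a a' where a: "solves (potential \<mu> (\<nu> k)) a a' strip" "a (- half_width) = 0" "a half_width = 0"
      "\<And>x. x \<in> strip \<Longrightarrow> a x = sine_coefficient L k u x"
      unfolding \<nu>_def by (rule sine_coefficient_solves[OF L0 u]) blast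
    have mu5: "\<mu> \<le> 5" using mu h2(2) by simp
    consider "k = 0" | "k = 1" | "k = 2" | "k > 2" by linarith
    then show ?thesis
    proof cases
      case 1
      then show ?thesis by (simp add: sine_coefficient_def wave_number_def)
    next
      case 2
      have "a x = 0"
        by (rule solution_zero_if_potential_ordered[OF a(1) mu5 \<nu>0 a(2,3) h1(3,6,7,8) _ x]) (use 2 k in auto)
      then show ?thesis using a(4)[OF x] by simp
    next
      case 3
      have "a x = 0"
        by (rule solution_zero_if_potential_ordered[OF a(1) mu5 \<nu>0 a(2,3) h2(3,6,7,8) _ x]) (use 3 k in auto)
      then show ?thesis using a(4)[OF x] by simp
    next
      case 4
      have "a x = 0"
        by (rule solution_zero_if_potential_ordered[OF a(1) mu5 \<nu>0 a(2,3) h2(3,6,7,8) _ x]) (use 4 mu \<nu>_mono in auto)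
      then show ?thesis using a(4)[OF x] by simp
    qed
  qed
  have trivial: "u = 0" if u: "u \<in> dirichlet_eigenspace ?g ?\<Omega> \<mu>" and mu: "\<mu> \<le> \<mu>2" "\<mu> \<noteq> \<mu>1" "\<mu> \<noteq> \<mu>2" for u \<mu>
  proof (rule sine_coefficient_eq_imp_eq[OF L0])
    show "sine_coefficient L k u x = sine_coefficient L k 0 x" if "x \<in> strip" for k x
      using vanish[OF u mu(1) _ _ that] mu(2,3) by (simp add: sine_coefficient_def)
  qed (use u in \<open>auto simp: dirichlet_eigenspace_def\<close>)
  note E1 = dim_one_if_other_coefficients_vanish[OF L0 _ h1(2) h1(3)[unfolded \<nu>_def] h1(4,6,7)]
  note E2 = dim_one_if_other_coefficients_vanish[OF L0 _ h2(2) h2(3)[unfolded \<nu>_def] h2(4,6,7)]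
  have van1: "sine_coefficient L j u x = 0"
    if "u \<in> dirichlet_eigenspace ?g ?\<Omega> \<mu>1" "j \<noteq> 1" "x \<in> strip" for u j x
    by (rule vanish[OF that(1) _ _ _ that(3)]) (use gap that(2) in auto)
  have van2: "sine_coefficient L j u x = 0"
    if "u \<in> dirichlet_eigenspace ?g ?\<Omega> \<mu>2" "j \<noteq> 2" "x \<in> strip" for u j x
    by (rule vanish[OF that(1) _ _ _ that(3)]) (use gap that(2) in auto)
  have s1: "\<mu>1 \<in> dirichlet_spectrum ?g ?\<Omega>" "\<exists>B. finite B \<and> dirichlet_eigenspace ?g ?\<Omega> \<mu>1 \<subseteq> span B"
      "dim (dirichlet_eigenspace ?g ?\<Omega> \<mu>1) = 1"
    and s2: "\<mu>2 \<in> dirichlet_spectrum ?g ?\<Omega>" "\<exists>B. finite B \<and> dirichlet_eigenspace ?g ?\<Omega> \<mu>2 \<subseteq> span B"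
      "dim (dirichlet_eigenspace ?g ?\<Omega> \<mu>2) = 1"
    using E1[OF _ van1] E2[OF _ van2] by simp_all
  have spec: "\<mu> \<in> dirichlet_spectrum ?g ?\<Omega> \<longleftrightarrow> \<mu> = \<mu>1 \<or> \<mu> = \<mu>2" if "\<mu> \<le> \<mu>2" for \<mu>
    using trivial[OF _ that] s1(1) s2(1) by (auto simp: dirichlet_spectrum_def)
  have sets: "dirichlet_spectrum ?g ?\<Omega> \<inter> {..<\<mu>1} = {}" "dirichlet_spectrum ?g ?\<Omega> \<inter> {..\<mu>1} = {\<mu>1}"
    "dirichlet_spectrum ?g ?\<Omega> \<inter> {..<\<mu>2} = {\<mu>1}" "dirichlet_spectrum ?g ?\<Omega> \<inter> {..\<mu>2} = {\<mu>1, \<mu>2}"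
    using spec gap(1) by (force simp: set_eq_iff)+
  have fin: "\<exists>B. finite B \<and> dirichlet_eigenspace ?g ?\<Omega> \<mu> \<subseteq> span B" if "\<mu> \<le> \<mu>2" for \<mu>
  proof (cases "\<mu> = \<mu>1 \<or> \<mu> = \<mu>2")
    case False
    then have "dirichlet_eigenspace ?g ?\<Omega> \<mu> \<subseteq> span {}" using trivial[OF _ that] by auto
    then show ?thesis by blast
  qed (use s1(2) s2(2) in auto)
  show ?thesis
  proof
    show "is_dirichlet_eigenvalue ?g ?\<Omega> 1 \<mu>1"
      unfolding is_dirichlet_eigenvalue_def multiplicity_sum_def sets
      using s1 fin gap(1) by auto
    show "is_dirichlet_eigenvalue ?g ?\<Omega> 2 \<mu>2"
      unfolding is_dirichlet_eigenvalue_def multiplicity_sum_def sets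
      using s1 s2 fin gap(1) by auto
    have "\<nu> 2 - \<nu> 1 = 3 * pi\<^sup>2 / L\<^sup>2"
      by (simp add: \<nu>_def wave_number_def power_divide power_mult_distrib diff_divide_distrib[symmetric])
    then show "(1 + 1 / 200) * (\<mu>2 - \<mu>1) < 3 * pi\<^sup>2 / L\<^sup>2" using gap(2) by simp
  qed
qed

theorem theorem1p1:
  shows "\<exists>(\<Omega> :: (real ^ 2) set) (lam1 :: real) (lam2 :: real).
    hyperbolic_domain \<Omega> \<and> hyperbolic_convex \<Omega> \<and>
    is_dirichlet_eigenvalue hyperbolic_metric \<Omega> 1 lam1 \<and>
    is_dirichlet_eigenvalue hyperbolic_metric \<Omega> 2 lam2 \<and>
    lam2 - lam1 < 3 * pi\<^sup>2 / (hyperbolic_diameter \<Omega>)\<^sup>2"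
proof -
  \<comment> \<open>Chosen so that \<open>2003\<^sup>2 \<le> (1 + 1 / 200) * 2000\<^sup>2\<close>:
    the excess 3 of the diameter over \<open>L\<close> costs less than the factor
    \<open>1 + 1 / 200\<close> gains.\<close>
  define L :: real where "L = 2000"
  define D where "D = hyperbolic_diameter (polar_rectangle L)"
  have D: "0 < D" "D \<le> 2003"
    using hyperbolic_diameter_polar_rectangle[of L] by (auto simp: D_def L_def)
  obtain \<mu>1 \<mu>2 where mu: "is_dirichlet_eigenvalue hyperbolic_metric (polar_rectangle L) 1 \<mu>1"
    "is_dirichlet_eigenvalue hyperbolic_metric (polar_rectangle L) 2 \<mu>2"
    "(1 + 1 / 200) * (\<mu>2 - \<mu>1) < 3 * pi\<^sup>2 / L\<^sup>2"
    by (rule polar_rectangle_eigenvalues[of L]) (auto simp: L_def)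
  have "D\<^sup>2 \<le> 2003\<^sup>2" using D by (intro power_mono) auto
  then have "D\<^sup>2 \<le> (1 + 1 / 200) * L\<^sup>2" by (simp add: L_def power2_eq_square)
  then have "3 * pi\<^sup>2 / ((1 + 1 / 200) * L\<^sup>2) \<le> 3 * pi\<^sup>2 / D\<^sup>2"
    using D(1) by (intro divide_left_mono) (auto simp: L_def)
  moreover have "\<mu>2 - \<mu>1 < 3 * pi\<^sup>2 / ((1 + 1 / 200) * L\<^sup>2)"
    using mu(3) by (simp add: L_def field_simps)
  ultimately have "\<mu>2 - \<mu>1 < 3 * pi\<^sup>2 / D\<^sup>2" by linarith
  then show ?thesis
    using mu(1,2) hyperbolic_domain_polar_rectangle[of L] hyperbolic_convex_polar_rectangle[of L]
    by (auto simp: D_def L_def)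
qed

end
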